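(* Let $H_1,H_2$ be Hilbert spaces and let $\mathcal{A}\subset B(H_1)$ and $\mathcal{B}\subset B(H_2)$ be unital operator algebras. Assume that there exists a unital completely bounded isomorphism $\theta:\mathcal{F}\to\mathcal{A}$ where $\mathcal{F}$ is a uniform algebra. Let $\varphi:\mathcal{A}\to\mathcal{B}$ be a unital completely bounded isomorphism. Then there exist two invertible operators $X\in B(H_1)$ and $Y\in B(H_2)$ such that the map $$XaX^{-1}\mapsto Y\varphi(a)Y^{-1}$$ (from $X\mathcal{A}X^{-1}$ onto $Y\mathcal{B}Y^{-1}$) is completely isometric.
   Context: A unital operator algebra $\mathcal{A}\subset B(H)$ is a (not necessarily self-adjoint) subalgebra of $B(H)$ containing the identity operator, with the matrix norms on $M_d(\mathcal{A})$ inherited from $M_d(B(H))=B(H^{d})$. A linear map $\psi$ is completely bounded if its amplifications $(a_{ij})\mapsto(\psi(a_{ij}))$ on $M_d$ are bounded uniformly in $d$, and completely isometric if all these amplifications are isometric. A unital completely bounded isomorphism is a bijective unital completely bounded algebra homomorphism whose inverse is also completely bounded. A uniform algebra is a closed unital subalgebra of a commutative (unital) $C^*$-algebra, with the inherited matrix norms. *)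

theory Defs
  imports "HOL-Analysis.Analysis"
begin

text \<open>
  Complex Hilbert spaces. The underlying real Hilbert space structure is the one of
  \<open>real_inner\<close>, tied to the complex one by \<open>inner_eq_Re_cinner\<close>; in particular the norm is the one
  of the complex inner product. The inner product is linear in its first argument. The zero
  space is allowed.
\<close>

class complex_inner = real_inner +
  fixes scaleC :: "complex \<Rightarrow> 'a \<Rightarrow> 'a" (infixr \<open>*\<^sub>C\<close> 75)
    and cinner :: "'a \<Rightarrow> 'a \<Rightarrow> complex"
  assumes scaleC_add_right: "c *\<^sub>C (x + y) = c *\<^sub>C x + c *\<^sub>C y"
    and scaleC_add_left: "(c + d) *\<^sub>C x = c *\<^sub>C x + d *\<^sub>C x"
    and scaleC_scaleC: "c *\<^sub>C d *\<^sub>C x = (c * d) *\<^sub>C x"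
    and scaleC_of_real: "complex_of_real r *\<^sub>C x = r *\<^sub>R x"
    and cinner_commute: "cinner y x = cnj (cinner x y)"
    and cinner_add_left: "cinner (x + y) z = cinner x z + cinner y z"
    and cinner_scaleC_left: "cinner (c *\<^sub>C x) y = c * cinner x y"
    and inner_eq_Re_cinner: "inner x y = Re (cinner x y)"

class chilbert_space = complex_inner + complete_space

instantiation complex :: chilbert_space
begin
definition scaleC_complex :: "complex \<Rightarrow> complex \<Rightarrow> complex"
  where "scaleC_complex c x = c * x"
definition cinner_complex :: "complex \<Rightarrow> complex \<Rightarrow> complex"
  where "cinner_complex x y = x * cnj y"
instance
  by standard
    (auto simp: scaleC_complex_def cinner_complex_def inner_complex_def algebra_simps scaleR_conv_of_real)
end

lemma norm_scaleC: "norm (c *\<^sub>C x) = cmod c * norm (x :: 'a::complex_inner)"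
proof -
  have r: "cinner (c *\<^sub>C x) (c *\<^sub>C x) = c * cnj c * cinner x x"
    by (metis cinner_commute cinner_scaleC_left complex_cnj_mult mult.assoc)
  have c: "c * cnj c = complex_of_real ((cmod c)\<^sup>2)"
    by (rule complex_norm_square[symmetric])
  have "(norm (c *\<^sub>C x))\<^sup>2 = (cmod c * norm x)\<^sup>2"
    unfolding power_mult_distrib power2_norm_eq_inner inner_eq_Re_cinner r c
    by (simp del: of_real_power)
  then show ?thesis
    by (simp add: power2_eq_iff_nonneg)
qed

lift_definition scaleC_op ::
    "complex \<Rightarrow> ('a::real_normed_vector \<Rightarrow>\<^sub>L 'b::complex_inner) \<Rightarrow> ('a \<Rightarrow>\<^sub>L 'b)"
  is "\<lambda>c f x. c *\<^sub>C f x"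
proof -
  fix c :: complex and f :: "'a \<Rightarrow> 'b"
  assume f: "bounded_linear f"
  have "c *\<^sub>C r *\<^sub>R y = r *\<^sub>R c *\<^sub>C y" for r and y :: 'b
    by (simp add: scaleC_scaleC mult.commute flip: scaleC_of_real)
  then have "bounded_linear (\<lambda>y::'b. c *\<^sub>C y)"
    by (intro bounded_linear_intro[where K = "cmod c"])
      (auto simp: scaleC_add_right norm_scaleC mult.commute)
  then show "bounded_linear (\<lambda>x. c *\<^sub>C f x)"
    by (rule bounded_linear_compose[OF _ f])
qed

text \<open>
  \<open>B(H)\<close>. The type \<open>'a \<Rightarrow>\<^sub>L 'a\<close> consists of the bounded real-linear operators, with the operator norm.
\<close>

definition bounded_ops :: "('a::complex_inner \<Rightarrow>\<^sub>L 'a) set"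
  where "bounded_ops = {T. \<forall>c x. blinfun_apply T (c *\<^sub>C x) = c *\<^sub>C blinfun_apply T x}"

text \<open>
  The norm of \<open>M\<^sub>d(B(H)) = B(H\<^sup>d)\<close>. Vectors in \<open>H\<^sup>d\<close> and \<open>d \<times> d\<close> matrices are functions on \<open>nat\<close>,
  of which only the values at indices below \<open>d\<close> are used.
\<close>

definition mat_norm ::
    "nat \<Rightarrow> (nat \<Rightarrow> nat \<Rightarrow> ('a::real_normed_vector \<Rightarrow>\<^sub>L 'b::real_normed_vector)) \<Rightarrow> real"
  where "mat_norm d T =
    (SUP x \<in> {x. L2_set (\<lambda>j. norm (x j)) {..<d} \<le> 1}.
      L2_set (\<lambda>i. norm (\<Sum>j<d. T i j (x j))) {..<d})"

lemma bdd_above_mat_norm: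
  fixes T :: "nat \<Rightarrow> nat \<Rightarrow> ('a::real_normed_vector \<Rightarrow>\<^sub>L 'b::real_normed_vector)"
  shows "bdd_above ((\<lambda>x. L2_set (\<lambda>i. norm (\<Sum>j<d. T i j (x j))) {..<d})
    ` {x. L2_set (\<lambda>j. norm (x j)) {..<d} \<le> 1})"
proof (rule bdd_aboveI2)
  fix x :: "nat \<Rightarrow> 'a"
  assume "x \<in> {x. L2_set (\<lambda>j. norm (x j)) {..<d} \<le> 1}"
  then have "norm (x j) \<le> 1" if "j < d" for j
    using member_le_L2_set[of "{..<d}" j "\<lambda>j. norm (x j)"] that by simp
  then have "norm (T i j (x j)) \<le> norm (T i j)" if "j < d" for i j
    by (metis mult.right_neutral mult_left_mono norm_blinfun norm_ge_zero order_trans that)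
  then have "norm (\<Sum>j<d. T i j (x j)) \<le> (\<Sum>j<d. norm (T i j))" for i
    by (intro sum_norm_le) simp
  then show "L2_set (\<lambda>i. norm (\<Sum>j<d. T i j (x j))) {..<d}
      \<le> L2_set (\<lambda>i. \<Sum>j<d. norm (T i j)) {..<d}"
    by (intro L2_set_mono) auto
qed

definition unital_operator_algebra :: "('a::complex_inner \<Rightarrow>\<^sub>L 'a) set \<Rightarrow> bool"
  where "unital_operator_algebra A \<longleftrightarrow>
    A \<subseteq> bounded_ops \<and>
    id_blinfun \<in> A \<and>
    (\<forall>S\<in>A. \<forall>T\<in>A. S + T \<in> A) \<and>
    (\<forall>c. \<forall>T\<in>A. scaleC_op c T \<in> A) \<and>
    (\<forall>S\<in>A. \<forall>T\<in>A. S o\<^sub>L T \<in> A)"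

definition is_adjoint :: "('a::complex_inner \<Rightarrow>\<^sub>L 'a) \<Rightarrow> ('a \<Rightarrow>\<^sub>L 'a) \<Rightarrow> bool"
  where "is_adjoint T S \<longleftrightarrow> (\<forall>x y. cinner (T x) y = cinner x (S y))"

text \<open>
  \<open>C\<^sup>*\<close>-algebras are taken concretely, as norm-closed self-adjoint algebras of operators on a
  Hilbert space; this is also what gives them, and hence uniform algebras, their matrix norms.
\<close>

definition commutative_unital_cstar_algebra :: "('a::chilbert_space \<Rightarrow>\<^sub>L 'a) set \<Rightarrow> bool"
  where "commutative_unital_cstar_algebra C \<longleftrightarrow>
    unital_operator_algebra C \<and>
    closed C \<and>
    (\<forall>T\<in>C. \<exists>S\<in>C. is_adjoint T S) \<and>
    (\<forall>S\<in>C. \<forall>T\<in>C. S o\<^sub>L T = T o\<^sub>L S)"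

definition uniform_algebra :: "('a::chilbert_space \<Rightarrow>\<^sub>L 'a) set \<Rightarrow> bool"
  where "uniform_algebra F \<longleftrightarrow>
    unital_operator_algebra F \<and> closed F \<and>
    (\<exists>C. commutative_unital_cstar_algebra C \<and> F \<subseteq> C)"

definition op_linear_on ::
    "('a::complex_inner \<Rightarrow>\<^sub>L 'a) set \<Rightarrow> (('a \<Rightarrow>\<^sub>L 'a) \<Rightarrow> ('b::complex_inner \<Rightarrow>\<^sub>L 'b)) \<Rightarrow> bool"
  where "op_linear_on A \<psi> \<longleftrightarrow>
    (\<forall>S\<in>A. \<forall>T\<in>A. \<psi> (S + T) = \<psi> S + \<psi> T) \<and>
    (\<forall>c. \<forall>T\<in>A. \<psi> (scaleC_op c T) = scaleC_op c (\<psi> T))"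

definition completely_bounded_on ::
    "('a::complex_inner \<Rightarrow>\<^sub>L 'a) set \<Rightarrow> (('a \<Rightarrow>\<^sub>L 'a) \<Rightarrow> ('b::complex_inner \<Rightarrow>\<^sub>L 'b)) \<Rightarrow> bool"
  where "completely_bounded_on A \<psi> \<longleftrightarrow>
    op_linear_on A \<psi> \<and>
    (\<exists>K. \<forall>d T. (\<forall>i<d. \<forall>j<d. T i j \<in> A) \<longrightarrow>
      mat_norm d (\<lambda>i j. \<psi> (T i j)) \<le> K * mat_norm d T)"

definition completely_isometric_on ::
    "('a::complex_inner \<Rightarrow>\<^sub>L 'a) set \<Rightarrow> (('a \<Rightarrow>\<^sub>L 'a) \<Rightarrow> ('b::complex_inner \<Rightarrow>\<^sub>L 'b)) \<Rightarrow> bool"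
  where "completely_isometric_on A \<psi> \<longleftrightarrow>
    op_linear_on A \<psi> \<and>
    (\<forall>d T. (\<forall>i<d. \<forall>j<d. T i j \<in> A) \<longrightarrow>
      mat_norm d (\<lambda>i j. \<psi> (T i j)) = mat_norm d T)"

definition unital_cb_isomorphism ::
    "('a::complex_inner \<Rightarrow>\<^sub>L 'a) set \<Rightarrow> ('b::complex_inner \<Rightarrow>\<^sub>L 'b) set
      \<Rightarrow> (('a \<Rightarrow>\<^sub>L 'a) \<Rightarrow> ('b \<Rightarrow>\<^sub>L 'b)) \<Rightarrow> bool"
  where "unital_cb_isomorphism A B \<psi> \<longleftrightarrow>
    bij_betw \<psi> A B \<and>
    \<psi> id_blinfun = id_blinfun \<and>
    (\<forall>S\<in>A. \<forall>T\<in>A. \<psi> (S o\<^sub>L T) = \<psi> S o\<^sub>L \<psi> T) \<and>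
    completely_bounded_on A \<psi> \<and>
    completely_bounded_on B (inv_into A \<psi>)"

definition inverse_ops :: "('a::complex_inner \<Rightarrow>\<^sub>L 'a) \<Rightarrow> ('a \<Rightarrow>\<^sub>L 'a) \<Rightarrow> bool"
  where "inverse_ops X X' \<longleftrightarrow>
    X \<in> bounded_ops \<and> X' \<in> bounded_ops \<and>
    X o\<^sub>L X' = id_blinfun \<and> X' o\<^sub>L X = id_blinfun"

end

theory Submission
  imports Defs
begin

text \<open>
  The map is completely isometric because both of its sides can be made completely isometric copies
of the uniform algebra \<open>F\<close>. Both \<open>\<theta>\<close> and \<open>\<phi> \<circ> \<theta>\<close> are
completely bounded unital homomorphisms of \<open>F\<close> that are bounded below, and
\<open>uniform_algebra_similarity\<close> says that such a homomorphism \<open>\<rho>\<close> becomes completely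
isometric after conjugation by an invertible operator. This has three ingredients.

  \<^item> \<^emph>\<open>Paulsen's similarity theorem\<close> (\<open>similar_to_completely_contractive\<close>): some
    \<open>\<sigma> = X \<rho>(\<cdot>) X'\<close>, with \<open>X'\<close> the inverse of \<open>X\<close>, is
    completely contractive. What is needed is an equivalent Hilbert norm \<open>sqrt q\<close> on the space of
    \<open>\<rho>\<close> such that \<open>\<Sum>\<^sub>i q (\<Sum>\<^sub>j \<rho>(f\<^sub>i\<^sub>j) y\<^sub>j) \<le> \<Sum>\<^sub>j q (y\<^sub>j)\<close>
    for every contractive matrix over \<open>F\<close>. These inequalities are linear in \<open>q\<close>. They say that
    \<open>q\<close> is monotone for an additive preorder on finite multisets of vectors, and complete
    boundedness says that \<open>\<parallel>x\<parallel>\<^sup>2\<close> on the smaller side is dominated by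
    \<open>K\<^sup>2\<parallel>y\<parallel>\<^sup>2\<close> on the larger one. The Hahn-Banach type theorem
    \<open>monotone_sandwich\<close> then provides \<open>q\<close> between the two. Applied to scalar matrices, which belong
    to \<open>F\<close>, monotonicity gives the parallelogram law, so \<open>q\<close> is automatically Hilbertian. The
    square root of the operator that represents \<open>q\<close> is, up to a scalar, the required \<open>X\<close>.

  \<^item> \<^emph>\<open>\<open>\<sigma>\<close> does not decrease norms.\<close> Elements of a commutative \<open>C\<^sup>*\<close>-algebra satisfy
    \<open>\<parallel>f\<^sup>2\<parallel> = \<parallel>f\<parallel>\<^sup>2\<close>, while \<open>\<sigma>\<close> is multiplicative and bounded below. Comparing the powers
    \<open>f ^ (2 ^ k)\<close> removes the lower bound's constant.

  \<^item> \<^emph>\<open>Matrix norms over a commutative \<open>C\<^sup>*\<close>-algebra are determined by scalar compressions\<close>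
    (\<open>mat_norm_le_scalar_compressions\<close>): the norm of a matrix \<open>(T\<^sub>i\<^sub>j)\<close> is the supremum of the norms
    of \<open>\<Sum>\<^sub>i\<^sub>j a\<^sub>i b\<^sub>j T\<^sub>i\<^sub>j\<close> over scalar unit vectors \<open>a\<close> and \<open>b\<close>. Since \<open>\<sigma>\<close>
    does not decrease the norms of these elements of \<open>F\<close>, it does not decrease matrix norms either.
    Instead of Gelfand's theorem, the proof uses approximate joint diagonalizations of finitely
    many commuting operators, built from a quadratic partition of unity.
\<close>

section \<open>Monotone additive functions between two bounds\<close>

lemma sum_mset_repeat_mset:
  fixes f :: "'a \<Rightarrow> real"
  shows "(\<Sum>x\<in>#repeat_mset n A. f x) = real n * (\<Sum>x\<in>#A. f x)"
  by (induction n) (auto simp: algebra_simps)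

lemma image_mset_repeat_mset: "image_mset f (repeat_mset n A) = repeat_mset n (image_mset f A)"
  by (induction n) auto

lemma set_mset_repeat_mset_subset: "set_mset (repeat_mset n A) \<subseteq> set_mset A"
  by (induction n) auto

text \<open>
  A summand common to both sides acts as a catalyst: one copy of \<open>Z\<close> suffices to exchange any
number of copies of \<open>X\<close> for \<open>Y\<close>, one after the other. Dividing by \<open>m\<close> later makes \<open>Z\<close> negligible,
so common summands can be cancelled in inequalities between additive functions.
\<close>
lemma additive_preorder_cancel:
  assumes refl: "\<And>X. R X X"
    and trans: "\<And>X Y Z. R X Y \<Longrightarrow> R Y Z \<Longrightarrow> R X Z"
    and add: "\<And>X Y X' Y'. R X Y \<Longrightarrow> R X' Y' \<Longrightarrow> R (X + X') (Y + Y' :: 'a multiset)"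
    and R: "R (X + Z) (Y + Z)"
  shows "R (repeat_mset m X + Z) (repeat_mset m Y + Z)"
proof (induction m)
  case 0
  show ?case by (simp add: refl)
next
  case (Suc m)
  have "R (X + (repeat_mset m X + Z)) (X + (repeat_mset m Y + Z))"
    by (rule add[OF refl Suc])
  moreover have "R (X + (repeat_mset m Y + Z)) (repeat_mset m Y + (Y + Z))"
    using add[OF refl R, of "repeat_mset m Y"] by (simp only: add.left_commute)
  ultimately have "R (X + (repeat_mset m X + Z)) (repeat_mset m Y + (Y + Z))"
    by (rule trans)
  then show ?case by (simp only: repeat_mset_Suc add.assoc add.left_commute[of Y])
qed

text \<open>
  A Hahn-Banach theorem for a preordered commutative monoid that is free as a monoid: an additive
function on multisets is given by its values on points. The values are found one point at a time. A set
\<open>G\<close> of pairs (point, value) is admissible when every relation between multisets yields an inequality,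
however some of the entries are charged values from \<open>G\<close> and the remaining ones are charged \<open>s\<close> on the
smaller and \<open>p\<close> on the larger side. This is a property of finite character, so there is a maximal admissible \<open>G\<close>. It has a value for every point \<open>h\<close>: each relation with different
multiplicities of \<open>h\<close> on the two sides bounds the value from above or below, and suitable multiples
of a lower and an upper bound add up to a relation with equal multiplicities, where \<open>h\<close> cancels.
\<close>
theorem monotone_sandwich:
  fixes R :: "'a multiset \<Rightarrow> 'a multiset \<Rightarrow> bool" and s p :: "'a \<Rightarrow> real"
  assumes refl: "\<And>X. R X X"
    and trans: "\<And>X Y Z. R X Y \<Longrightarrow> R Y Z \<Longrightarrow> R X Z"
    and add: "\<And>X Y X' Y'. R X Y \<Longrightarrow> R X' Y' \<Longrightarrow> R (X + X') (Y + Y')"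
    and bound: "\<And>X Y. R X Y \<Longrightarrow> (\<Sum>x\<in>#X. s x) \<le> (\<Sum>y\<in>#Y. p y)"
  shows "\<exists>q. (\<forall>x. s x \<le> q x \<and> q x \<le> p x) \<and>
    (\<forall>X Y. R X Y \<longrightarrow> (\<Sum>x\<in>#X. q x) \<le> (\<Sum>y\<in>#Y. q y))"
proof -
  define adm where "adm G \<longleftrightarrow> (\<forall>A B X Y. set_mset A \<subseteq> G \<and> set_mset B \<subseteq> G \<and>
      R (image_mset fst A + X) (image_mset fst B + Y) \<longrightarrow>
      (\<Sum>a\<in>#A. snd a) + (\<Sum>x\<in>#X. s x) \<le> (\<Sum>b\<in>#B. snd b) + (\<Sum>y\<in>#Y. p y))"
    for G :: "('a \<times> real) set"
  have "\<exists>G\<in>Collect adm. \<forall>X\<in>Collect adm. G \<subseteq> X \<longrightarrow> X = G"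
  proof (rule subset_Zorn')
    fix \<C> assume ch: "subset.chain (Collect adm) \<C>"
    show "\<Union>\<C> \<in> Collect adm"
    proof (cases "\<C> = {}")
      case True
      then show ?thesis using bound by (auto simp: adm_def)
    next
      case False
      show ?thesis unfolding adm_def mem_Collect_eq
      proof (intro allI impI, elim conjE)
        fix A B :: "('a \<times> real) multiset" and X Y
        assume AB: "set_mset A \<subseteq> \<Union>\<C>" "set_mset B \<subseteq> \<Union>\<C>"
          and RR: "R (image_mset fst A + X) (image_mset fst B + Y)"
        have "finite (set_mset A \<union> set_mset B)" by simp
        with AB obtain G where "G \<in> \<C>" "set_mset A \<union> set_mset B \<subseteq> G"
          using finite_subset_Union_chain[of "set_mset A \<union> set_mset B" \<C> "Collect adm"] ch False
          by (metis Un_least)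
        moreover from this ch have "adm G" by (auto simp: subset_chain_def)
        ultimately show "(\<Sum>a\<in>#A. snd a) + (\<Sum>x\<in>#X. s x) \<le> (\<Sum>b\<in>#B. snd b) + (\<Sum>y\<in>#Y. p y)"
          using RR unfolding adm_def by blast
      qed
    qed
  qed
  then obtain G where G: "adm G" and max: "\<And>X. adm X \<Longrightarrow> G \<subseteq> X \<Longrightarrow> X = G" by auto

  have total: "\<exists>t. (h, t) \<in> G" for h
  proof -
    \<comment> \<open>Admissibility of the pair \<open>(h, t)\<close> depends only on the slack \<open>v\<close> of the relations with \<open>n\<close> and \<open>k\<close> copies of \<open>h\<close>.\<close>
    define D where "D n k v \<longleftrightarrow> (\<exists>A B X Y. set_mset A \<subseteq> G \<and> set_mset B \<subseteq> G \<and>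
      R (image_mset fst A + X + replicate_mset n h) (image_mset fst B + Y + replicate_mset k h) \<and>
      v = (\<Sum>b\<in>#B. snd b) + (\<Sum>y\<in>#Y. p y) - (\<Sum>a\<in>#A. snd a) - (\<Sum>x\<in>#X. s x))" for n k v
    have D_add: "D (n + n') (k + k') (v + v')" if D: "D n k v" "D n' k' v'" for n k v n' k' v'
    proof -
      obtain A B X Y where 1: "set_mset A \<subseteq> G" "set_mset B \<subseteq> G"
        "R (image_mset fst A + X + replicate_mset n h) (image_mset fst B + Y + replicate_mset k h)"
        "v = (\<Sum>b\<in>#B. snd b) + (\<Sum>y\<in>#Y. p y) - (\<Sum>a\<in>#A. snd a) - (\<Sum>x\<in>#X. s x)"
        using D(1) unfolding D_def by blast
      obtain A' B' X' Y' where 2: "set_mset A' \<subseteq> G" "set_mset B' \<subseteq> G"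
        "R (image_mset fst A' + X' + replicate_mset n' h) (image_mset fst B' + Y' + replicate_mset k' h)"
        "v' = (\<Sum>b\<in>#B'. snd b) + (\<Sum>y\<in>#Y'. p y) - (\<Sum>a\<in>#A'. snd a) - (\<Sum>x\<in>#X'. s x)"
        using D(2) unfolding D_def by blast
      have rep: "replicate_mset (i + j) h = replicate_mset i h + replicate_mset j h" for i j
        by (induction i) auto
      have "R (image_mset fst (A + A') + (X + X') + replicate_mset (n + n') h)
          (image_mset fst (B + B') + (Y + Y') + replicate_mset (k + k') h)"
        using add[OF 1(3) 2(3)] by (simp add: rep ac_simps)
      with 1 2 show ?thesis unfolding D_def
        by (intro exI[of _ "A + A'"] exI[of _ "B + B'"] exI[of _ "X + X'"] exI[of _ "Y + Y'"]) auto
    qed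
    have D_mult: "D (m * n) (m * k) (real m * v)" if D: "D n k v" for m n k v
    proof (induction m)
      case 0
      show ?case unfolding D_def
        by (intro exI[of _ "{#}"]) (simp add: refl)
    next
      case (Suc m)
      show ?case using D_add[OF D Suc] by (simp add: algebra_simps)
    qed
    have D_cancel: "0 \<le> v" if D: "D n n v" for n v
    proof -
      obtain A B X Y where 1: "set_mset A \<subseteq> G" "set_mset B \<subseteq> G"
        "R (image_mset fst A + X + replicate_mset n h) (image_mset fst B + Y + replicate_mset n h)"
        "v = (\<Sum>b\<in>#B. snd b) + (\<Sum>y\<in>#Y. p y) - (\<Sum>a\<in>#A. snd a) - (\<Sum>x\<in>#X. s x)"
        using D(1) unfolding D_def by blast
      have "0 \<le> real m * v + real n * (p h - s h)" for m
      proof -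
        have "R (image_mset fst (repeat_mset m A) + (repeat_mset m X + replicate_mset n h))
          (image_mset fst (repeat_mset m B) + (repeat_mset m Y + replicate_mset n h))"
          using additive_preorder_cancel[where R = R and m = m, OF refl trans add 1(3)]
          by (simp only: image_mset_repeat_mset repeat_mset_distrib2 add.assoc)
        moreover have "set_mset (repeat_mset m A) \<subseteq> G" "set_mset (repeat_mset m B) \<subseteq> G"
          using 1(1,2) by (auto dest: subsetD[OF set_mset_repeat_mset_subset])
        ultimately have "(\<Sum>a\<in>#repeat_mset m A. snd a) + (\<Sum>x\<in>#repeat_mset m X + replicate_mset n h. s x)
            \<le> (\<Sum>b\<in>#repeat_mset m B. snd b) + (\<Sum>y\<in>#repeat_mset m Y + replicate_mset n h. p y)"
          using G[unfolded adm_def, rule_format, of "repeat_mset m A" "repeat_mset m B"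
            "repeat_mset m X + replicate_mset n h" "repeat_mset m Y + replicate_mset n h"] by simp
        then show ?thesis
          by (simp add: sum_mset_repeat_mset 1(4) algebra_simps)
      qed
      note * = this
      show "0 \<le> v"
      proof (rule ccontr)
        assume "\<not> 0 \<le> v"
        then obtain m where "real n * (p h - s h) < real m * (- v)"
          using reals_Archimedean3[of "-v"] by auto
        then show False using *[of m] by simp
      qed
    qed
    define Lo where "Lo = {- v / real (k - n) |n k v. D n k v \<and> n < k}"
    define Up where "Up = {v / real (n - k) |n k v. D n k v \<and> k < n}"
    have le: "l \<le> u" if lu: "l \<in> Lo" "u \<in> Up" for l u
    proof -
      obtain n k v where 1: "D n k v" "n < k" "l = - v / real (k - n)" using lu Lo_def by auto
      obtain n' k' v' where 2: "D n' k' v'" "k' < n'" "u = v' / real (n' - k')" using lu Up_def by auto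
      obtain i where i: "k = n + i" "i > 0" using 1(2) by (metis less_imp_add_positive)
      obtain j where j: "n' = k' + j" "j > 0" using 2(2) by (metis less_imp_add_positive)
      \<comment> \<open>These multiples balance the numbers of copies of \<open>h\<close> on the two sides.\<close>
      have "D (j * n + i * n') (j * k + i * k') (real j * v + real i * v')"
        by (rule D_add[OF D_mult[OF 1(1)] D_mult[OF 2(1)]])
      moreover have "j * n + i * n' = j * k + i * k'" using i j by (simp add: algebra_simps)
      ultimately have "0 \<le> real j * v + real i * v'" using D_cancel by auto
      moreover have "v = - l * real i" "v' = u * real j" using i j 1(3) 2(3) by simp_all
      ultimately have "0 \<le> (real i * real j) * (u - l)" by (simp add: algebra_simps)
      moreover have "0 < real i * real j" using i j by simp
      ultimately show ?thesis by (metis diff_ge_0_iff_ge zero_le_mult_iff not_less)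
    qed
    have "D 0 1 (- s h)" unfolding D_def
      apply (rule exI[of _ "{#}"], rule exI[of _ "{#}"], rule exI[of _ "{#h#}"], rule exI[of _ "{#}"])
      by (simp add: refl)
    then have "- (- s h) / real (1 - 0) \<in> Lo" unfolding Lo_def by blast
    then have Lo0: "Lo \<noteq> {}" by blast
    have "D 1 0 (p h)" unfolding D_def
      apply (rule exI[of _ "{#}"], rule exI[of _ "{#}"], rule exI[of _ "{#}"], rule exI[of _ "{#h#}"])
      by (simp add: refl)
    then have "p h / real (1 - 0) \<in> Up" unfolding Up_def by blast
    then have Up0: "Up \<noteq> {}" by blast
    then obtain u where "u \<in> Up" by blast
    then have bd: "bdd_above Lo" using le by (intro bdd_aboveI[of _ u])
    define t where "t = Sup Lo"
    have t_lo: "l \<le> t" if "l \<in> Lo" for l unfolding t_def using that bd by (rule cSup_upper)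
    have t_up: "t \<le> u" if "u \<in> Up" for u unfolding t_def using Lo0 le that by (auto intro: cSup_least)
    have Dt: "0 \<le> v + (real k - real n) * t" if D: "D n k v" for n k v
    proof -
      consider "n = k" | "n < k" | "k < n" by linarith
      then show ?thesis
      proof cases
        case 1 then show ?thesis using D_cancel D by auto
      next
        case 2
        then have "- v / real (k - n) \<in> Lo" using D unfolding Lo_def by blast
        from t_lo[OF this] show ?thesis using 2
          by (simp add: of_nat_diff field_simps)
      next
        case 3
        then have "v / real (n - k) \<in> Up" using D unfolding Up_def by blast
        from t_up[OF this] show ?thesis using 3
          by (simp add: of_nat_diff field_simps)
      qed
    qed
    have "adm (insert (h, t) G)"
      unfolding adm_def
    proof (intro allI impI, elim conjE)
      fix A B :: "('a \<times> real) multiset" and X Y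
      assume AB: "set_mset A \<subseteq> insert (h, t) G" "set_mset B \<subseteq> insert (h, t) G"
        and RR: "R (image_mset fst A + X) (image_mset fst B + Y)"
      define A' where "A' = filter_mset (\<lambda>x. x \<noteq> (h, t)) A"
      define B' where "B' = filter_mset (\<lambda>x. x \<noteq> (h, t)) B"
      have split: "M = filter_mset (\<lambda>x. x \<noteq> (h, t)) M + replicate_mset (count M (h, t)) (h, t)" for M
        using multiset_partition[of M "\<lambda>x. x \<noteq> (h,t)"] by (simp add: filter_eq_replicate_mset)
      have A: "A = A' + replicate_mset (count A (h, t)) (h, t)" unfolding A'_def by (rule split)
      have B: "B = B' + replicate_mset (count B (h, t)) (h, t)" unfolding B'_def by (rule split)
      obtain n k where n: "A = A' + replicate_mset n (h, t)" and k: "B = B' + replicate_mset k (h, t)"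
        using A B by blast
      have G': "set_mset A' \<subseteq> G" "set_mset B' \<subseteq> G" using AB by (auto simp: A'_def B'_def)
      have "R (image_mset fst A' + X + replicate_mset n h) (image_mset fst B' + Y + replicate_mset k h)"
        using RR unfolding n k by (simp add: ac_simps)
      then have "D n k ((\<Sum>b\<in>#B'. snd b) + (\<Sum>y\<in>#Y. p y) - (\<Sum>a\<in>#A'. snd a) - (\<Sum>x\<in>#X. s x))"
        unfolding D_def using G' by blast
      from Dt[OF this]
      show "(\<Sum>a\<in>#A. snd a) + (\<Sum>x\<in>#X. s x) \<le> (\<Sum>b\<in>#B. snd b) + (\<Sum>y\<in>#Y. p y)"
        unfolding n k by (simp add: algebra_simps)
    qed
    then have "insert (h, t) G = G" using max by blast
    then show ?thesis by blast
  qed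
  then obtain q where q: "\<And>h. (h, q h) \<in> G" by metis
  have in_G: "set_mset (image_mset (\<lambda>h. (h, q h)) X) \<subseteq> G" for X using q by auto
  have gr: "image_mset fst (image_mset (\<lambda>h. (h, q h)) X) = X" for X
    by (simp add: multiset.map_comp comp_def)
  have sn: "(\<Sum>a\<in>#image_mset (\<lambda>h. (h, q h)) X. snd a) = (\<Sum>x\<in>#X. q x)" for X
    by (simp add: multiset.map_comp comp_def)
  have Gq: "(\<Sum>a\<in>#A. q a) + (\<Sum>x\<in>#X. s x) \<le> (\<Sum>b\<in>#B. q b) + (\<Sum>y\<in>#Y. p y)"
    if "R (A + X) (B + Y)" for A B X Y
    using G[unfolded adm_def, rule_format, of "image_mset (\<lambda>h. (h, q h)) A" "image_mset (\<lambda>h. (h, q h)) B" X Y]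
      in_G that by (simp only: gr sn image_mset_union)
  have "s x \<le> q x" for x using Gq[of "{#}" "{#x#}" "{#x#}" "{#}"] refl by simp
  moreover have "q x \<le> p x" for x using Gq[of "{#x#}" "{#}" "{#}" "{#x#}"] refl by simp
  moreover have "(\<Sum>x\<in>#X. q x) \<le> (\<Sum>y\<in>#Y. q y)" if "R X Y" for X Y
    using Gq[of X "{#}" Y "{#}"] that by simp
  ultimately show ?thesis by blast
qed

section \<open>Quadratic forms on Hilbert spaces and square roots\<close>

instance chilbert_space \<subseteq> banach ..

text \<open>
  The defect \<open>g r = f (r x) - r f(x)\<close> is additive and vanishes at \<open>1\<close>, hence is periodic. It is
bounded on the unit interval, hence everywhere, and a bounded additive function is zero.
\<close>
lemma additive_bounded_imp_homogeneous:
  fixes f :: "'v::real_normed_vector \<Rightarrow> real"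
  assumes add: "\<And>x y. f (x + y) = f x + f y"
    and bd: "\<And>x. \<bar>f x\<bar> \<le> a * (norm x)\<^sup>2 + b" and a: "0 \<le> a"
  shows "f (r *\<^sub>R x) = r * f x"
proof -
  define g where "g r = f (r *\<^sub>R x) - r * f x" for r
  have g_add: "g (r + s) = g r + g s" for r s
    by (simp add: g_def scaleR_left_distrib add algebra_simps)
  have g0: "g 0 = 0" using g_add[of 0 0] by simp
  have g_nat: "g (real n * r) = real n * g r" for n r
    by (induction n) (simp_all add: g0 g_add algebra_simps)
  have g1: "g 1 = 0" by (simp add: g_def)
  have g_neg: "g (- r) = - g r" for r using g_add[of r "-r"] g0 by simp
  have g_int: "g (of_int k) = 0" for k
    using g_nat[of "nat k" 1] g_nat[of "nat (-k)" 1] g_neg[of "- of_int k"] g1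
    by (cases "k \<ge> 0") auto
  have g_frac: "g r = g (frac r)" for r
    using g_add[of "of_int \<lfloor>r\<rfloor>" "frac r"] g_int by (simp add: frac_def)
  have "\<bar>g s\<bar> \<le> a * (norm x)\<^sup>2 + b + \<bar>f x\<bar>" if s: "0 \<le> s" "s \<le> 1" for s
  proof -
    have "(norm (s *\<^sub>R x))\<^sup>2 \<le> (norm x)\<^sup>2"
      using s by (intro power_mono) (auto intro: mult_left_le_one_le)
    then have "a * (norm (s *\<^sub>R x))\<^sup>2 \<le> a * (norm x)\<^sup>2" using a by (rule mult_left_mono)
    then have "\<bar>f (s *\<^sub>R x)\<bar> \<le> a * (norm x)\<^sup>2 + b" using bd[of "s *\<^sub>R x"] by simp
    moreover have "\<bar>s * f x\<bar> \<le> \<bar>f x\<bar>" using s by (auto simp: abs_mult intro: mult_left_le_one_le)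
    ultimately show ?thesis unfolding g_def by linarith
  qed
  then have g_bd: "\<bar>g s\<bar> \<le> a * (norm x)\<^sup>2 + b + \<bar>f x\<bar>" for s
    by (metis g_frac frac_ge_0 frac_lt_1 less_imp_le)
  have "g r = 0"
  proof (rule ccontr)
    assume "g r \<noteq> 0"
    then obtain n where "a * (norm x)\<^sup>2 + b + \<bar>f x\<bar> < real n * \<bar>g r\<bar>"
      using reals_Archimedean3[of "\<bar>g r\<bar>"] by auto
    then show False using g_bd[of "real n * r"] by (simp add: g_nat abs_mult)
  qed
  then show ?thesis by (simp add: g_def)
qed

text \<open>
  The first-order condition at a minimum, used for the minimizer in the next theorem.
\<close>
lemma quadratic_nonneg_imp_linear_coeff_0:
  fixes a b :: real
  assumes nn: "\<And>t. 0 \<le> t\<^sup>2 * a + t * b"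
  shows "b = 0"
proof (rule ccontr)
  assume b: "b \<noteq> 0"
  have a: "0 \<le> a" using nn[of 1] nn[of "-1"] by simp
  define t where "t = - b / (a + 1)"
  have t: "(a + 1) * t = - b" using a by (simp add: t_def)
  have "(a + 1)\<^sup>2 * (t\<^sup>2 * a + t * b) = ((a + 1) * t)\<^sup>2 * a + (a + 1) * ((a + 1) * t) * b"
    by (simp add: power2_eq_square algebra_simps)
  also have "\<dots> = - b\<^sup>2" unfolding t by (simp add: power2_eq_square algebra_simps)
  also have "\<dots> < 0" using b by simp
  finally show False using nn[of t] by (simp add: mult_less_0_iff not_less[symmetric])
qed

text \<open>
  The representing vector is the minimizer of \<open>\<parallel>x\<parallel>\<^sup>2 - 2 f(x)\<close>. A minimizing sequence is
Cauchy by the parallelogram law.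
\<close>
theorem riesz_representation:
  fixes f :: "'v::{real_inner,banach} \<Rightarrow> real"
  assumes f: "bounded_linear f"
  shows "\<exists>u. \<forall>y. f y = inner u y"
proof -
  interpret f: bounded_linear f by (rule f)
  obtain K where K: "\<And>x. norm (f x) \<le> norm x * K" using f.bounded by blast
  define \<phi> where "\<phi> x = (norm x)\<^sup>2 - 2 * f x" for x
  have low: "- K\<^sup>2 \<le> \<phi> x" for x
  proof -
    have "f x \<le> norm x * K" using K[of x] by simp
    moreover have "0 \<le> (norm x - K)\<^sup>2" by simp
    ultimately show ?thesis by (simp add: \<phi>_def power2_eq_square algebra_simps)
  qed
  define m where "m = Inf (range \<phi>)"
  have bdd: "bdd_below (range \<phi>)" using low by (intro bdd_belowI[of _ "- K\<^sup>2"]) auto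
  have m: "m \<le> \<phi> x" for x unfolding m_def using bdd by (auto intro: cInf_lower)
  have "\<exists>x. \<phi> x < m + inverse (real (Suc n))" for n
    using cInf_lessD[of "range \<phi>" "m + inverse (real (Suc n))"] unfolding m_def by auto
  then obtain x where x: "\<And>n. \<phi> (x n) < m + inverse (real (Suc n))" by metis
  have par: "(norm (u - v))\<^sup>2 = 2 * \<phi> u + 2 * \<phi> v - 4 * \<phi> ((1/2) *\<^sub>R (u + v))" for u v
    by (simp add: \<phi>_def power2_norm_eq_inner power_divide f.scaleR f.add inner_simps inner_commute field_simps)
  have d: "(norm (u - v))\<^sup>2 \<le> 2 * (\<phi> u - m) + 2 * (\<phi> v - m)" for u v
    using par[of u v] m[of "(1/2) *\<^sub>R (u + v)"] by simp
  have "Cauchy x"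
  proof (rule metric_CauchyI)
    fix e :: real assume e: "0 < e"
    then obtain N where N: "inverse (real (Suc N)) < e\<^sup>2 / 4"
      using reals_Archimedean[of "e\<^sup>2 / 4"] by auto
    show "\<exists>M. \<forall>i\<ge>M. \<forall>j\<ge>M. dist (x i) (x j) < e"
    proof (intro exI allI impI)
      fix i j assume ij: "N \<le> i" "N \<le> j"
      have "\<phi> (x n) < m + e\<^sup>2 / 4" if "N \<le> n" for n
      proof -
        have "inverse (real (Suc n)) \<le> inverse (real (Suc N))" using that by auto
        then have "inverse (real (Suc n)) < e\<^sup>2 / 4" using N by (rule le_less_trans)
        then have "m + inverse (real (Suc n)) < m + e\<^sup>2 / 4" by (rule add_strict_left_mono)
        with x[of n] show ?thesis by (rule less_trans)
      qed
      from this[OF ij(1)] this[OF ij(2)] have "2 * (\<phi> (x i) - m) + 2 * (\<phi> (x j) - m) < e\<^sup>2"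
        by (simp add: field_simps)
      with d[of "x i" "x j"] have "(norm (x i - x j))\<^sup>2 < e\<^sup>2" by (rule le_less_trans)
      then show "dist (x i) (x j) < e" using e by (simp add: dist_norm power2_less_imp_less)
    qed
  qed
  then obtain u where u: "x \<longlonglongrightarrow> u" using Cauchy_convergent_iff convergent_def by blast
  have "(\<lambda>n. \<phi> (x n)) \<longlonglongrightarrow> \<phi> u"
    unfolding \<phi>_def by (intro tendsto_intros f.tendsto u)
  moreover have "(\<lambda>n. m + inverse (real (Suc n))) \<longlonglongrightarrow> m + 0"
    by (intro tendsto_intros LIMSEQ_inverse_real_of_nat)
  ultimately have "\<phi> u \<le> m + 0"
    by (rule LIMSEQ_le) (use x less_imp_le in blast)
  then have min: "\<phi> u \<le> \<phi> v" for v using m[of v] by simp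
  have "f y = inner u y" for y
  proof -
    have "0 \<le> t\<^sup>2 * (norm y)\<^sup>2 + t * (2 * (inner u y - f y))" for t
    proof -
      have "(norm (u + t *\<^sub>R y))\<^sup>2 = (norm u)\<^sup>2 + 2 * t * inner u y + t\<^sup>2 * (norm y)\<^sup>2"
        unfolding power2_norm_eq_inner
        by (simp add: inner_simps inner_commute power2_eq_square algebra_simps)
      then show ?thesis
        using min[of "u + t *\<^sub>R y"] by (simp add: \<phi>_def f.scaleR f.add algebra_simps)
    qed
    from quadratic_nonneg_imp_linear_coeff_0[OF this] show ?thesis by simp
  qed
  then show ?thesis by blast
qed

definition selfadj :: "('v::real_inner \<Rightarrow>\<^sub>L 'v) \<Rightarrow> bool"
  where "selfadj T \<longleftrightarrow> (\<forall>x y. inner (T x) y = inner x (T y))"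

text \<open>
  The theorem of Jordan and von Neumann: the polarization of \<open>q\<close> is additive in each variable by the
parallelogram law, and homogeneous because it is locally bounded. Riesz representation turns the resulting
bounded bilinear form into an operator.
\<close>
theorem bounded_quadratic_form_operator:
  fixes q :: "'v::{real_inner,banach} \<Rightarrow> real"
  assumes par: "\<And>x y. q (x + y) + q (x - y) = 2 * q x + 2 * q y"
    and bd: "\<And>x. 0 \<le> q x" "\<And>x. q x \<le> C * (norm x)\<^sup>2"
  shows "\<exists>P. selfadj P \<and> (\<forall>x. q x = inner (P x) x) \<and>
    (\<forall>x y. inner (P x) y = (q (x + y) - q (x - y)) / 4)"
proof -
  define B where "B x y = (q (x + y) - q (x - y)) / 4" for x y
  have q0: "q 0 = 0" using par[of 0 0] by simp
  have q_neg: "q (- x) = q x" for x using par[of 0 x] q0 by simp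
  have q_minus: "q (x - y) = q (y - x)" for x y using q_neg[of "x - y"] by simp
  have B_sym: "B x y = B y x" for x y unfolding B_def by (simp add: q_minus[of x y] add.commute)
  have B0: "B 0 y = 0" for y by (simp add: B_def q_neg)
  have B_mid: "B (x + z) y + B (x - z) y = 2 * B x y" for x y z
    using par[of "x + y" z] par[of "x - y" z] unfolding B_def
    by (simp add: add_divide_distrib diff_divide_distrib) (simp add: algebra_simps)
  have B_2: "B (x + x) y = 2 * B x y" for x y using B_mid[of x x y] B0 by simp
  have B_add: "B (u + v) y = B u y + B v y" for u v y
    using B_mid[of "(1/2) *\<^sub>R (u + v)" "(1/2) *\<^sub>R (u - v)" y] B_2[of "(1/2) *\<^sub>R (u + v)" y]
    by (simp add: scaleR_add_right[symmetric] scaleR_diff_right[symmetric] flip: scaleR_add_left)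
  have C': "q x \<le> \<bar>C\<bar> * (norm x)\<^sup>2" for x
    using bd(2)[of x] mult_right_mono[OF abs_ge_self[of C] zero_le_power2[of "norm x"]] by linarith
  have B_bd: "\<bar>B x y\<bar> \<le> \<bar>C\<bar> / 2 * (norm x)\<^sup>2 + \<bar>C\<bar> / 2 * (norm y)\<^sup>2" for x y
  proof -
    have "\<bar>B x y\<bar> \<le> (q (x + y) + q (x - y)) / 4"
      unfolding B_def using bd(1)[of "x + y"] bd(1)[of "x - y"] by (simp add: abs_le_iff)
    also have "\<dots> = (q x + q y) / 2" by (simp add: par)
    also have "\<dots> \<le> (\<bar>C\<bar> * (norm x)\<^sup>2 + \<bar>C\<bar> * (norm y)\<^sup>2) / 2"
      using C'[of x] C'[of y] by simp
    finally show ?thesis by (simp add: algebra_simps add_divide_distrib)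
  qed
  have B_scale: "B (r *\<^sub>R x) y = r * B x y" for r x y
    by (rule additive_bounded_imp_homogeneous[of "\<lambda>x. B x y" "\<bar>C\<bar> / 2" "\<bar>C\<bar> / 2 * (norm y)\<^sup>2"])
       (use B_bd[of _ y] in \<open>simp_all add: B_add\<close>)
  have B_add_r: "B x (u + v) = B x u + B x v" for x u v
    by (metis B_sym B_add)
  have B_scale_r: "B x (r *\<^sub>R y) = r * B x y" for r x y
    by (metis B_sym B_scale)
  have B_bd': "\<bar>B x y\<bar> \<le> \<bar>C\<bar> * norm x * norm y" for x y
  proof (cases "x = 0 \<or> y = 0")
    case True
    then show ?thesis using B0[of x] B0[of y] B_sym[of x 0] by auto
  next
    case False
    then have "\<bar>B ((1 / norm x) *\<^sub>R x) ((1 / norm y) *\<^sub>R y)\<bar> \<le> \<bar>C\<bar>"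
      using B_bd[of "(1 / norm x) *\<^sub>R x" "(1 / norm y) *\<^sub>R y"] by simp
    moreover have "B ((1 / norm x) *\<^sub>R x) ((1 / norm y) *\<^sub>R y) = B x y / (norm x * norm y)"
      by (simp add: B_scale B_scale_r)
    ultimately show ?thesis using False by (simp add: abs_mult field_simps)
  qed
  have "bounded_linear (B x)" for x
    by (intro bounded_linear_intro[where K = "\<bar>C\<bar> * norm x"])
       (use B_bd'[of x] in \<open>simp_all add: B_add_r B_scale_r ac_simps\<close>)
  then have "\<exists>u. \<forall>y. B x y = inner u y" for x by (rule riesz_representation)
  then obtain p where p: "\<And>x y. B x y = inner (p x) y" by metis
  have p_lin: "bounded_linear p"
  proof (rule bounded_linear_intro[where K = "\<bar>C\<bar>"])
    have eq: "u = v" if "\<And>z. inner u z = inner v z" for u v :: 'v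
      using that vector_eq_rdot by blast
    show "p (x + y) = p x + p y" for x y
      by (rule eq) (simp add: inner_add_left B_add flip: p)
    show "p (r *\<^sub>R x) = r *\<^sub>R p x" for r x
      by (rule eq) (simp add: B_scale flip: p)
    show "norm (p x) \<le> norm x * \<bar>C\<bar>" for x
    proof -
      have "norm (p x) * norm (p x) = B x (p x)" by (simp add: p flip: power2_norm_eq_inner power2_eq_square)
      also have "\<dots> \<le> (norm x * \<bar>C\<bar>) * norm (p x)" using B_bd'[of x "p x"] by (simp add: ac_simps)
      finally show ?thesis by (cases "p x = 0") simp_all
    qed
  qed
  define P where "P = Blinfun p"
  have P: "blinfun_apply P = p" unfolding P_def by (rule bounded_linear_Blinfun_apply[OF p_lin])
  have "inner (P x) y = (q (x + y) - q (x - y)) / 4" for x y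
    using p[of x y] by (simp add: P B_def)
  moreover have "selfadj P"
    unfolding selfadj_def P by (metis p B_sym inner_commute)
  moreover have "q x = inner (P x) x" for x
    using p[of x x] B_def[of x x] par[of x x] q0 by (simp add: P)
  ultimately show ?thesis by blast
qed

text \<open>
  The equation \<open>(1 - S)\<^sup>2 = 1 - R\<close> is the fixed point equation \<open>S = (R + S\<^sup>2) / 2\<close>. Its right-hand
side is a contraction of the ball of radius \<open>1 - sqrt (1 - r) < 1\<close>. The iteration stays
inside any closed algebra that contains \<open>R\<close>, so the root inherits complex linearity, or membership in a
\<open>C\<^sup>*\<close>-algebra, from \<open>R\<close>.
\<close>
theorem selfadj_sqrt:
  fixes C :: "('v::{real_inner,banach} \<Rightarrow>\<^sub>L 'v) set"
  assumes C: "closed C" "\<And>S T. S \<in> C \<Longrightarrow> T \<in> C \<Longrightarrow> S + T \<in> C"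
      "\<And>r T. T \<in> C \<Longrightarrow> r *\<^sub>R T \<in> C" "\<And>S T. S \<in> C \<Longrightarrow> T \<in> C \<Longrightarrow> S o\<^sub>L T \<in> C"
    and R: "R \<in> C" "selfadj R" "norm R \<le> r" "r < 1"
  shows "\<exists>S\<in>C. selfadj S \<and> norm S < 1 \<and> (id_blinfun - S) o\<^sub>L (id_blinfun - S) = id_blinfun - R"
proof -
  have r0: "0 \<le> r" using R(3) norm_ge_zero order_trans by blast
  define t where "t = 1 - sqrt (1 - r)"
  have t: "0 \<le> t" "t < 1" using r0 R(4) by (simp_all add: t_def)
  have tt: "r + t * t = 2 * t"
  proof -
    have "(1 - t)\<^sup>2 = 1 - r" using R(4) by (simp add: t_def)
    then show ?thesis by (simp add: power2_eq_square algebra_simps)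
  qed
  define D where "D = {S. S \<in> C \<and> selfadj S \<and> norm S \<le> t}"
  \<comment> \<open>The radius \<open>t\<close> is the smaller root of \<open>(r + t\<^sup>2) / 2 = t\<close>, so that \<open>f\<close> maps the ball to itself.\<close>
  define f where "f S = (1/2) *\<^sub>R (R + (S o\<^sub>L S))" for S
  have "closed D"
  proof -
    have "D = C \<inter> (\<Inter>x. \<Inter>y. {S. inner (blinfun_apply S x) y = inner x (blinfun_apply S y)}) \<inter> {S. norm S \<le> t}"
      by (auto simp: D_def selfadj_def)
    moreover have "closed {S. inner (blinfun_apply S x) y = inner x (blinfun_apply S y)}" for x y :: 'v
      by (intro closed_Collect_eq continuous_intros)
    moreover have "closed {S :: 'v \<Rightarrow>\<^sub>L 'v. norm S \<le> t}"
      by (intro closed_Collect_le continuous_intros)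
    ultimately show ?thesis using C(1) by (simp add: closed_INT closed_Int)
  qed
  then have cD: "complete D" by (simp add: complete_eq_closed)
  have "0 *\<^sub>R R \<in> C" using C(3) R(1) by blast
  then have "0 \<in> D" using t by (simp add: D_def selfadj_def)
  then have D0: "D \<noteq> {}" by blast
  have fD: "f ` D \<subseteq> D"
  proof (rule image_subsetI)
    fix S assume S: "S \<in> D"
    have "f S \<in> C" using S R C by (auto simp: D_def f_def)
    moreover have "selfadj (f S)" using S R(2)
      by (auto simp: D_def f_def selfadj_def inner_simps blinfun.add_left blinfun.scaleR_left)
    moreover have "norm (f S) \<le> t"
    proof -
      have "norm (S o\<^sub>L S) \<le> norm S * norm S" by (rule norm_blinfun_compose)
      also have "\<dots> \<le> t * t" using S by (intro mult_mono) (auto simp: D_def t)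
      finally have "norm (R + (S o\<^sub>L S)) \<le> r + t * t"
        using norm_triangle_ineq[of R "S o\<^sub>L S"] R(3) by linarith
      then show ?thesis by (simp add: f_def tt)
    qed
    ultimately show "f S \<in> D" by (simp add: D_def)
  qed
  have "dist (f S) (f T) \<le> t * dist S T" if ST: "S \<in> D" "T \<in> D" for S T
  proof -
    have eq: "f S - f T = (1/2) *\<^sub>R ((S o\<^sub>L (S - T)) + ((S - T) o\<^sub>L T))"
      by (rule blinfun_eqI)
         (simp add: f_def blinfun.add_left blinfun.diff_left blinfun.diff_right blinfun.scaleR_left
           flip: scaleR_diff_right)
    have "norm (S o\<^sub>L (S - T)) \<le> t * norm (S - T)"
      by (rule order_trans[OF norm_blinfun_compose]) (use ST in \<open>auto simp: D_def intro: mult_right_mono\<close>)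
    moreover have "norm ((S - T) o\<^sub>L T) \<le> t * norm (S - T)"
      by (rule order_trans[OF norm_blinfun_compose], subst mult.commute)
         (use ST in \<open>auto simp: D_def intro: mult_right_mono\<close>)
    ultimately have "norm ((S o\<^sub>L (S - T)) + ((S - T) o\<^sub>L T)) \<le> 2 * (t * norm (S - T))"
      using norm_triangle_ineq[of "S o\<^sub>L (S - T)" "(S - T) o\<^sub>L T"] by linarith
    then show ?thesis by (simp add: dist_norm eq)
  qed
  from Banach_fix[OF cD D0 t fD this] obtain S where S: "S \<in> D" "f S = S" by blast
  have SS: "R + (S o\<^sub>L S) = 2 *\<^sub>R S"
  proof -
    have "2 *\<^sub>R f S = R + (S o\<^sub>L S)" by (simp add: f_def)
    then show ?thesis using S(2) by simp
  qed
  have "(id_blinfun - S) o\<^sub>L (id_blinfun - S) = id_blinfun - R"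
  proof (rule blinfun_eqI)
    fix x
    have "R x + S (S x) = S x + S x"
      using arg_cong[OF SS, of "\<lambda>T. blinfun_apply T x"] by (simp add: blinfun.add_left blinfun.scaleR_left scaleR_2)
    then show "((id_blinfun - S) o\<^sub>L (id_blinfun - S)) x = (id_blinfun - R) x"
      by (simp add: blinfun.diff_left blinfun.diff_right algebra_simps)
  qed
  then show ?thesis using S(1) t by (auto simp: D_def)
qed

lemma id_minus_strict_contraction_invertible:
  fixes S :: "'v::banach \<Rightarrow>\<^sub>L 'v"
  assumes S: "norm S < 1"
  shows "\<exists>Y. (id_blinfun - S) o\<^sub>L Y = id_blinfun \<and> Y o\<^sub>L (id_blinfun - S) = id_blinfun"
proof -
  have c: "0 \<le> norm S" by simp
  have "dist (id_blinfun + (S o\<^sub>L T)) (id_blinfun + (S o\<^sub>L U)) \<le> norm S * dist T U" for T U :: "'v \<Rightarrow>\<^sub>L 'v"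
  proof -
    have "(S o\<^sub>L T) - (S o\<^sub>L U) = S o\<^sub>L (T - U)"
      by (rule blinfun_eqI) (simp add: blinfun.diff_left blinfun.diff_right)
    then show ?thesis using norm_blinfun_compose[of S "T - U"] by (simp add: dist_norm)
  qed
  then obtain Y where Y: "id_blinfun + (S o\<^sub>L Y) = Y"
    using banach_fix_type[OF c S, of "\<lambda>T. id_blinfun + (S o\<^sub>L T)"] by blast
  have "dist (id_blinfun + (T o\<^sub>L S)) (id_blinfun + (U o\<^sub>L S)) \<le> norm S * dist T U" for T U :: "'v \<Rightarrow>\<^sub>L 'v"
  proof -
    have "(T o\<^sub>L S) - (U o\<^sub>L S) = (T - U) o\<^sub>L S"
      by (rule blinfun_eqI) (simp add: blinfun.diff_left blinfun.diff_right)
    then show ?thesis using norm_blinfun_compose[of "T - U" S] by (simp add: dist_norm mult.commute)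
  qed
  then obtain Z where Z: "id_blinfun + (Z o\<^sub>L S) = Z"
    using banach_fix_type[OF c S, of "\<lambda>T. id_blinfun + (T o\<^sub>L S)"] by blast
  have Y': "Y x - S (Y x) = x" for x
    using arg_cong[OF Y, of "\<lambda>T. blinfun_apply T x"] by (simp add: blinfun.add_left algebra_simps)
  have Z': "Z x - Z (S x) = x" for x
    using arg_cong[OF Z, of "\<lambda>T. blinfun_apply T x"] by (simp add: blinfun.add_left algebra_simps)
  have ZY: "Z x = Y x" for x
    using Z'[of "Y x"] Y'[of x] by (metis blinfun.diff_right)
  have "(id_blinfun - S) o\<^sub>L Y = id_blinfun"
    by (rule blinfun_eqI) (simp add: blinfun.diff_left Y')
  moreover have "Y o\<^sub>L (id_blinfun - S) = id_blinfun"
    by (rule blinfun_eqI) (simp add: blinfun.diff_left blinfun.diff_right Z' flip: ZY)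
  ultimately show ?thesis by blast
qed

lemma scaleC_scaleR: "r *\<^sub>R x = complex_of_real r *\<^sub>C (x::'a::complex_inner)"
  by (simp add: scaleC_of_real)

lemma scaleC_Complex: "Complex a b *\<^sub>C x = a *\<^sub>R x + b *\<^sub>R \<i> *\<^sub>C (x::'a::complex_inner)"
  by (simp add: scaleC_scaleR scaleC_scaleC Complex_eq scaleC_add_left mult.commute)

text \<open>
  Real linearity comes with the type, so compatibility with \<open>\<i>\<close> is all that complex
linearity requires.
\<close>
lemma bounded_opsI:
  assumes "\<And>x. blinfun_apply T (\<i> *\<^sub>C x) = \<i> *\<^sub>C blinfun_apply T x"
  shows "T \<in> bounded_ops"
  unfolding bounded_ops_def
proof (intro CollectI allI)
  fix c x
  show "T (c *\<^sub>C x) = c *\<^sub>C T x"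
    by (cases c) (simp add: scaleC_Complex blinfun.add_right blinfun.scaleR_right assms)
qed

lemma bounded_opsD: "T \<in> bounded_ops \<Longrightarrow> blinfun_apply T (c *\<^sub>C x) = c *\<^sub>C blinfun_apply T x"
  by (simp add: bounded_ops_def)

lemma cinner_scaleC_right: "cinner x (c *\<^sub>C y) = cnj c * cinner x (y::'a::complex_inner)"
  by (metis cinner_commute cinner_scaleC_left complex_cnj_mult)

lemma inner_scaleC_ii: "inner (\<i> *\<^sub>C x) (\<i> *\<^sub>C y) = inner x (y::'a::complex_inner)"
  by (simp add: inner_eq_Re_cinner cinner_scaleC_left cinner_scaleC_right)

lemma bounded_linear_scaleC: "bounded_linear (\<lambda>x::'a::complex_inner. c *\<^sub>C x)"
  by (intro bounded_linear_intro[where K = "cmod c"])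
     (auto simp: scaleC_add_right norm_scaleC scaleC_scaleR scaleC_scaleC mult.commute)

lemma closed_bounded_ops: "closed (bounded_ops :: ('a::complex_inner \<Rightarrow>\<^sub>L 'a) set)"
proof -
  have "(bounded_ops :: ('a \<Rightarrow>\<^sub>L 'a) set)
      = (\<Inter>c. \<Inter>x. {T. blinfun_apply T (c *\<^sub>C x) = c *\<^sub>C blinfun_apply T x})"
    by (auto simp: bounded_ops_def)
  moreover have "closed {T :: 'a \<Rightarrow>\<^sub>L 'a. blinfun_apply T (c *\<^sub>C x) = c *\<^sub>C blinfun_apply T x}" for c x
    by (intro closed_Collect_eq continuous_intros
      bounded_linear.continuous_on[OF bounded_linear_scaleC])
  ultimately show ?thesis by (metis (no_types, lifting) closed_INT)
qed

lemma bounded_ops_algebra: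
  "S \<in> bounded_ops \<Longrightarrow> T \<in> bounded_ops \<Longrightarrow> S + T \<in> bounded_ops"
  "S \<in> bounded_ops \<Longrightarrow> T \<in> bounded_ops \<Longrightarrow> S - T \<in> bounded_ops"
  "T \<in> bounded_ops \<Longrightarrow> r *\<^sub>R T \<in> bounded_ops"
  "S \<in> bounded_ops \<Longrightarrow> T \<in> bounded_ops \<Longrightarrow> S o\<^sub>L T \<in> bounded_ops"
  "id_blinfun \<in> bounded_ops"
proof -
  have d: "c *\<^sub>C (x - y) = c *\<^sub>C x - c *\<^sub>C y" for c and x y :: 'a
    by (metis (no_types, lifting) add_diff_cancel_right' diff_add_cancel scaleC_add_right)
  show "S \<in> bounded_ops \<Longrightarrow> T \<in> bounded_ops \<Longrightarrow> S + T \<in> bounded_ops"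
    "S \<in> bounded_ops \<Longrightarrow> T \<in> bounded_ops \<Longrightarrow> S - T \<in> bounded_ops"
    "T \<in> bounded_ops \<Longrightarrow> r *\<^sub>R T \<in> bounded_ops"
    "S \<in> bounded_ops \<Longrightarrow> T \<in> bounded_ops \<Longrightarrow> S o\<^sub>L T \<in> bounded_ops"
    "id_blinfun \<in> bounded_ops" for S T :: "'a \<Rightarrow>\<^sub>L 'a" and r
    by (auto simp: bounded_ops_def blinfun.add_left blinfun.diff_left blinfun.scaleR_left
        scaleC_add_right d scaleC_scaleR scaleC_scaleC mult.commute)
qed

lemma selfadj_norm_le:
  assumes R: "selfadj R" and r: "0 \<le> r" "\<And>x. \<bar>inner (R x) x\<bar> \<le> r * (norm x)\<^sup>2"
  shows "norm R \<le> r"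
proof (rule norm_blinfun_bound[OF r(1)])
  fix x
  have *: "2 * inner (R x) y \<le> r * ((norm x)\<^sup>2 + (norm y)\<^sup>2)" for y
  proof -
    have "4 * inner (R x) y = inner (R (x + y)) (x + y) - inner (R (x - y)) (x - y)"
    proof -
      have "inner (R y) x = inner (R x) y" using R by (simp add: selfadj_def inner_commute)
      then show ?thesis by (simp add: blinfun.add_right blinfun.diff_right inner_simps)
    qed
    also have "\<dots> \<le> r * (norm (x + y))\<^sup>2 + r * (norm (x - y))\<^sup>2"
      using r(2)[of "x + y"] r(2)[of "x - y"] by (simp add: abs_le_iff)
    also have "\<dots> = 2 * (r * ((norm x)\<^sup>2 + (norm y)\<^sup>2))"
      by (simp add: power2_norm_eq_inner inner_simps inner_commute algebra_simps)
    finally show ?thesis by simp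
  qed
  show "norm (R x) \<le> r * norm x"
  proof (cases "R x = 0 \<or> x = 0")
    case True
    then show ?thesis using r(1) by (auto simp: blinfun.zero_right)
  next
    case False
    have "2 * (norm x * norm (R x)) = 2 * inner (R x) ((norm x / norm (R x)) *\<^sub>R R x)"
      using False by (simp flip: power2_norm_eq_inner add: power2_eq_square)
    also have "\<dots> \<le> r * ((norm x)\<^sup>2 + (norm x)\<^sup>2)"
      using *[of "(norm x / norm (R x)) *\<^sub>R R x"] False by simp
    finally have "norm x * norm (R x) \<le> norm x * (r * norm x)"
      by (simp add: power2_eq_square algebra_simps)
    then show ?thesis using False by simp
  qed
qed

text \<open>
  If the operator \<open>P\<close> represents \<open>q\<close>, then \<open>1 \<le> P \<le> K\<close>, so that \<open>R = 1 - P / K\<close> is a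
strict contraction and \<open>X = (1 - R)\<^sup>1\<^sup>/\<^sup>2 = (P / K)\<^sup>1\<^sup>/\<^sup>2\<close> exists and is invertible.
Invariance of \<open>q\<close> under \<open>\<i>\<close> makes \<open>P\<close>, and hence \<open>X\<close>, complex linear.
\<close>
theorem equivalent_hilbert_norm_similarity:
  fixes q :: "'a::chilbert_space \<Rightarrow> real"
  assumes par: "\<And>x y. q (x + y) + q (x - y) = 2 * q x + 2 * q y"
    and ii: "\<And>x. q (\<i> *\<^sub>C x) = q x"
    and bd: "\<And>x. (norm x)\<^sup>2 \<le> q x" "\<And>x. q x \<le> K * (norm x)\<^sup>2" and K: "1 \<le> K"
  shows "\<exists>X X'. inverse_ops X X' \<and> (\<forall>x. K * (norm (blinfun_apply X x))\<^sup>2 = q x)"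
proof -
  have "0 \<le> q x" for x using bd(1)[of x] zero_le_power2 order_trans by blast
  then obtain P where P: "selfadj P" "\<And>x. q x = inner (P x) x"
    "\<And>x y. inner (P x) y = (q (x + y) - q (x - y)) / 4"
    using bounded_quadratic_form_operator[of q K] par bd(2) by blast
  have mi: "\<i> *\<^sub>C (- \<i> *\<^sub>C y) = y" for y :: 'a
    using scaleC_of_real[of 1 y] by (simp add: scaleC_scaleC)
  have neg: "(- \<i>) *\<^sub>C y = - (\<i> *\<^sub>C y)" for y :: 'a
    using scaleC_of_real[of 0 y] scaleC_add_left[of "\<i>" "- \<i>" y] by (simp add: eq_neg_iff_add_eq_0 add.commute)
  have P_ii: "P (\<i> *\<^sub>C x) = \<i> *\<^sub>C P x" for x
  proof -
    have "inner (P (\<i> *\<^sub>C x)) y = inner (\<i> *\<^sub>C P x) y" for y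
    proof -
      \<comment> \<open>Multiplication by \<open>\<i>\<close> preserves both \<open>q\<close> and the inner product.\<close>
      let ?z = "(- \<i>) *\<^sub>C y"
      have "inner (\<i> *\<^sub>C P x) y = inner (P x) ?z"
        using inner_scaleC_ii[of "P x" ?z] mi[of y] by simp
      also have "\<dots> = (q (\<i> *\<^sub>C (x + ?z)) - q (\<i> *\<^sub>C (x + \<i> *\<^sub>C y))) / 4"
        unfolding P(3)[of x "(- \<i>) *\<^sub>C y"] ii[of "x + (- \<i>) *\<^sub>C y"] ii[of "x + \<i> *\<^sub>C y"]
        by (simp only: neg diff_minus_eq_add)
      also have "\<dots> = (q (\<i> *\<^sub>C x + y) - q (\<i> *\<^sub>C x - y)) / 4"
      proof -
        have "\<i> *\<^sub>C (\<i> *\<^sub>C y) = - y" using scaleC_of_real[of "-1" y] by (simp add: scaleC_scaleC)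
        then show ?thesis by (simp add: scaleC_add_right mi)
      qed
      finally show ?thesis by (simp add: P(3))
    qed
    then show ?thesis using vector_eq_rdot by blast
  qed
  define r where "r = 1 - 1 / K"
  define R where "R = id_blinfun - (1 / K) *\<^sub>R P"
  have Rx: "blinfun_apply R x = x - (1 / K) *\<^sub>R P x" for x
    by (simp add: R_def blinfun.diff_left blinfun.scaleR_left)
  have R_in: "R \<in> bounded_ops" unfolding R_def using bounded_opsI[of P] P_ii
    by (intro bounded_ops_algebra) auto
  have R_sa: "selfadj R" using P(1)
    by (simp add: selfadj_def Rx inner_simps)
  have r: "0 \<le> r" "r < 1" using K by (simp_all add: r_def)
  have "\<bar>inner (R x) x\<bar> \<le> r * (norm x)\<^sup>2" for x
  proof -
    have "inner (R x) x = (norm x)\<^sup>2 - q x / K"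
      by (simp add: Rx inner_simps P(2) power2_norm_eq_inner)
    moreover have "q x / K \<le> (norm x)\<^sup>2" using bd(2)[of x] K by (simp add: field_simps)
    moreover have "(norm x)\<^sup>2 / K \<le> q x / K" using bd(1)[of x] K by (simp add: divide_right_mono)
    ultimately show ?thesis by (simp add: r_def algebra_simps)
  qed
  then have nR: "norm R \<le> r" by (rule selfadj_norm_le[OF R_sa r(1)])
  obtain S where S: "S \<in> bounded_ops" "selfadj S" "norm S < 1"
    "(id_blinfun - S) o\<^sub>L (id_blinfun - S) = id_blinfun - R"
    using selfadj_sqrt[OF closed_bounded_ops bounded_ops_algebra(1,3,4) R_in R_sa nR r(2)] by blast
  define X where "X = id_blinfun - S"
  obtain X' where X': "X o\<^sub>L X' = id_blinfun" "X' o\<^sub>L X = id_blinfun"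
    using id_minus_strict_contraction_invertible[OF S(3)] unfolding X_def by blast
  have X_in: "X \<in> bounded_ops" unfolding X_def using S(1) by (intro bounded_ops_algebra)
  have XX': "X (X' y) = y" "X' (X y) = y" for y
    using arg_cong[OF X'(1), of "\<lambda>T. blinfun_apply T y"] arg_cong[OF X'(2), of "\<lambda>T. blinfun_apply T y"] by simp_all
  have "X' \<in> bounded_ops"
  proof (rule bounded_opsI)
    show "X' (\<i> *\<^sub>C x) = \<i> *\<^sub>C X' x" for x
      by (metis XX' bounded_opsD[OF X_in])
  qed
  then have inv: "inverse_ops X X'" using X_in X' by (simp add: inverse_ops_def)
  have "K * (norm (X x))\<^sup>2 = q x" for x
  proof -
    have "selfadj X" using S(2) by (simp add: X_def selfadj_def blinfun.diff_left inner_simps)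
    then have "(norm (X x))\<^sup>2 = inner (X (X x)) x"
      by (simp add: power2_norm_eq_inner selfadj_def)
    also have "X (X x) = (1 / K) *\<^sub>R P x"
      using arg_cong[OF S(4), of "\<lambda>T. blinfun_apply T x"] by (simp add: X_def R_def blinfun.scaleR_left)
    finally show ?thesis using K by (simp add: P(2))
  qed
  with inv show ?thesis by blast
qed

section \<open>Matrix norms and linear maps on operator algebras\<close>

lemma L2_set_power2: "(L2_set f A)\<^sup>2 = (\<Sum>i\<in>A. (f i)\<^sup>2)"
  by (simp add: L2_set_def sum_nonneg)

lemma mat_norm_nonneg:
  fixes T :: "nat \<Rightarrow> nat \<Rightarrow> ('a::real_normed_vector \<Rightarrow>\<^sub>L 'b::real_normed_vector)"
  shows "0 \<le> mat_norm d T"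
proof -
  have "L2_set (\<lambda>i. norm (\<Sum>j<d. T i j 0)) {..<d} \<le> mat_norm d T"
    unfolding mat_norm_def
    by (rule cSUP_upper[OF _ bdd_above_mat_norm, of "\<lambda>_. 0"]) (simp add: L2_set_def)
  then show ?thesis using L2_set_nonneg order_trans by blast
qed

lemma mat_norm_leI:
  fixes T :: "nat \<Rightarrow> nat \<Rightarrow> ('a::real_normed_vector \<Rightarrow>\<^sub>L 'b::real_normed_vector)"
  assumes "0 \<le> c"
    and "\<And>x. L2_set (\<lambda>i. norm (\<Sum>j<d. T i j (x j))) {..<d} \<le> c * L2_set (\<lambda>j. norm (x j)) {..<d}"
  shows "mat_norm d T \<le> c"
  unfolding mat_norm_def
proof (rule cSUP_least)
  show "{x. L2_set (\<lambda>j. norm (x j :: 'a)) {..<d} \<le> 1} \<noteq> {}"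
    by (auto simp: L2_set_def intro!: exI[of _ "\<lambda>_. 0"])
  fix x :: "nat \<Rightarrow> 'a" assume "x \<in> {x. L2_set (\<lambda>j. norm (x j)) {..<d} \<le> 1}"
  then have "c * L2_set (\<lambda>j. norm (x j)) {..<d} \<le> c * 1"
    using assms(1) by (intro mult_left_mono) auto
  then show "L2_set (\<lambda>i. norm (\<Sum>j<d. T i j (x j))) {..<d} \<le> c" using assms(2)[of x] by simp
qed

lemma mat_norm_apply:
  fixes T :: "nat \<Rightarrow> nat \<Rightarrow> ('a::real_normed_vector \<Rightarrow>\<^sub>L 'b::real_normed_vector)"
  shows "L2_set (\<lambda>i. norm (\<Sum>j<d. T i j (x j))) {..<d} \<le> mat_norm d T * L2_set (\<lambda>j. norm (x j)) {..<d}"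
proof (cases "L2_set (\<lambda>j. norm (x j)) {..<d} = 0")
  case True
  then have "x j = 0" if "j < d" for j using that by (simp add: L2_set_eq_0_iff)
  then have "L2_set (\<lambda>i. norm (\<Sum>j<d. T i j (x j))) {..<d} = 0"
    by (simp add: L2_set_eq_0_iff)
  then show ?thesis using True by simp
next
  case False
  define r where "r = L2_set (\<lambda>j. norm (x j)) {..<d}"
  have r: "r > 0" using False L2_set_nonneg[of "\<lambda>j. norm (x j)" "{..<d}"] by (simp add: r_def less_le)
  have sc: "L2_set (\<lambda>j. norm ((1/r) *\<^sub>R z j)) {..<d} = (1/r) * L2_set (\<lambda>j. norm (z j)) {..<d}" for z :: "nat \<Rightarrow> 'c::real_normed_vector"
    using r by (subst L2_set_right_distrib) simp_all
  have "L2_set (\<lambda>i. norm (\<Sum>j<d. T i j ((1/r) *\<^sub>R x j))) {..<d} \<le> mat_norm d T"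
    unfolding mat_norm_def
    by (rule cSUP_upper[OF _ bdd_above_mat_norm, of "\<lambda>j. (1/r) *\<^sub>R x j"]) (use r in \<open>simp del: norm_scaleR add: sc flip: r_def\<close>)
  also have "(\<lambda>i. norm (\<Sum>j<d. T i j ((1/r) *\<^sub>R x j))) = (\<lambda>i. norm ((1/r) *\<^sub>R (\<Sum>j<d. T i j (x j))))"
    by (simp only: blinfun.scaleR_right scaleR_right.sum)
  finally show ?thesis unfolding sc using r by (simp add: field_simps flip: r_def)
qed

lemma mat_norm_apply_sum:
  fixes T :: "nat \<Rightarrow> nat \<Rightarrow> ('a::real_normed_vector \<Rightarrow>\<^sub>L 'b::real_normed_vector)"
  shows "(\<Sum>i<d. (norm (\<Sum>j<d. T i j (x j)))\<^sup>2) \<le> (mat_norm d T)\<^sup>2 * (\<Sum>j<d. (norm (x j))\<^sup>2)"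
  using power_mono[OF mat_norm_apply[where d = d and T = T and x = x] L2_set_nonneg, of 2]
  by (simp only: power_mult_distrib L2_set_power2)

lemma mat_norm_leI_sum:
  fixes T :: "nat \<Rightarrow> nat \<Rightarrow> ('a::real_normed_vector \<Rightarrow>\<^sub>L 'b::real_normed_vector)"
  assumes c: "0 \<le> c"
    and le: "\<And>x. (\<Sum>i<d. (norm (\<Sum>j<d. T i j (x j)))\<^sup>2) \<le> c\<^sup>2 * (\<Sum>j<d. (norm (x j))\<^sup>2)"
  shows "mat_norm d T \<le> c"
proof (rule mat_norm_leI[OF c])
  fix x
  show "L2_set (\<lambda>i. norm (\<Sum>j<d. T i j (x j))) {..<d} \<le> c * L2_set (\<lambda>j. norm (x j)) {..<d}"
    by (rule power2_le_imp_le) (use le[of x] c in \<open>simp_all add: power_mult_distrib L2_set_power2\<close>)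
qed

lemma scaleC_op_of_real: "scaleC_op (complex_of_real r) T = r *\<^sub>R T"
  by (rule blinfun_eqI) (simp add: scaleC_op.rep_eq scaleC_of_real blinfun.scaleR_left)

lemma unital_operator_algebra_scaleR:
  "unital_operator_algebra F \<Longrightarrow> T \<in> F \<Longrightarrow> r *\<^sub>R T \<in> F"
  unfolding unital_operator_algebra_def by (metis scaleC_op_of_real)

lemma unital_operator_algebra_0: "unital_operator_algebra F \<Longrightarrow> 0 \<in> F"
  using unital_operator_algebra_scaleR[of F id_blinfun 0] by (simp add: unital_operator_algebra_def)

lemma unital_operator_algebra_sum:
  assumes "unital_operator_algebra F" "\<And>i. i \<in> I \<Longrightarrow> T i \<in> F"
  shows "(\<Sum>i\<in>I. T i) \<in> F"
  using assms(2)
  by (induction I rule: infinite_finite_induct)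
     (use assms(1) unital_operator_algebra_0 in \<open>auto simp: unital_operator_algebra_def\<close>)

lemma op_linear_on_scaleR:
  "op_linear_on F \<rho> \<Longrightarrow> T \<in> F \<Longrightarrow> \<rho> (r *\<^sub>R T) = r *\<^sub>R \<rho> T"
  unfolding op_linear_on_def by (metis scaleC_op_of_real)

lemma op_linear_on_0: "op_linear_on F \<rho> \<Longrightarrow> unital_operator_algebra F \<Longrightarrow> \<rho> 0 = 0"
  using op_linear_on_scaleR[of F \<rho> 0 0] unital_operator_algebra_0 by fastforce

lemma op_linear_on_sum:
  assumes "op_linear_on F \<rho>" "unital_operator_algebra F" "\<And>i. i \<in> I \<Longrightarrow> T i \<in> F"
  shows "\<rho> (\<Sum>i\<in>I. T i) = (\<Sum>i\<in>I. \<rho> (T i))"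
  using assms(3)
proof (induction I rule: infinite_finite_induct)
  case (insert i I)
  then have "(\<Sum>i\<in>I. T i) \<in> F" by (intro unital_operator_algebra_sum assms(2)) auto
  then show ?case using insert assms(1) by (simp add: op_linear_on_def)
qed (use assms op_linear_on_0 in auto)

lemma sum_lessThan_if:
  fixes g :: "nat \<Rightarrow> 'b::comm_monoid_add"
  shows "n \<le> d \<Longrightarrow> (\<Sum>j<d. if j < n then g j else 0) = (\<Sum>j<n. g j)"
  by (rule sum.mono_neutral_cong_right) auto

lemma sum_lessThan_add:
  fixes g :: "nat \<Rightarrow> 'b::comm_monoid_add"
  shows "(\<Sum>j<n + n'. g j) = (\<Sum>j<n. g j) + (\<Sum>j<n'. g (n + j))"
  by (induction n') (simp_all add: add.assoc)

section \<open>Paulsen's similarity theorem\<close>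
definition contraction_matrix :: "nat \<Rightarrow> nat \<Rightarrow> (nat \<Rightarrow> nat \<Rightarrow> ('c::real_normed_vector \<Rightarrow>\<^sub>L 'c)) \<Rightarrow> bool"
  where "contraction_matrix m n f \<longleftrightarrow>
    (\<forall>v. (\<Sum>i<m. (norm (\<Sum>j<n. f i j (v j)))\<^sup>2) \<le> (\<Sum>j<n. (norm (v j))\<^sup>2))"

text \<open>
  The preorder for which the new norm has to be monotone. Rectangular matrices and lists,
rather than square matrices, make direct sums and permutations of vectors available.
\<close>
definition dominated ::
    "('c::real_normed_vector \<Rightarrow>\<^sub>L 'c) set \<Rightarrow> (('c \<Rightarrow>\<^sub>L 'c) \<Rightarrow> ('a::real_normed_vector \<Rightarrow>\<^sub>L 'a)) \<Rightarrow> 'a list \<Rightarrow> 'a list \<Rightarrow> bool"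
  where "dominated F \<rho> xs ys \<longleftrightarrow> (\<exists>f.
    (\<forall>i<length xs. \<forall>j<length ys. f i j \<in> F) \<and> contraction_matrix (length xs) (length ys) f \<and>
    (\<forall>i<length xs. xs ! i = (\<Sum>j<length ys. \<rho> (f i j) (ys ! j))))"

locale unital_cb_hom =
  fixes F :: "('c::complex_inner \<Rightarrow>\<^sub>L 'c) set"
    and \<rho> :: "('c \<Rightarrow>\<^sub>L 'c) \<Rightarrow> ('a::chilbert_space \<Rightarrow>\<^sub>L 'a)"
  assumes alg: "unital_operator_algebra F"
    and cb: "completely_bounded_on F \<rho>"
    and unital: "\<rho> id_blinfun = id_blinfun"
    and mult: "\<And>S T. S \<in> F \<Longrightarrow> T \<in> F \<Longrightarrow> \<rho> (S o\<^sub>L T) = \<rho> S o\<^sub>L \<rho> T"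
begin

lemma lin: "op_linear_on F \<rho>"
  using cb by (simp add: completely_bounded_on_def)

lemma id_in: "id_blinfun \<in> F"
  using alg by (simp add: unital_operator_algebra_def)

lemmas in_F = alg[THEN unital_operator_algebra_0] alg[THEN unital_operator_algebra_scaleR] id_in
lemmas rho_simps = op_linear_on_0[OF lin alg] op_linear_on_scaleR[OF lin] unital

lemma dominated_if_mset_eq:
  assumes "mset xs = mset ys"
  shows "dominated F \<rho> xs ys"
proof -
  obtain p where p: "p permutes {..<length ys}" "permute_list p ys = xs"
    using mset_eq_permutation[OF assms] .
  have len: "length xs = length ys" using assms mset_eq_length by blast
  have pi: "p i < length ys" if "i < length ys" for i
    using permutes_in_image[OF p(1)] that by simp
  define f where "f i j = (if j = p i then id_blinfun else 0 :: 'c \<Rightarrow>\<^sub>L 'c)" for i j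
  have fv: "(\<Sum>j<length ys. f i j (v j)) = v (p i)" if "i < length ys" for i v
    using pi[OF that] by (simp add: f_def if_distrib[of "\<lambda>T. blinfun_apply T _"] cong: if_cong)
  have rv: "(\<Sum>j<length ys. \<rho> (f i j) (v j)) = v (p i)" if "i < length ys" for i v
    using pi[OF that] by (simp add: f_def if_distrib[of \<rho>] if_distrib[of "\<lambda>T. blinfun_apply T _"] rho_simps cong: if_cong)
  have "contraction_matrix (length ys) (length ys) f"
    unfolding contraction_matrix_def
  proof
    fix v :: "nat \<Rightarrow> 'c"
    have "(\<Sum>i<length ys. (norm (\<Sum>j<length ys. f i j (v j)))\<^sup>2) = (\<Sum>i<length ys. (norm (v (p i)))\<^sup>2)"
      by (intro sum.cong) (simp_all add: fv)
    also have "\<dots> = (\<Sum>i<length ys. (norm (v i))\<^sup>2)"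
      using sum.permute[OF p(1), of "\<lambda>i. (norm (v i))\<^sup>2"] by (simp add: comp_def)
    finally show "(\<Sum>i<length ys. (norm (\<Sum>j<length ys. f i j (v j)))\<^sup>2) \<le> (\<Sum>j<length ys. (norm (v j))\<^sup>2)"
      by simp
  qed
  moreover have "xs ! i = ys ! p i" if "i < length ys" for i
    using p that by (metis permute_list_nth)
  moreover have "f i j \<in> F" for i j by (simp add: f_def in_F)
  ultimately show ?thesis unfolding dominated_def len
    by (intro exI[of _ f]) (simp add: rv)
qed

lemma dominated_trans:
  assumes "dominated F \<rho> xs ys" "dominated F \<rho> ys zs"
  shows "dominated F \<rho> xs zs"
proof -
  let ?m = "length xs" and ?n = "length ys" and ?l = "length zs"
  obtain f where f: "\<And>i j. i < ?m \<Longrightarrow> j < ?n \<Longrightarrow> f i j \<in> F" "contraction_matrix ?m ?n f"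
    "\<And>i. i < ?m \<Longrightarrow> xs ! i = (\<Sum>j<?n. \<rho> (f i j) (ys ! j))"
    using assms(1) unfolding dominated_def by blast
  obtain g where g: "\<And>i j. i < ?n \<Longrightarrow> j < ?l \<Longrightarrow> g i j \<in> F" "contraction_matrix ?n ?l g"
    "\<And>i. i < ?n \<Longrightarrow> ys ! i = (\<Sum>j<?l. \<rho> (g i j) (zs ! j))"
    using assms(2) unfolding dominated_def by blast
  define h where "h i k = (\<Sum>j<?n. f i j o\<^sub>L g j k)" for i k
  have comp: "f i j o\<^sub>L g j k \<in> F" if "i < ?m" "j < ?n" "k < ?l" for i j k
    using alg f(1) g(1) that by (simp add: unital_operator_algebra_def)
  have h_in: "h i k \<in> F" if "i < ?m" "k < ?l" for i k
    unfolding h_def using comp that by (intro unital_operator_algebra_sum[OF alg]) auto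
  have hv: "(\<Sum>k<?l. h i k (v k)) = (\<Sum>j<?n. f i j (\<Sum>k<?l. g j k (v k)))" for i and v :: "nat \<Rightarrow> 'c"
    unfolding h_def by (simp add: blinfun.sum_left blinfun.sum_right) (rule sum.swap)
  have "contraction_matrix ?m ?l h"
    unfolding contraction_matrix_def hv
    using f(2) g(2) unfolding contraction_matrix_def by (meson order_trans)
  moreover have "xs ! i = (\<Sum>k<?l. \<rho> (h i k) (zs ! k))" if i: "i < ?m" for i
  proof -
    have "\<rho> (h i k) = (\<Sum>j<?n. \<rho> (f i j) o\<^sub>L \<rho> (g j k))" if "k < ?l" for k
      unfolding h_def using i that comp f(1) g(1)
      by (subst op_linear_on_sum[OF lin alg]) (auto intro!: sum.cong simp: mult)
    then have "(\<Sum>k<?l. \<rho> (h i k) (zs ! k)) = (\<Sum>k<?l. \<Sum>j<?n. \<rho> (f i j) (\<rho> (g j k) (zs ! k)))"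
      by (simp add: blinfun.sum_left)
    also have "\<dots> = (\<Sum>j<?n. \<Sum>k<?l. \<rho> (f i j) (\<rho> (g j k) (zs ! k)))" by (rule sum.swap)
    also have "\<dots> = (\<Sum>j<?n. \<rho> (f i j) (ys ! j))"
      by (intro sum.cong) (simp_all add: g(3) blinfun.sum_right)
    finally show ?thesis using f(3)[OF i] by simp
  qed
  ultimately show ?thesis unfolding dominated_def using h_in by blast
qed

text \<open>
  A direct sum of contractive matrices is contractive.
\<close>
lemma dominated_append:
  assumes "dominated F \<rho> xs ys" "dominated F \<rho> xs' ys'"
  shows "dominated F \<rho> (xs @ xs') (ys @ ys')"
proof -
  let ?m = "length xs" and ?n = "length ys" and ?m' = "length xs'" and ?n' = "length ys'"
  obtain f where f: "\<And>i j. i < ?m \<Longrightarrow> j < ?n \<Longrightarrow> f i j \<in> F" "contraction_matrix ?m ?n f"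
    "\<And>i. i < ?m \<Longrightarrow> xs ! i = (\<Sum>j<?n. \<rho> (f i j) (ys ! j))"
    using assms(1) unfolding dominated_def by blast
  obtain g where g: "\<And>i j. i < ?m' \<Longrightarrow> j < ?n' \<Longrightarrow> g i j \<in> F" "contraction_matrix ?m' ?n' g"
    "\<And>i. i < ?m' \<Longrightarrow> xs' ! i = (\<Sum>j<?n'. \<rho> (g i j) (ys' ! j))"
    using assms(2) unfolding dominated_def by blast
  define h where "h i j = (if i < ?m then (if j < ?n then f i j else 0)
      else if j < ?n then 0 else g (i - ?m) (j - ?n))" for i j
  have "contraction_matrix (?m + ?m') (?n + ?n') h"
    unfolding contraction_matrix_def
  proof
    fix v :: "nat \<Rightarrow> 'c"
    have "(\<Sum>i<?m. (norm (\<Sum>j<?n. f i j (v j)))\<^sup>2) \<le> (\<Sum>j<?n. (norm (v j))\<^sup>2)"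
      using f(2) by (simp add: contraction_matrix_def)
    moreover have "(\<Sum>i<?m'. (norm (\<Sum>j<?n'. g i j (v (?n + j))))\<^sup>2) \<le> (\<Sum>j<?n'. (norm (v (?n + j)))\<^sup>2)"
      using g(2)[unfolded contraction_matrix_def, rule_format, of "\<lambda>j. v (?n + j)"] .
    ultimately show "(\<Sum>i<?m + ?m'. (norm (\<Sum>j<?n + ?n'. h i j (v j)))\<^sup>2) \<le> (\<Sum>j<?n + ?n'. (norm (v j))\<^sup>2)"
      by (simp add: sum_lessThan_add h_def)
  qed
  moreover have "(xs @ xs') ! i = (\<Sum>j<?n + ?n'. \<rho> (h i j) ((ys @ ys') ! j))" if "i < ?m + ?m'" for i
  proof (cases "i < ?m")
    case True
    then show ?thesis by (simp add: sum_lessThan_add h_def nth_append f(3) rho_simps)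
  next
    case False
    then have "i - ?m < ?m'" using that by simp
    from g(3)[OF this] False show ?thesis by (simp add: sum_lessThan_add h_def nth_append rho_simps)
  qed
  moreover have "h i j \<in> F" if "i < ?m + ?m'" "j < ?n + ?n'" for i j
    using that f(1) g(1) in_F by (auto simp: h_def)
  ultimately show ?thesis unfolding dominated_def by (intro exI[of _ h]) simp
qed

text \<open>
  Complete boundedness is stated for square matrices; a rectangular contraction becomes a square one
after padding with zeros.
\<close>
lemma dominated_bound:
  assumes K: "\<And>d T. (\<forall>i<d. \<forall>j<d. T i j \<in> F) \<Longrightarrow> mat_norm d (\<lambda>i j. \<rho> (T i j)) \<le> K * mat_norm d T"
    and dom: "dominated F \<rho> xs ys"
  shows "(\<Sum>i<length xs. (norm (xs ! i))\<^sup>2) \<le> K\<^sup>2 * (\<Sum>j<length ys. (norm (ys ! j))\<^sup>2)"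
proof -
  let ?m = "length xs" and ?n = "length ys"
  obtain f where f: "\<And>i j. i < ?m \<Longrightarrow> j < ?n \<Longrightarrow> f i j \<in> F" "contraction_matrix ?m ?n f"
    "\<And>i. i < ?m \<Longrightarrow> xs ! i = (\<Sum>j<?n. \<rho> (f i j) (ys ! j))"
    using dom unfolding dominated_def by blast
  define d where "d = max ?m ?n"
  have d: "?m \<le> d" "?n \<le> d" by (simp_all add: d_def)
  define T where "T i j = (if i < ?m \<and> j < ?n then f i j else 0)" for i j
  have T_in: "\<forall>i<d. \<forall>j<d. T i j \<in> F" using f(1) in_F by (simp add: T_def)
  have row: "(\<Sum>j<d. T i j (v j)) = (if i < ?m then (\<Sum>j<?n. f i j (v j)) else 0)" for i and v :: "nat \<Rightarrow> 'c"
    using sum_lessThan_if[OF d(2), of "\<lambda>j. f i j (v j)"]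
    by (simp add: T_def if_distrib[of "\<lambda>T. blinfun_apply T _"] cong: if_cong)
  have row': "(\<Sum>j<d. \<rho> (T i j) (v j)) = (if i < ?m then (\<Sum>j<?n. \<rho> (f i j) (v j)) else 0)" for i v
    using sum_lessThan_if[OF d(2), of "\<lambda>j. \<rho> (f i j) (v j)"]
    by (simp add: T_def if_distrib[of \<rho>] rho_simps if_distrib[of "\<lambda>T. blinfun_apply T _"] cong: if_cong)
  have sq: "(\<Sum>i<d. (norm (if i < ?m then g i else 0))\<^sup>2) = (\<Sum>i<?m. (norm (g i))\<^sup>2)" for g :: "nat \<Rightarrow> 'x::real_normed_vector"
    using sum_lessThan_if[OF d(1), of "\<lambda>i. (norm (g i))\<^sup>2"]
    by (simp add: if_distrib[of norm] if_distrib[of "\<lambda>x. x\<^sup>2"] cong: if_cong)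
  have "mat_norm d T \<le> 1"
  proof (rule mat_norm_leI_sum)
    fix v :: "nat \<Rightarrow> 'c"
    have "(\<Sum>i<d. (norm (\<Sum>j<d. T i j (v j)))\<^sup>2) \<le> (\<Sum>j<?n. (norm (v j))\<^sup>2)"
      unfolding row sq using f(2) by (simp add: contraction_matrix_def)
    also have "\<dots> \<le> (\<Sum>j<d. (norm (v j))\<^sup>2)" using d by (intro sum_mono2) auto
    finally show "(\<Sum>i<d. (norm (\<Sum>j<d. T i j (v j)))\<^sup>2) \<le> 1\<^sup>2 * (\<Sum>j<d. (norm (v j))\<^sup>2)" by simp
  qed simp
  then have "\<bar>K * mat_norm d T\<bar> \<le> \<bar>K\<bar> * 1"
    unfolding abs_mult using mat_norm_nonneg[of d T] by (intro mult_left_mono) auto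
  then have "mat_norm d (\<lambda>i j. \<rho> (T i j)) \<le> \<bar>K\<bar>" using K[OF T_in] by simp
  then have sqK: "(mat_norm d (\<lambda>i j. \<rho> (T i j)))\<^sup>2 \<le> K\<^sup>2"
    using power_mono[OF _ mat_norm_nonneg, of d _ "\<bar>K\<bar>" 2] by simp
  define y where "y j = (if j < ?n then ys ! j else 0)" for j
  have "(\<Sum>i<?m. (norm (xs ! i))\<^sup>2) = (\<Sum>i<d. (norm (\<Sum>j<d. \<rho> (T i j) (y j)))\<^sup>2)"
    unfolding row' sq by (simp add: f(3) y_def)
  also have "\<dots> \<le> (mat_norm d (\<lambda>i j. \<rho> (T i j)))\<^sup>2 * (\<Sum>j<d. (norm (y j))\<^sup>2)"
    by (rule mat_norm_apply_sum)
  also have "\<dots> \<le> K\<^sup>2 * (\<Sum>j<d. (norm (y j))\<^sup>2)"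
    by (intro mult_right_mono sqK sum_nonneg) simp
  also have "(\<Sum>j<d. (norm (y j))\<^sup>2) = (\<Sum>j<?n. (norm (ys ! j))\<^sup>2)"
    using sum_lessThan_if[OF d(2), of "\<lambda>j. (norm (ys ! j))\<^sup>2"]
    by (simp add: y_def if_distrib[of norm] if_distrib[of "\<lambda>x. x\<^sup>2"] cong: if_cong)
  finally show ?thesis .
qed

text \<open>
  Forgetting the order of the vectors makes concatenation commutative, as \<open>monotone_sandwich\<close> requires.
\<close>
definition dominated_mset :: "'a multiset \<Rightarrow> 'a multiset \<Rightarrow> bool"
  where "dominated_mset X Y \<longleftrightarrow> (\<exists>xs ys. mset xs = X \<and> mset ys = Y \<and> dominated F \<rho> xs ys)"

lemma sum_mset_nth: "(\<Sum>x\<in>#mset xs. g x) = (\<Sum>i<length xs. g (xs ! i) :: real)"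
  by (simp add: sum_mset_sum_list sum_list_sum_nth atLeast0LessThan flip: mset_map)

lemma monotone_quadratic_form:
  "\<exists>q K. 1 \<le> K \<and> (\<forall>x. (norm x)\<^sup>2 \<le> q x \<and> q x \<le> K * (norm x)\<^sup>2) \<and>
    (\<forall>xs ys. dominated F \<rho> xs ys \<longrightarrow> (\<Sum>i<length xs. q (xs ! i)) \<le> (\<Sum>j<length ys. q (ys ! j)))"
proof -
  obtain K where K: "\<And>d T. (\<forall>i<d. \<forall>j<d. T i j \<in> F) \<Longrightarrow>
      mat_norm d (\<lambda>i j. \<rho> (T i j)) \<le> K * mat_norm d T"
    using cb unfolding completely_bounded_on_def by blast
  define L where "L = max 1 (K\<^sup>2)"
  have "\<exists>q. (\<forall>x. (norm x)\<^sup>2 \<le> q x \<and> q x \<le> L * (norm x)\<^sup>2) \<and>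
    (\<forall>X Y. dominated_mset X Y \<longrightarrow> (\<Sum>x\<in>#X. q x) \<le> (\<Sum>y\<in>#Y. q y))"
  proof (rule monotone_sandwich)
    show "dominated_mset X X" for X
    proof -
      obtain xs where "mset xs = X" using ex_mset by blast
      then show ?thesis unfolding dominated_mset_def using dominated_if_mset_eq by blast
    qed
    show "dominated_mset X Z" if XY: "dominated_mset X Y" and YZ: "dominated_mset Y Z" for X Y Z
    proof -
      obtain xs ys where 1: "mset xs = X" "mset ys = Y" "dominated F \<rho> xs ys"
        using XY unfolding dominated_mset_def by blast
      obtain ys' zs where 2: "mset ys' = Y" "mset zs = Z" "dominated F \<rho> ys' zs"
        using YZ unfolding dominated_mset_def by blast
      have "dominated F \<rho> ys ys'" using 1 2 by (intro dominated_if_mset_eq) simp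
      then have "dominated F \<rho> xs zs" using 1(3) 2(3) dominated_trans by blast
      then show ?thesis unfolding dominated_mset_def using 1 2 by blast
    qed
    show "dominated_mset (X + X') (Y + Y')" if "dominated_mset X Y" "dominated_mset X' Y'" for X Y X' Y'
      using that dominated_append unfolding dominated_mset_def by (metis mset_append)
    show "(\<Sum>x\<in>#X. (norm x)\<^sup>2) \<le> (\<Sum>y\<in>#Y. L * (norm y)\<^sup>2)" if XY: "dominated_mset X Y" for X Y
    proof -
      obtain xs ys where 1: "mset xs = X" "mset ys = Y" "dominated F \<rho> xs ys"
        using XY unfolding dominated_mset_def by blast
      have "(\<Sum>i<length xs. (norm (xs ! i))\<^sup>2) \<le> K\<^sup>2 * (\<Sum>j<length ys. (norm (ys ! j))\<^sup>2)"
        by (rule dominated_bound[OF K 1(3)])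
      also have "\<dots> \<le> L * (\<Sum>j<length ys. (norm (ys ! j))\<^sup>2)"
        by (intro mult_right_mono sum_nonneg) (simp_all add: L_def)
      finally show ?thesis by (simp add: sum_mset_nth sum_distrib_left flip: 1(1,2))
    qed
  qed
  then obtain q where q: "\<And>x. (norm x)\<^sup>2 \<le> q x" "\<And>x. q x \<le> L * (norm x)\<^sup>2"
    "\<And>X Y. dominated_mset X Y \<Longrightarrow> (\<Sum>x\<in>#X. q x) \<le> (\<Sum>y\<in>#Y. q y)" by blast
  have "(\<Sum>i<length xs. q (xs ! i)) \<le> (\<Sum>j<length ys. q (ys ! j))" if "dominated F \<rho> xs ys" for xs ys
    using q(3)[of "mset xs" "mset ys"] that unfolding dominated_mset_def sum_mset_nth by blast
  moreover have "1 \<le> L" by (simp add: L_def)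
  ultimately show ?thesis using q(1,2) by blast
qed

text \<open>
  The vectors \<open>(1,1,1,1)/2\<close> and \<open>(1,1,-1,-1)/2\<close> are orthonormal. Hence the scalar matrix with these
rows and its transpose are contractions, one taking \<open>(x,x,y,y)\<close> to \<open>(x+y,x-y)\<close> and the
other going back. A monotone \<open>q\<close> therefore satisfies the parallelogram law.
\<close>
lemma dominated_half_sums:
  "dominated F \<rho> [x + y, x - y] [x, x, y, y]" "dominated F \<rho> [x, x, y, y] [x + y, x - y]"
proof -
  define f where "f i j = (if i = 0 \<or> j < 2 then 1/2 else - 1/2 :: real) *\<^sub>R (id_blinfun :: 'c \<Rightarrow>\<^sub>L 'c)" for i j :: nat
  have f_rho: "\<rho> (f i j) = (if i = 0 \<or> j < 2 then 1/2 else - 1/2 :: real) *\<^sub>R id_blinfun" for i j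
    by (simp add: f_def rho_simps in_F)
  have f_in: "f i j \<in> F" for i j by (simp add: f_def in_F)
  have half: "(1/2) *\<^sub>R z + (1/2) *\<^sub>R z = z" "- ((1/2) *\<^sub>R z) - (1/2) *\<^sub>R z = - z" for z :: 'a
  proof -
    show "(1/2) *\<^sub>R z + (1/2) *\<^sub>R z = z" by (simp flip: scaleR_add_left)
    then show "- ((1/2) *\<^sub>R z) - (1/2) *\<^sub>R z = - z"
      by (metis minus_add_distrib add_uminus_conv_diff)
  qed
  have "contraction_matrix 2 4 f"
    unfolding contraction_matrix_def
  proof
    fix v :: "nat \<Rightarrow> 'c"
    have *: "(norm ((1/2) *\<^sub>R (a + b + c + d)))\<^sup>2 + (norm ((1/2) *\<^sub>R (a + b - c - d)))\<^sup>2
      = (norm a)\<^sup>2 + (norm b)\<^sup>2 + (norm c)\<^sup>2 + (norm d)\<^sup>2 - (1/2) * (norm (a - b))\<^sup>2 - (1/2) * (norm (c - d))\<^sup>2"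
      for a b c d :: 'c
      by (simp add: power_mult_distrib power_divide power2_norm_eq_inner inner_simps inner_commute field_simps)
    have "(\<Sum>i<2. (norm (\<Sum>j<4. f i j (v j)))\<^sup>2)
        = (norm ((1/2) *\<^sub>R (v 0 + v 1 + v 2 + v 3)))\<^sup>2 + (norm ((1/2) *\<^sub>R (v 0 + v 1 - v 2 - v 3)))\<^sup>2"
      by (simp add: f_def eval_nat_numeral blinfun.scaleR_left scaleR_add_right scaleR_diff_right)
    also have "\<dots> \<le> (norm (v 0))\<^sup>2 + (norm (v 1))\<^sup>2 + (norm (v 2))\<^sup>2 + (norm (v 3))\<^sup>2"
      unfolding * by simp
    also have "\<dots> = (\<Sum>j<4. (norm (v j))\<^sup>2)" by (simp add: eval_nat_numeral)
    finally show "(\<Sum>i<2. (norm (\<Sum>j<4. f i j (v j)))\<^sup>2) \<le> (\<Sum>j<4. (norm (v j))\<^sup>2)" .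
  qed
  then show "dominated F \<rho> [x + y, x - y] [x, x, y, y]"
    unfolding dominated_def
    apply (intro exI[of _ f])
    apply (simp add: f_in f_rho eval_nat_numeral blinfun.scaleR_left less_Suc_eq)
    apply (simp add: half add.assoc diff_diff_eq)
    done
  have "contraction_matrix 4 2 (\<lambda>i j. f j i)"
    unfolding contraction_matrix_def
  proof
    fix v :: "nat \<Rightarrow> 'c"
    have *: "2 * (norm ((1/2) *\<^sub>R (a + b)))\<^sup>2 + 2 * (norm ((1/2) *\<^sub>R (a - b)))\<^sup>2 = (norm a)\<^sup>2 + (norm b)\<^sup>2"
      for a b :: 'c
      by (simp add: power_mult_distrib power_divide power2_norm_eq_inner inner_simps inner_commute field_simps)
    have "(\<Sum>i<4. (norm (\<Sum>j<2. f j i (v j)))\<^sup>2)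
        = 2 * (norm ((1/2) *\<^sub>R (v 0 + v 1)))\<^sup>2 + 2 * (norm ((1/2) *\<^sub>R (v 0 - v 1)))\<^sup>2"
      by (simp add: f_def eval_nat_numeral blinfun.scaleR_left scaleR_add_right scaleR_diff_right)
    also have "\<dots> = (\<Sum>j<2. (norm (v j))\<^sup>2)" unfolding * by (simp add: eval_nat_numeral)
    finally show "(\<Sum>i<4. (norm (\<Sum>j<2. f j i (v j)))\<^sup>2) \<le> (\<Sum>j<2. (norm (v j))\<^sup>2)" by simp
  qed
  then show "dominated F \<rho> [x, x, y, y] [x + y, x - y]"
    unfolding dominated_def
    apply (intro exI[of _ "\<lambda>i j. f j i"])
    apply (simp add: f_in f_rho eval_nat_numeral blinfun.scaleR_left less_Suc_eq)
    apply (simp add: scaleR_add_right scaleR_diff_right half)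
    done
qed

lemma dominated_ii: "dominated F \<rho> [\<i> *\<^sub>C x] [x]"
  unfolding dominated_def
proof (intro exI[of _ "\<lambda>_ _. scaleC_op \<i> id_blinfun"] conjI)
  show "\<forall>i<length [\<i> *\<^sub>C x]. \<forall>j<length [x]. scaleC_op \<i> id_blinfun \<in> F"
    using alg id_in by (simp add: unital_operator_algebra_def)
  show "contraction_matrix (length [\<i> *\<^sub>C x]) (length [x]) (\<lambda>_ _. scaleC_op \<i> (id_blinfun :: 'c \<Rightarrow>\<^sub>L 'c))"
    by (simp add: contraction_matrix_def scaleC_op.rep_eq norm_scaleC)
  have "\<rho> (scaleC_op \<i> id_blinfun) = scaleC_op \<i> id_blinfun"
    using lin id_in unital by (simp add: op_linear_on_def)
  then show "\<forall>i<length [\<i> *\<^sub>C x]. [\<i> *\<^sub>C x] ! i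
      = (\<Sum>j<length [x]. \<rho> (scaleC_op \<i> id_blinfun) ([x] ! j))"
    by (simp add: scaleC_op.rep_eq)
qed

text \<open>
  Paulsen's similarity theorem. Monotonicity of \<open>q\<close> with respect to contractive matrices
over \<open>F\<close> says that \<open>\<rho>\<close> is completely contractive for the norm \<open>sqrt q\<close>, and \<open>X\<close> carries this
norm to a multiple of the original one.
\<close>
theorem similar_to_completely_contractive:
  "\<exists>X X'. inverse_ops X X' \<and> (\<forall>d T. (\<forall>i<d. \<forall>j<d. T i j \<in> F) \<longrightarrow>
      mat_norm d (\<lambda>i j. X o\<^sub>L \<rho> (T i j) o\<^sub>L X') \<le> mat_norm d T)"
proof -
  obtain q K where K: "1 \<le> K" and q: "\<And>x. (norm x)\<^sup>2 \<le> q x" "\<And>x. q x \<le> K * (norm x)\<^sup>2"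
    and mono: "\<And>xs ys. dominated F \<rho> xs ys \<Longrightarrow> (\<Sum>i<length xs. q (xs ! i)) \<le> (\<Sum>j<length ys. q (ys ! j))"
    using monotone_quadratic_form by blast
  have "q (x + y) + q (x - y) = 2 * q x + 2 * q y" for x y
    using mono[OF dominated_half_sums(1), of x y] mono[OF dominated_half_sums(2), of x y]
    by simp
  moreover have "q (\<i> *\<^sub>C x) = q x" for x
  proof -
    have le: "q (\<i> *\<^sub>C x) \<le> q x" for x using mono[OF dominated_ii, of x] by simp
    have "\<i> *\<^sub>C \<i> *\<^sub>C \<i> *\<^sub>C \<i> *\<^sub>C x = x"
      using scaleC_of_real[of 1 x] by (simp add: scaleC_scaleC)
    then show ?thesis using le[of x] le[of "\<i> *\<^sub>C x"] le[of "\<i> *\<^sub>C \<i> *\<^sub>C x"] le[of "\<i> *\<^sub>C \<i> *\<^sub>C \<i> *\<^sub>C x"]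
      by simp
  qed
  ultimately obtain X X' where X: "inverse_ops X X'" "\<And>x. K * (norm (blinfun_apply X x))\<^sup>2 = q x"
    using equivalent_hilbert_norm_similarity[of q K] q K by blast
  have XX': "X (X' y) = y" for y
    using X(1) unfolding inverse_ops_def by (metis blinfun_apply_blinfun_compose blinfun_apply_id_blinfun)
  have "mat_norm d (\<lambda>i j. X o\<^sub>L \<rho> (T i j) o\<^sub>L X') \<le> mat_norm d T"
    if T: "\<forall>i<d. \<forall>j<d. T i j \<in> F" for d T
  \<comment> \<open>Dividing by \<open>c\<close> instead of the norm of \<open>T\<close> avoids a separate treatment of norm zero.\<close>
  proof (rule dense_ge)
    fix c assume c: "mat_norm d T < c"
    then have c0: "0 < c" using mat_norm_nonneg[of d T] by simp
    show "mat_norm d (\<lambda>i j. X o\<^sub>L \<rho> (T i j) o\<^sub>L X') \<le> c"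
    proof (rule mat_norm_leI_sum)
      fix x :: "nat \<Rightarrow> 'a"
      define f where "f i j = (1 / c) *\<^sub>R T i j" for i j
      define y where "y i = (\<Sum>j<d. \<rho> (f i j) (X' (x j)))" for i
      have f_in: "f i j \<in> F" if "i < d" "j < d" for i j using T that by (simp add: f_def in_F)
      have "contraction_matrix d d f"
        unfolding contraction_matrix_def
      proof
        fix v :: "nat \<Rightarrow> 'c"
        have "(\<Sum>i<d. (norm (\<Sum>j<d. f i j (v j)))\<^sup>2) = (1 / c)\<^sup>2 * (\<Sum>i<d. (norm (\<Sum>j<d. T i j (v j)))\<^sup>2)"
          by (simp add: f_def blinfun.scaleR_left power_mult_distrib power_divide sum_distrib_left flip: scaleR_right.sum sum_divide_distrib)
        also have "\<dots> \<le> (1 / c)\<^sup>2 * (c\<^sup>2 * (\<Sum>j<d. (norm (v j))\<^sup>2))"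
        proof (rule mult_left_mono)
          have "(mat_norm d T)\<^sup>2 \<le> c\<^sup>2" using c by (intro power_mono mat_norm_nonneg) simp
          then show "(\<Sum>i<d. (norm (\<Sum>j<d. T i j (v j)))\<^sup>2) \<le> c\<^sup>2 * (\<Sum>j<d. (norm (v j))\<^sup>2)"
            by (rule order_trans[OF mat_norm_apply_sum mult_right_mono]) (simp add: sum_nonneg)
        qed simp
        also have "\<dots> = (\<Sum>j<d. (norm (v j))\<^sup>2)" using c0 by (simp add: power_divide)
        finally show "(\<Sum>i<d. (norm (\<Sum>j<d. f i j (v j)))\<^sup>2) \<le> (\<Sum>j<d. (norm (v j))\<^sup>2)" .
      qed
      then have "dominated F \<rho> (map y [0..<d]) (map (\<lambda>j. X' (x j)) [0..<d])"
        unfolding dominated_def using f_in by (intro exI[of _ f]) (simp add: y_def)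
      from mono[OF this] have "(\<Sum>i<d. q (y i)) \<le> (\<Sum>j<d. q (X' (x j)))" by simp
      then have "K * (\<Sum>i<d. (norm (X (y i)))\<^sup>2) \<le> K * (\<Sum>j<d. (norm (x j))\<^sup>2)"
        by (simp add: sum_distrib_left XX' flip: X(2))
      then have le: "(\<Sum>i<d. (norm (X (y i)))\<^sup>2) \<le> (\<Sum>j<d. (norm (x j))\<^sup>2)" using K by simp
      have "(\<Sum>j<d. (X o\<^sub>L \<rho> (T i j) o\<^sub>L X') (x j)) = c *\<^sub>R X (y i)" if "i < d" for i
      proof -
        have "\<rho> (f i j) = (1 / c) *\<^sub>R \<rho> (T i j)" if "j < d" for j
          using T \<open>i < d\<close> that by (simp add: f_def rho_simps)
        then have "y i = (1 / c) *\<^sub>R (\<Sum>j<d. \<rho> (T i j) (X' (x j)))"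
          by (simp add: y_def blinfun.scaleR_left scaleR_right.sum)
        then show ?thesis using c0 by (simp add: blinfun.scaleR_right blinfun.sum_right)
      qed
      then have "(\<Sum>i<d. (norm (\<Sum>j<d. (X o\<^sub>L \<rho> (T i j) o\<^sub>L X') (x j)))\<^sup>2) = c\<^sup>2 * (\<Sum>i<d. (norm (X (y i)))\<^sup>2)"
        using c0 by (simp add: power_mult_distrib sum_distrib_left)
      also have "\<dots> \<le> c\<^sup>2 * (\<Sum>j<d. (norm (x j))\<^sup>2)" using le by (intro mult_left_mono) auto
      finally show "(\<Sum>i<d. (norm (\<Sum>j<d. (X o\<^sub>L \<rho> (T i j) o\<^sub>L X') (x j)))\<^sup>2) \<le> c\<^sup>2 * (\<Sum>j<d. (norm (x j))\<^sup>2)" .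
    qed (use c0 in simp)
  qed
  with X(1) show ?thesis by blast
qed

end

section \<open>Scalar matrices acting on Hilbert space vectors\<close>

lemma L2_set_sum_le: "L2_set (\<lambda>p. \<Sum>j\<in>J. f j p) P \<le> (\<Sum>j\<in>J. L2_set (f j) P)"
proof (induction J rule: infinite_finite_induct)
  case (insert j J)
  then show ?case using L2_set_triangle_ineq[of "f j" "\<lambda>p. \<Sum>j\<in>J. f j p" P] by simp
qed (simp_all add: L2_set_def)

lemma cinner_zero_left: "cinner 0 (y::'a::complex_inner) = 0"
  using cinner_scaleC_left[of 0 0 y] scaleC_of_real[of 0 "0::'a"] by simp

lemma cinner_sum_left: "cinner (\<Sum>k\<in>A. f k) (y::'a::complex_inner) = (\<Sum>k\<in>A. cinner (f k) y)"
  by (induction A rule: infinite_finite_induct) (simp_all add: cinner_zero_left cinner_add_left)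

lemma cinner_diff_left: "cinner (x - z) (y::'a::complex_inner) = cinner x y - cinner z y"
  using cinner_add_left[of "x - z" z y] by simp

lemma cinner_eq_0_sym: "cinner x y = 0 \<Longrightarrow> cinner y (x::'a::complex_inner) = 0"
  by (metis cinner_commute complex_cnj_zero)

lemma cinner_self_eq_0: "cinner x x = 0 \<Longrightarrow> x = (0::'a::complex_inner)"
  using inner_eq_Re_cinner[of x x] by simp

lemma scaleC_zero_left: "0 *\<^sub>C x = (0::'a::complex_inner)"
  using scaleC_of_real[of 0 x] by simp

lemma scaleC_zero_right: "c *\<^sub>C 0 = (0::'a::complex_inner)"
  using norm_scaleC[of c "0::'a"] by simp

lemma scaleC_sum_right: "c *\<^sub>C (\<Sum>k\<in>A. f k) = (\<Sum>k\<in>A. c *\<^sub>C f k :: 'a::complex_inner)"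
  by (induction A rule: infinite_finite_induct) (simp_all add: scaleC_zero_right scaleC_add_right)

lemma scaleC_sum_left: "(\<Sum>k\<in>A. f k) *\<^sub>C x = (\<Sum>k\<in>A. f k *\<^sub>C x :: 'a::complex_inner)"
  by (induction A rule: infinite_finite_induct) (simp_all add: scaleC_zero_left scaleC_add_left)

lemma scaleC_one: "1 *\<^sub>C x = (x::'a::complex_inner)"
  using scaleC_of_real[of 1 x] by simp

text \<open>
  Gram-Schmidt without normalization, so that linearly dependent vectors need no special treatment:
some of the \<open>e k\<close> are then zero.
\<close>
lemma orthogonal_expansion:
  fixes v :: "nat \<Rightarrow> 'a::complex_inner"
  shows "\<exists>e c. (\<forall>k<m. \<forall>l<m. k \<noteq> l \<longrightarrow> cinner (e k) (e l) = 0) \<and>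
    (\<forall>j<m. v j = (\<Sum>k<m. c j k *\<^sub>C e k))"
proof (induction m)
  case 0
  then show ?case by simp
next
  case (Suc m)
  then obtain e c where e: "\<And>k l. k < m \<Longrightarrow> l < m \<Longrightarrow> k \<noteq> l \<Longrightarrow> cinner (e k) (e l) = 0"
    and v: "\<And>j. j < m \<Longrightarrow> v j = (\<Sum>k<m. c j k *\<^sub>C e k)" by blast
  \<comment> \<open>If \<open>e k = 0\<close>, the quotient is zero, as it should be.\<close>
  define b where "b k = cinner (v m) (e k) / cinner (e k) (e k)" for k
  define u where "u = v m - (\<Sum>k<m. b k *\<^sub>C e k)"
  have u: "cinner u (e l) = 0" if l: "l < m" for l
  proof (cases "cinner (e l) (e l) = 0")
    case True
    then have "e l = 0" by (rule cinner_self_eq_0)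
    then show ?thesis using cinner_eq_0_sym[OF cinner_zero_left] by simp
  next
    case False
    have "(\<Sum>k<m. b k * cinner (e k) (e l)) = (\<Sum>k\<in>{l}. b k * cinner (e k) (e l))"
      using l e by (intro sum.mono_neutral_right) auto
    then show ?thesis using False
      by (simp add: u_def cinner_diff_left cinner_sum_left cinner_scaleC_left) (simp add: b_def)
  qed
  define e' where "e' = e(m := u)"
  define c' where "c' j k = (if j = m then (if k = m then 1 else b k) else if k = m then 0 else c j k)" for j k
  have "cinner (e' k) (e' l) = 0" if "k < Suc m" "l < Suc m" "k \<noteq> l" for k l
    using that e u cinner_eq_0_sym[OF u] by (auto simp: e'_def less_Suc_eq)
  moreover have "v j = (\<Sum>k<Suc m. c' j k *\<^sub>C e' k)" if "j < Suc m" for j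
    using that by (auto simp: c'_def e'_def less_Suc_eq v u_def scaleC_zero_left scaleC_one)
  ultimately show ?case by blast
qed

lemma norm_orthogonal_combination:
  fixes e :: "nat \<Rightarrow> 'a::complex_inner"
  assumes e: "\<forall>k<m. \<forall>l<m. k \<noteq> l \<longrightarrow> cinner (e k) (e l) = 0"
  shows "(norm (\<Sum>k<m. z k *\<^sub>C e k))\<^sup>2 = (\<Sum>k<m. (cmod (z k))\<^sup>2 * (norm (e k))\<^sup>2)"
  using e
proof (induction m)
  case (Suc m)
  have "cinner (\<Sum>k<m. z k *\<^sub>C e k) (z m *\<^sub>C e m) = 0"
    using Suc.prems by (simp add: cinner_sum_left cinner_scaleC_left cinner_scaleC_right)
  then have "inner (\<Sum>k<m. z k *\<^sub>C e k) (z m *\<^sub>C e m) = 0" by (simp add: inner_eq_Re_cinner)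
  then have "(norm ((\<Sum>k<m. z k *\<^sub>C e k) + z m *\<^sub>C e m))\<^sup>2
      = (norm (\<Sum>k<m. z k *\<^sub>C e k))\<^sup>2 + (norm (z m *\<^sub>C e m))\<^sup>2"
    by (simp add: power2_norm_eq_inner inner_simps inner_commute)
  then show ?case using Suc by (simp add: norm_scaleC power_mult_distrib)
qed simp

text \<open>
  In coordinates with respect to orthogonal vectors the matrix acts on each coordinate column separately.
\<close>
lemma scalar_matrix_amplification:
  fixes v :: "nat \<Rightarrow> 'a::complex_inner" and \<mu> :: "nat \<Rightarrow> nat \<Rightarrow> complex"
  shows "L2_set (\<lambda>i. norm (\<Sum>j<d. \<mu> i j *\<^sub>C v j)) {..<d}
    \<le> mat_norm d (\<lambda>i j. blinfun_mult_right (\<mu> i j)) * L2_set (\<lambda>j. norm (v j)) {..<d}"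
proof -
  define \<Gamma> where "\<Gamma> = mat_norm d (\<lambda>i j. blinfun_mult_right (\<mu> i j))"
  obtain e c where e: "\<forall>k<d. \<forall>l<d. k \<noteq> l \<longrightarrow> cinner (e k) (e l) = 0"
    and v: "\<And>j. j < d \<Longrightarrow> v j = (\<Sum>k<d. c j k *\<^sub>C e k)"
    using orthogonal_expansion[of d v] by blast
  have row: "(\<Sum>j<d. \<mu> i j *\<^sub>C v j) = (\<Sum>k<d. (\<Sum>j<d. \<mu> i j * c j k) *\<^sub>C e k)" for i
  proof -
    have "(\<Sum>j<d. \<mu> i j *\<^sub>C v j) = (\<Sum>j<d. \<Sum>k<d. (\<mu> i j * c j k) *\<^sub>C e k)"
      by (intro sum.cong) (simp_all add: v scaleC_sum_right scaleC_scaleC)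
    also have "\<dots> = (\<Sum>k<d. \<Sum>j<d. (\<mu> i j * c j k) *\<^sub>C e k)" by (rule sum.swap)
    finally show ?thesis by (simp add: scaleC_sum_left)
  qed
  have col: "(\<Sum>i<d. (cmod (\<Sum>j<d. \<mu> i j * c j k))\<^sup>2) \<le> \<Gamma>\<^sup>2 * (\<Sum>j<d. (cmod (c j k))\<^sup>2)" for k
    using mat_norm_apply_sum[where d = d and T = "\<lambda>i j. blinfun_mult_right (\<mu> i j)" and x = "\<lambda>j. c j k"]
    by (simp add: \<Gamma>_def blinfun_mult_right.rep_eq)
  have "(\<Sum>i<d. (norm (\<Sum>j<d. \<mu> i j *\<^sub>C v j))\<^sup>2)
      = (\<Sum>i<d. \<Sum>k<d. (cmod (\<Sum>j<d. \<mu> i j * c j k))\<^sup>2 * (norm (e k))\<^sup>2)"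
    by (simp add: row norm_orthogonal_combination[OF e])
  also have "\<dots> = (\<Sum>k<d. (\<Sum>i<d. (cmod (\<Sum>j<d. \<mu> i j * c j k))\<^sup>2) * (norm (e k))\<^sup>2)"
    by (subst sum.swap) (simp add: sum_distrib_right)
  also have "\<dots> \<le> (\<Sum>k<d. (\<Gamma>\<^sup>2 * (\<Sum>j<d. (cmod (c j k))\<^sup>2)) * (norm (e k))\<^sup>2)"
    by (intro sum_mono mult_right_mono col) simp
  also have "\<dots> = \<Gamma>\<^sup>2 * (\<Sum>k<d. \<Sum>j<d. (cmod (c j k))\<^sup>2 * (norm (e k))\<^sup>2)"
    by (simp add: sum_distrib_left sum_distrib_right mult.assoc)
  also have "\<dots> = \<Gamma>\<^sup>2 * (\<Sum>j<d. (norm (v j))\<^sup>2)"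
    by (subst sum.swap) (simp add: v norm_orthogonal_combination[OF e])
  finally have le: "(\<Sum>i<d. (norm (\<Sum>j<d. \<mu> i j *\<^sub>C v j))\<^sup>2) \<le> \<Gamma>\<^sup>2 * (\<Sum>j<d. (norm (v j))\<^sup>2)" .
  have "0 \<le> \<Gamma>" unfolding \<Gamma>_def by (rule mat_norm_nonneg)
  then have "0 \<le> \<Gamma> * L2_set (\<lambda>j. norm (v j)) {..<d}" by simp
  moreover have "(L2_set (\<lambda>i. norm (\<Sum>j<d. \<mu> i j *\<^sub>C v j)) {..<d})\<^sup>2 \<le> (\<Gamma> * L2_set (\<lambda>j. norm (v j)) {..<d})\<^sup>2"
    unfolding power_mult_distrib L2_set_power2 by (rule le)
  ultimately show ?thesis unfolding \<Gamma>_def[symmetric] by (metis power2_le_imp_le)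
qed

text \<open>
  The supremum over \<open>a\<close> is attained at the conjugate of the image of \<open>b\<close>. The factor \<open>u\<close>
will be the norm of an approximate joint eigenvector, which may be zero.
\<close>
lemma scalar_matrix_norm_leI:
  fixes \<mu> :: "nat \<Rightarrow> nat \<Rightarrow> complex"
  assumes u: "0 \<le> u" and V: "0 \<le> V"
    and le: "\<And>a b. cmod (\<Sum>i<d. \<Sum>j<d. a i * b j * \<mu> i j) * u
      \<le> V * (L2_set (\<lambda>i. cmod (a i)) {..<d} * L2_set (\<lambda>j. cmod (b j)) {..<d})"
  shows "mat_norm d (\<lambda>i j. blinfun_mult_right (\<mu> i j)) * u \<le> V"
proof (cases "u = 0")
  case True
  then show ?thesis using V by simp
next
  case False
  then have u0: "0 < u" using u by simp
  have "mat_norm d (\<lambda>i j. blinfun_mult_right (\<mu> i j)) \<le> V / u"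
  proof (rule mat_norm_leI)
    fix x :: "nat \<Rightarrow> complex"
    \<comment> \<open>Testing with \<open>a = cnj y\<close> turns the double sum into \<open>\<parallel>y\<parallel>\<^sup>2\<close>.\<close>
    define y where "y i = (\<Sum>j<d. \<mu> i j * x j)" for i
    define t where "t = L2_set (\<lambda>i. cmod (y i)) {..<d}"
    have t0: "0 \<le> t" by (simp add: t_def)
    have "(\<Sum>i<d. \<Sum>j<d. cnj (y i) * x j * \<mu> i j) = (\<Sum>i<d. cnj (y i) * y i)"
    proof (rule sum.cong)
      fix i
      show "(\<Sum>j<d. cnj (y i) * x j * \<mu> i j) = cnj (y i) * y i"
        unfolding y_def[of i] sum_distrib_left by (simp add: ac_simps)
    qed simp
    also have "\<dots> = (\<Sum>i<d. complex_of_real ((cmod (y i))\<^sup>2))"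
      by (intro sum.cong) (simp_all add: complex_norm_square mult.commute del: of_real_power)
    also have "\<dots> = complex_of_real (t\<^sup>2)" by (simp add: t_def L2_set_power2)
    finally have "t\<^sup>2 * u \<le> V * (t * L2_set (\<lambda>j. cmod (x j)) {..<d})"
      using le[of "\<lambda>i. cnj (y i)" x] by (simp add: t_def norm_power)
    then have "t * u \<le> V * L2_set (\<lambda>j. cmod (x j)) {..<d}"
      using t0 V by (cases "t = 0") (simp_all add: power2_eq_square ac_simps)
    moreover have "L2_set (\<lambda>i. norm (\<Sum>j<d. blinfun_mult_right (\<mu> i j) (x j))) {..<d} = t"
      by (simp add: t_def y_def blinfun_mult_right.rep_eq)
    ultimately show "L2_set (\<lambda>i. norm (\<Sum>j<d. blinfun_mult_right (\<mu> i j) (x j))) {..<d}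
        \<le> V / u * L2_set (\<lambda>j. norm (x j)) {..<d}"
      using u0 by (simp add: field_simps)
  qed (use V u in simp)
  then show ?thesis using u0 by (simp add: field_simps)
qed

lemma inner_scaleC_ii_left: "inner (\<i> *\<^sub>C x) y = - inner x (\<i> *\<^sub>C (y::'a::complex_inner))"
  by (simp add: inner_eq_Re_cinner cinner_scaleC_left cinner_scaleC_right)

section \<open>Approximate joint diagonalization in a commutative \<open>C\<^sup>*\<close>-algebra\<close>
lemma sum_list_swap:
  fixes f :: "'x \<Rightarrow> 'y \<Rightarrow> real"
  shows "(\<Sum>x\<leftarrow>xs. \<Sum>y\<leftarrow>ys. f x y) = (\<Sum>y\<leftarrow>ys. \<Sum>x\<leftarrow>xs. f x y)"
  by (induction xs) (simp_all add: sum_list_addf)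

lemma sum_list_concat_map:
  fixes f :: "'y \<Rightarrow> real"
  shows "(\<Sum>y\<leftarrow>concat (map g xs). f y) = (\<Sum>x\<leftarrow>xs. \<Sum>y\<leftarrow>g x. f y)"
  by (induction xs) simp_all

locale comm_cstar =
  fixes C :: "('c::chilbert_space \<Rightarrow>\<^sub>L 'c) set"
  assumes cstar: "commutative_unital_cstar_algebra C"
begin

lemma alg: "unital_operator_algebra C" and closed_C: "closed C"
  using cstar by (simp_all add: commutative_unital_cstar_algebra_def)

lemma in_C: "S \<in> C \<Longrightarrow> T \<in> C \<Longrightarrow> S + T \<in> C" "T \<in> C \<Longrightarrow> r *\<^sub>R T \<in> C"
  "S \<in> C \<Longrightarrow> T \<in> C \<Longrightarrow> S o\<^sub>L T \<in> C" "id_blinfun \<in> C"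
  using alg unital_operator_algebra_scaleR[OF alg] by (simp_all add: unital_operator_algebra_def)

lemma diff_in_C: "S \<in> C \<Longrightarrow> T \<in> C \<Longrightarrow> S - T \<in> C"
  using in_C(1)[of S "(-1) *\<^sub>R T"] in_C(2)[of T "-1"] by simp

lemma commute: "S \<in> C \<Longrightarrow> T \<in> C \<Longrightarrow> blinfun_apply S (blinfun_apply T x) = T (S x)"
  using cstar unfolding commutative_unital_cstar_algebra_def by (metis blinfun_apply_blinfun_compose)

lemma C_scaleC: "T \<in> C \<Longrightarrow> blinfun_apply T (c *\<^sub>C x) = c *\<^sub>C T x"
  using alg bounded_opsD by (auto simp: unital_operator_algebra_def)

lemma adjoint_exists:
  assumes "T \<in> C"
  shows "\<exists>S\<in>C. \<forall>x y. inner (blinfun_apply T x) y = inner x (blinfun_apply S y)"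
proof -
  obtain S where S: "S \<in> C" "is_adjoint T S"
    using assms cstar unfolding commutative_unital_cstar_algebra_def by blast
  then have "inner (blinfun_apply T x) y = inner x (blinfun_apply S y)" for x y
    by (simp add: inner_eq_Re_cinner is_adjoint_def)
  with S(1) show ?thesis by blast
qed

lemma real_imaginary_parts:
  assumes T: "T \<in> C"
  shows "\<exists>A\<in>C. \<exists>B\<in>C. selfadj A \<and> selfadj B \<and> (\<forall>x. T x = A x + \<i> *\<^sub>C B x)"
proof -
  obtain S where S: "S \<in> C" and TS: "\<And>x y. inner (T x) y = inner x (S y)"
    using adjoint_exists[OF T] by blast
  have ST: "inner (S x) y = inner x (T y)" for x y by (metis TS inner_commute)
  define A where "A = (1/2) *\<^sub>R (T + S)"
  define B where "B = (- 1/2) *\<^sub>R scaleC_op \<i> (T - S)"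
  have Ax: "blinfun_apply A x = (1/2) *\<^sub>R (T x + S x)" for x
    by (simp add: A_def blinfun.add_left blinfun.scaleR_left)
  have Bx: "blinfun_apply B x = (- 1/2) *\<^sub>R \<i> *\<^sub>C (T x - S x)" for x
    by (simp add: B_def blinfun.diff_left blinfun.minus_left blinfun.scaleR_left scaleC_op.rep_eq)
  have "A \<in> C" using T S by (simp add: A_def in_C)
  moreover have "B \<in> C" using T S alg diff_in_C[OF T S] unfolding B_def
    by (intro in_C(2)) (simp add: unital_operator_algebra_def)
  moreover have "selfadj A" by (simp add: selfadj_def Ax inner_simps TS ST)
  moreover have "selfadj B" unfolding selfadj_def
  proof (intro allI)
    fix x y
    have "inner (T x - S x) (\<i> *\<^sub>C y) = inner x (\<i> *\<^sub>C (S y - T y))"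
    proof -
      have "inner (T x - S x) (\<i> *\<^sub>C y) = inner x (S (\<i> *\<^sub>C y) - T (\<i> *\<^sub>C y))"
        by (simp add: inner_simps TS ST)
      also have "S (\<i> *\<^sub>C y) - T (\<i> *\<^sub>C y) = (S - T) (\<i> *\<^sub>C y)" by (simp add: blinfun.diff_left)
      also have "\<dots> = \<i> *\<^sub>C (S y - T y)"
        by (subst C_scaleC[OF diff_in_C[OF S T]]) (simp add: blinfun.diff_left)
      finally show ?thesis .
    qed
    moreover have "\<i> *\<^sub>C (S y - T y) = - (\<i> *\<^sub>C (T y - S y))"
      using scaleC_add_right[of \<i> "S y - T y" "T y - S y"] by (simp add: scaleC_zero_right eq_neg_iff_add_eq_0)
    ultimately show "inner (B x) y = inner x (B y)"
      by (simp add: Bx inner_scaleC_ii_left)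
  qed
  moreover have "T x = A x + \<i> *\<^sub>C B x" for x
  proof -
    have "\<i> *\<^sub>C B x = (1/2) *\<^sub>R (T x - S x)"
      by (simp only: Bx scaleC_scaleR scaleC_scaleC) (simp add: ac_simps flip: scaleC_of_real)
    then have "A x + \<i> *\<^sub>C B x = (1/2) *\<^sub>R ((T x + S x) + (T x - S x))"
      by (simp only: Ax scaleR_add_right)
    then show ?thesis by (simp flip: scaleR_2)
  qed
  ultimately show ?thesis by blast
qed

text \<open>
  A quadratic partition of unity \<open>\<Sum> E\<^sup>* E = 1\<close> with labelled members. A label records the scalars
that approximate the given operators on the range of \<open>E\<close>.
\<close>
definition resolution :: "(('c \<Rightarrow>\<^sub>L 'c) \<times> 'k) list \<Rightarrow> bool"
  where "resolution L \<longleftrightarrow> (\<forall>p\<in>set L. fst p \<in> C) \<and>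
    (\<forall>z. (\<Sum>p\<leftarrow>L. (norm (blinfun_apply (fst p) z))\<^sup>2) = (norm z)\<^sup>2)"

text \<open>
  The expansion of \<open>(c\<^sup>2 + s\<^sup>2) ^ n = 1\<close> into words in \<open>c\<close> and \<open>s\<close>, labelled by the number of
letters \<open>c\<close>. This is a random walk with success probability \<open>c\<^sup>2\<close>: the estimate is the statement that
the variance of the number of successes grows at most linearly in \<open>n\<close>, because the mixed terms of each
step cancel.
\<close>
lemma random_walk_resolution:
  assumes c: "c \<in> C" "selfadj c" and s: "s \<in> C" "selfadj s"
    and cs: "\<And>x. c (c x) + s (s x) = x"
  shows "\<exists>L. resolution L \<and>
    (\<forall>z. (\<Sum>p\<leftarrow>L. (norm (real n *\<^sub>R c (c (blinfun_apply (fst p) z)) - snd p *\<^sub>R blinfun_apply (fst p) z))\<^sup>2) \<le> real n * (norm z)\<^sup>2)"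
proof (induction n)
  case 0
  show ?case
    by (rule exI[of _ "[(id_blinfun, 0)]"]) (simp add: resolution_def in_C)
next
  case (Suc n)
  then obtain L where L: "\<And>p. p \<in> set L \<Longrightarrow> fst p \<in> C"
    "\<And>z. (\<Sum>p\<leftarrow>L. (norm (blinfun_apply (fst p) z))\<^sup>2) = (norm z)\<^sup>2"
    and V: "\<And>z. (\<Sum>p\<leftarrow>L. (norm (real n *\<^sub>R c (c (blinfun_apply (fst p) z)) - snd p *\<^sub>R blinfun_apply (fst p) z))\<^sup>2) \<le> real n * (norm z)\<^sup>2"
    unfolding resolution_def by blast
  have split: "(norm (c x))\<^sup>2 + (norm (s x))\<^sup>2 = (norm x)\<^sup>2" for x
  proof -
    have "inner (c x) (c x) + inner (s x) (s x) = inner x (c (c x) + s (s x))"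
      using c(2) s(2) by (simp add: selfadj_def inner_simps)
    then show ?thesis by (simp add: power2_norm_eq_inner cs)
  qed
  have le: "(norm (c x))\<^sup>2 \<le> (norm x)\<^sup>2" "(norm (s x))\<^sup>2 \<le> (norm x)\<^sup>2" for x
    using split[of x] zero_le_power2[of "norm (c x)"] zero_le_power2[of "norm (s x)"] by linarith+
  have sc: "s (c x) = c (s x)" for x by (rule commute[OF s(1) c(1)])
  define L' where "L' = map (\<lambda>p. (c o\<^sub>L fst p, snd p + 1)) L @ map (\<lambda>p. (s o\<^sub>L fst p, snd p)) L"
  have "resolution L'"
    unfolding resolution_def
  proof (intro conjI ballI allI)
    show "fst p \<in> C" if "p \<in> set L'" for p
      using that L(1) c(1) s(1) by (auto simp: L'_def in_C)
    show "(\<Sum>p\<leftarrow>L'. (norm (blinfun_apply (fst p) z))\<^sup>2) = (norm z)\<^sup>2" for z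
      by (simp add: L'_def comp_def split L(2) flip: sum_list_addf)
  qed
  moreover have "(\<Sum>p\<leftarrow>L'. (norm (real (Suc n) *\<^sub>R c (c (blinfun_apply (fst p) z)) - snd p *\<^sub>R blinfun_apply (fst p) z))\<^sup>2)
      \<le> real (Suc n) * (norm z)\<^sup>2" for z
  proof -
    \<comment> \<open>One step from a single vertex of the walk: the second moment increases by at most the weight \<open>\<parallel>u\<parallel>\<^sup>2\<close>.\<close>
    have step: "(norm (real (Suc n) *\<^sub>R c (c (c u)) - (k + 1) *\<^sub>R c u))\<^sup>2
        + (norm (real (Suc n) *\<^sub>R c (c (s u)) - k *\<^sub>R s u))\<^sup>2
      \<le> (norm (real n *\<^sub>R c (c u) - k *\<^sub>R u))\<^sup>2 + (norm u)\<^sup>2" for u :: 'c and k :: real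
    proof -
      define w where "w = real n *\<^sub>R c (c u) - k *\<^sub>R u"
      \<comment> \<open>With \<open>c\<^sup>2 - 1 = - s\<^sup>2\<close>, a step adds \<open>- s\<^sup>2\<close> to the deviation after a success and \<open>c\<^sup>2\<close> after a failure.\<close>
      have csu: "c (c (s u)) = s (c (c u))" by (simp add: sc)
      have ccu: "c (c (c u)) = c u - c (s (s u))"
        using arg_cong[OF cs[of u], of c] by (simp add: blinfun.add_right algebra_simps)
      have 1: "real (Suc n) *\<^sub>R c (c (c u)) - (k + 1) *\<^sub>R c u = c w - c (s (s u))"
      proof -
        have "c w = real n *\<^sub>R c (c (c u)) - k *\<^sub>R c u"
          by (simp add: w_def blinfun.diff_right blinfun.scaleR_right)
        moreover have "c (c (c u)) - c u = - c (s (s u))" using ccu by simp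
        moreover have "real (Suc n) *\<^sub>R c (c (c u)) - (k + 1) *\<^sub>R c u
            = (real n *\<^sub>R c (c (c u)) - k *\<^sub>R c u) + (c (c (c u)) - c u)"
          by (simp add: algebra_simps)
        ultimately show ?thesis by simp
      qed
      have 2: "real (Suc n) *\<^sub>R c (c (s u)) - k *\<^sub>R s u = s w + s (c (c u))"
        by (simp add: w_def blinfun.diff_right blinfun.scaleR_right csu algebra_simps)
      have "inner (c w) (c (s (s u))) = inner (s w) (s (c (c u)))"
      proof -
        have "c (c (s (s u))) = s (s (c (c u)))" by (simp add: sc)
        then show ?thesis using c(2) s(2) by (simp add: selfadj_def)
      qed
      then have "(norm (c w - c (s (s u))))\<^sup>2 + (norm (s w + s (c (c u))))\<^sup>2
          = ((norm (c w))\<^sup>2 + (norm (s w))\<^sup>2) + ((norm (c (s (s u))))\<^sup>2 + (norm (s (c (c u))))\<^sup>2)"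
        by (simp add: power2_norm_eq_inner inner_simps inner_commute)
      also have "(norm (c (s (s u))))\<^sup>2 + (norm (s (c (c u))))\<^sup>2 = (norm (c (s u)))\<^sup>2"
        using split[of "c (s u)"] by (simp add: sc)
      also have "\<dots> \<le> (norm u)\<^sup>2" using le order_trans by blast
      finally show ?thesis unfolding 1 2 split by (simp add: w_def)
    qed
    have "(\<Sum>p\<leftarrow>L'. (norm (real (Suc n) *\<^sub>R c (c (blinfun_apply (fst p) z)) - snd p *\<^sub>R blinfun_apply (fst p) z))\<^sup>2)
        = (\<Sum>p\<leftarrow>L. (norm (real (Suc n) *\<^sub>R c (c (c (blinfun_apply (fst p) z))) - (snd p + 1) *\<^sub>R c (blinfun_apply (fst p) z)))\<^sup>2
          + (norm (real (Suc n) *\<^sub>R c (c (s (blinfun_apply (fst p) z))) - snd p *\<^sub>R s (blinfun_apply (fst p) z)))\<^sup>2)"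
      by (simp add: L'_def comp_def sum_list_addf)
    also have "\<dots> \<le> (\<Sum>p\<leftarrow>L. (norm (real n *\<^sub>R c (c (blinfun_apply (fst p) z)) - snd p *\<^sub>R blinfun_apply (fst p) z))\<^sup>2 + (norm (blinfun_apply (fst p) z))\<^sup>2)"
      by (intro sum_list_mono step)
    also have "\<dots> \<le> real n * (norm z)\<^sup>2 + (norm z)\<^sup>2"
      using V[of z] by (simp add: sum_list_addf L(2))
    finally show ?thesis by (simp add: algebra_simps)
  qed
  ultimately show ?case by blast
qed

text \<open>
  Rescale \<open>A\<close> affinely to \<open>c\<^sup>2 = 1/2 + A / (4 M)\<close>, so that both \<open>c\<^sup>2\<close> and \<open>s\<^sup>2 = 1 - c\<^sup>2\<close> are at
distance at most \<open>3/4\<close> from the identity and have square roots. After \<open>n\<close> steps the relative frequency of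
\<open>c\<close> deviates from \<open>c\<^sup>2\<close> by the order of \<open>1 / sqrt n\<close> in root mean square (the weak law of large numbers).
\<close>
lemma selfadj_resolution:
  assumes A: "A \<in> C" "selfadj A" and \<epsilon>: "0 < \<epsilon>"
  shows "\<exists>L. resolution L \<and>
    (\<forall>z. (\<Sum>p\<leftarrow>L. (norm (A (blinfun_apply (fst p) z) - snd p *\<^sub>R blinfun_apply (fst p) z))\<^sup>2) \<le> \<epsilon> * (norm z)\<^sup>2)"
proof -
  define M where "M = norm A + 1"
  have M: "0 < M" "norm A \<le> M" by (simp_all add: M_def add_nonneg_pos)
  have root: "\<exists>c\<in>C. selfadj c \<and> (\<forall>x. c (c x) = (1/2) *\<^sub>R x + (t / (4 * M)) *\<^sub>R A x)" if t: "\<bar>t\<bar> = 1" for t :: real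
  proof -
    define R where "R = (1/2) *\<^sub>R id_blinfun - (t / (4 * M)) *\<^sub>R A"
    have Rx: "blinfun_apply R x = (1/2) *\<^sub>R x - (t / (4 * M)) *\<^sub>R A x" for x
      by (simp add: R_def blinfun.diff_left blinfun.scaleR_left)
    have 1: "R \<in> C" unfolding R_def using A by (intro diff_in_C in_C)
    have 2: "selfadj R" using A(2) by (simp add: selfadj_def Rx inner_simps)
    have "norm R \<le> norm ((1/2) *\<^sub>R (id_blinfun :: 'c \<Rightarrow>\<^sub>L 'c)) + norm ((t / (4 * M)) *\<^sub>R A)"
      unfolding R_def by (rule norm_triangle_ineq4)
    also have "\<dots> \<le> 1/2 + 1/4"
    proof (rule add_mono)
      show "norm ((1/2) *\<^sub>R (id_blinfun :: 'c \<Rightarrow>\<^sub>L 'c)) \<le> 1/2"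
        using norm_blinfun_id_le[where 'a = 'c] by simp
      show "norm ((t / (4 * M)) *\<^sub>R A) \<le> 1/4"
        using M t by (simp add: abs_mult field_simps)
    qed
    finally have 3: "norm R \<le> 3/4" by simp
    obtain S where S: "S \<in> C" "selfadj S" "(id_blinfun - S) o\<^sub>L (id_blinfun - S) = id_blinfun - R"
      using selfadj_sqrt[OF closed_C in_C(1-3) 1 2 3] by auto
    have "id_blinfun - S \<in> C" by (intro diff_in_C in_C S)
    moreover have "selfadj (id_blinfun - S)"
      using S(2) by (simp add: selfadj_def blinfun.diff_left inner_simps)
    moreover have "(id_blinfun - S) ((id_blinfun - S) x) = (1/2) *\<^sub>R x + (t / (4 * M)) *\<^sub>R A x" for x
    proof -
      have "(id_blinfun - S) ((id_blinfun - S) x) = x - R x"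
        using arg_cong[OF S(3), of "\<lambda>T. blinfun_apply T x"] by (simp add: blinfun.diff_left)
      also have "\<dots> = (1 - 1/2) *\<^sub>R x + (t / (4 * M)) *\<^sub>R A x"
        unfolding Rx scaleR_diff_left by simp
      finally show ?thesis by simp
    qed
    ultimately show ?thesis by blast
  qed
  obtain c where c: "c \<in> C" "selfadj c" "\<And>x. c (c x) = (1/2) *\<^sub>R x + (1 / (4 * M)) *\<^sub>R A x"
    using root[of 1] by auto
  obtain s where s: "s \<in> C" "selfadj s" "\<And>x. s (s x) = (1/2) *\<^sub>R x + (- 1 / (4 * M)) *\<^sub>R A x"
    using root[of "- 1"] by auto
  have cs: "c (c x) + s (s x) = x" for x
  proof -
    have "c (c x) + s (s x) = ((1/2) *\<^sub>R x + (1/2) *\<^sub>R x) + ((1 / (4 * M)) *\<^sub>R A x + (- 1 / (4 * M)) *\<^sub>R A x)"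
      unfolding c(3) s(3) by (simp only: ac_simps)
    also have "\<dots> = (1/2 + 1/2) *\<^sub>R x + (1 / (4 * M) + - 1 / (4 * M)) *\<^sub>R A x"
      by (simp only: scaleR_add_left)
    finally show ?thesis by simp
  qed
  obtain n where n: "16 * M\<^sup>2 / \<epsilon> < real n" using reals_Archimedean2 by blast
  have n0: "0 < real n" using n \<epsilon> by (meson divide_nonneg_pos le_less_trans mult_nonneg_nonneg zero_le_numeral zero_le_power2)
  obtain L where L: "resolution L"
    "\<And>z. (\<Sum>p\<leftarrow>L. (norm (real n *\<^sub>R c (c (blinfun_apply (fst p) z)) - snd p *\<^sub>R blinfun_apply (fst p) z))\<^sup>2) \<le> real n * (norm z)\<^sup>2"
    using random_walk_resolution[OF c(1,2) s(1,2) cs] by blast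
  define L' where "L' = map (\<lambda>p. (fst p, 4 * M * (snd p / real n - 1/2))) L"
  have "resolution L'" using L(1) by (auto simp: resolution_def L'_def comp_def)
  moreover have "(\<Sum>p\<leftarrow>L'. (norm (A (blinfun_apply (fst p) z) - snd p *\<^sub>R blinfun_apply (fst p) z))\<^sup>2) \<le> \<epsilon> * (norm z)\<^sup>2" for z
  proof -
    have *: "(norm (A u - (4 * M * (k / real n - 1/2)) *\<^sub>R u))\<^sup>2
        = (4 * M / real n)\<^sup>2 * (norm (real n *\<^sub>R c (c u) - k *\<^sub>R u))\<^sup>2" for u k
    proof -
      have "(4 * M / real n) *\<^sub>R (real n *\<^sub>R c (c u) - k *\<^sub>R u)
          = (4 * M / real n * real n * (1/2)) *\<^sub>R u + (4 * M / real n * real n * (1 / (4 * M))) *\<^sub>R A u - (4 * M / real n * k) *\<^sub>R u"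
        unfolding c(3) by (simp only: scaleR_diff_right scaleR_add_right scaleR_scaleR mult.assoc)
      also have "\<dots> = A u + (4 * M / real n * real n * (1/2) - 4 * M / real n * k) *\<^sub>R u"
        using M n0 by (simp only: scaleR_diff_left) simp
      also have "4 * M / real n * real n * (1/2) - 4 * M / real n * k = - (4 * M * (k / real n - 1/2))"
        using n0 by (simp add: field_simps)
      finally have "A u - (4 * M * (k / real n - 1/2)) *\<^sub>R u = (4 * M / real n) *\<^sub>R (real n *\<^sub>R c (c u) - k *\<^sub>R u)"
        by simp
      then show ?thesis by (simp only: norm_scaleR power_mult_distrib power2_abs)
    qed
    have "(\<Sum>p\<leftarrow>L'. (norm (A (blinfun_apply (fst p) z) - snd p *\<^sub>R blinfun_apply (fst p) z))\<^sup>2)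
        = (4 * M / real n)\<^sup>2 * (\<Sum>p\<leftarrow>L. (norm (real n *\<^sub>R c (c (blinfun_apply (fst p) z)) - snd p *\<^sub>R blinfun_apply (fst p) z))\<^sup>2)"
      by (simp only: L'_def map_map comp_def fst_conv snd_conv * sum_list_const_mult)
    also have "\<dots> \<le> (4 * M / real n)\<^sup>2 * (real n * (norm z)\<^sup>2)"
      by (intro mult_left_mono L(2)) simp
    also have "\<dots> = (16 * M\<^sup>2 / real n) * (norm z)\<^sup>2"
      using n0 by (simp add: field_simps power2_eq_square)
    also have "\<dots> \<le> \<epsilon> * (norm z)\<^sup>2"
      using n n0 \<epsilon> by (intro mult_right_mono) (simp_all add: field_simps)
    finally show ?thesis .
  qed
  ultimately show ?thesis by blast
qed

text \<open>
  Resolutions for several commuting operators are multiplied. The error for one operator is not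
affected by the other factor, whose squares sum to the identity. Labels are functions on
operators, so that they can be extended one operator at a time.
\<close>
lemma joint_resolution:
  fixes \<S> :: "('c \<Rightarrow>\<^sub>L 'c) set"
  assumes "finite \<S>" "\<And>A. A \<in> \<S> \<Longrightarrow> A \<in> C \<and> selfadj A" and \<epsilon>: "0 < \<epsilon>"
  shows "\<exists>L :: (('c \<Rightarrow>\<^sub>L 'c) \<times> (('c \<Rightarrow>\<^sub>L 'c) \<Rightarrow> real)) list. resolution L \<and>
    (\<forall>A\<in>\<S>. \<forall>z. (\<Sum>p\<leftarrow>L. (norm (blinfun_apply A (blinfun_apply (fst p) z) - snd p A *\<^sub>R blinfun_apply (fst p) z))\<^sup>2) \<le> \<epsilon> * (norm z)\<^sup>2)"
  using assms(1,2)
proof (induction \<S>)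
  case empty
  show ?case by (rule exI[of _ "[(id_blinfun, \<lambda>_. 0)]"]) (simp add: resolution_def in_C)
next
  case (insert A \<S>)
  then obtain L :: "(('c \<Rightarrow>\<^sub>L 'c) \<times> (('c \<Rightarrow>\<^sub>L 'c) \<Rightarrow> real)) list"
    where L: "\<And>p. p \<in> set L \<Longrightarrow> fst p \<in> C" "\<And>z. (\<Sum>p\<leftarrow>L. (norm (blinfun_apply (fst p) z))\<^sup>2) = (norm z)\<^sup>2"
    "\<And>B z. B \<in> \<S> \<Longrightarrow> (\<Sum>p\<leftarrow>L. (norm (blinfun_apply B (blinfun_apply (fst p) z) - snd p B *\<^sub>R blinfun_apply (fst p) z))\<^sup>2) \<le> \<epsilon> * (norm z)\<^sup>2"
    unfolding resolution_def by blast
  have A: "A \<in> C" "selfadj A" using insert.prems by auto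
  obtain M where M: "\<And>p. p \<in> set M \<Longrightarrow> fst p \<in> C" "\<And>z. (\<Sum>p\<leftarrow>M. (norm (blinfun_apply (fst p) z))\<^sup>2) = (norm z)\<^sup>2"
    "\<And>z. (\<Sum>p\<leftarrow>M. (norm (A (blinfun_apply (fst p) z) - snd p *\<^sub>R blinfun_apply (fst p) z))\<^sup>2) \<le> \<epsilon> * (norm z)\<^sup>2"
    using selfadj_resolution[OF A \<epsilon>] unfolding resolution_def by blast
  define N where "N = concat (map (\<lambda>p. map (\<lambda>r. (fst p o\<^sub>L fst r, (snd p)(A := snd r))) M) L)"
  have N: "(\<Sum>p\<leftarrow>N. f p) = (\<Sum>p\<leftarrow>L. \<Sum>r\<leftarrow>M. f (fst p o\<^sub>L fst r, (snd p)(A := snd r)))"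
    for f :: "('c \<Rightarrow>\<^sub>L 'c) \<times> (('c \<Rightarrow>\<^sub>L 'c) \<Rightarrow> real) \<Rightarrow> real"
    by (simp add: N_def sum_list_concat_map comp_def)
  have "resolution N"
    unfolding resolution_def
  proof (intro conjI ballI allI)
    show "fst p \<in> C" if "p \<in> set N" for p
      using that L(1) M(1) by (auto simp: N_def in_C)
    show "(\<Sum>p\<leftarrow>N. (norm (blinfun_apply (fst p) z))\<^sup>2) = (norm z)\<^sup>2" for z
      unfolding N by (subst sum_list_swap) (simp add: L(2) M(2))
  qed
  moreover have "(\<Sum>p\<leftarrow>N. (norm (blinfun_apply B (blinfun_apply (fst p) z) - snd p B *\<^sub>R blinfun_apply (fst p) z))\<^sup>2) \<le> \<epsilon> * (norm z)\<^sup>2"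
    if B: "B \<in> insert A \<S>" for B z
  proof (cases "B = A")
    case True
    have "(\<Sum>p\<leftarrow>N. (norm (blinfun_apply B (blinfun_apply (fst p) z) - snd p B *\<^sub>R blinfun_apply (fst p) z))\<^sup>2)
        = (\<Sum>p\<leftarrow>L. \<Sum>r\<leftarrow>M. (norm (A (blinfun_apply (fst r) (blinfun_apply (fst p) z)) - snd r *\<^sub>R blinfun_apply (fst r) (blinfun_apply (fst p) z)))\<^sup>2)"
      unfolding N True using L(1) M(1)
      by (intro arg_cong[of _ _ sum_list] map_cong refl) (simp add: commute)
    also have "\<dots> \<le> (\<Sum>p\<leftarrow>L. \<epsilon> * (norm (blinfun_apply (fst p) z))\<^sup>2)" by (intro sum_list_mono M(3))
    finally show ?thesis by (simp add: sum_list_const_mult L(2))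
  next
    case False
    have "(\<Sum>p\<leftarrow>N. (norm (blinfun_apply B (blinfun_apply (fst p) z) - snd p B *\<^sub>R blinfun_apply (fst p) z))\<^sup>2)
        = (\<Sum>r\<leftarrow>M. \<Sum>p\<leftarrow>L. (norm (B (blinfun_apply (fst p) (blinfun_apply (fst r) z)) - snd p B *\<^sub>R blinfun_apply (fst p) (blinfun_apply (fst r) z)))\<^sup>2)"
      unfolding N using False by (subst sum_list_swap) simp
    also have "\<dots> \<le> (\<Sum>r\<leftarrow>M. \<epsilon> * (norm (blinfun_apply (fst r) z))\<^sup>2)"
      using B False by (intro sum_list_mono L(3)) simp
    finally show ?thesis by (simp add: sum_list_const_mult M(2))
  qed
  ultimately show ?case by blast
qed

end

section \<open>Norms of matrices over a commutative \<open>C\<^sup>*\<close>-algebra\<close>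

context comm_cstar
begin

lemma approximate_joint_diagonalization:
  fixes T :: "nat \<Rightarrow> nat \<Rightarrow> ('c \<Rightarrow>\<^sub>L 'c)"
  assumes T: "\<And>i j. i < d \<Longrightarrow> j < d \<Longrightarrow> T i j \<in> C" and \<delta>: "0 < \<delta>"
  shows "\<exists>(n::nat) E \<mu>. (\<forall>p<n. E p \<in> C) \<and>
    (\<forall>z. L2_set (\<lambda>p. norm (blinfun_apply (E p) z)) {..<n} = norm z) \<and>
    (\<forall>i<d. \<forall>j<d. \<forall>z. L2_set (\<lambda>p. norm (T i j (blinfun_apply (E p) z) - \<mu> p i j *\<^sub>C blinfun_apply (E p) z)) {..<n}
      \<le> 2 * \<delta> * norm z)"
proof -
  have "\<forall>i j. \<exists>A B. i < d \<and> j < d \<longrightarrow> A \<in> C \<and> B \<in> C \<and> selfadj A \<and> selfadj B \<and>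
      (\<forall>x. T i j x = blinfun_apply A x + \<i> *\<^sub>C blinfun_apply B x)"
    using real_imaginary_parts[OF T] by blast
  then obtain A B where AB: "\<And>i j. i < d \<and> j < d \<longrightarrow> A i j \<in> C \<and> B i j \<in> C \<and> selfadj (A i j) \<and> selfadj (B i j) \<and>
      (\<forall>x. T i j x = blinfun_apply (A i j) x + \<i> *\<^sub>C blinfun_apply (B i j) x)"
    by metis
  define \<S> where "\<S> = (\<lambda>(i, j). A i j) ` ({..<d} \<times> {..<d}) \<union> (\<lambda>(i, j). B i j) ` ({..<d} \<times> {..<d})"
  have "finite \<S>" by (simp add: \<S>_def)
  moreover have "S \<in> C \<and> selfadj S" if "S \<in> \<S>" for S using that AB by (auto simp: \<S>_def)
  moreover have "0 < \<delta>\<^sup>2" using \<delta> by simp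
  ultimately obtain L :: "(('c \<Rightarrow>\<^sub>L 'c) \<times> (('c \<Rightarrow>\<^sub>L 'c) \<Rightarrow> real)) list" where L: "resolution L"
    "\<And>S z. S \<in> \<S> \<Longrightarrow> (\<Sum>p\<leftarrow>L. (norm (blinfun_apply S (blinfun_apply (fst p) z) - snd p S *\<^sub>R blinfun_apply (fst p) z))\<^sup>2) \<le> \<delta>\<^sup>2 * (norm z)\<^sup>2"
    using joint_resolution[of \<S> "\<delta>\<^sup>2"] by blast
  have nth: "(\<Sum>p\<leftarrow>L. f p) = (\<Sum>p<length L. f (L ! p))" for f :: "_ \<Rightarrow> real"
    by (simp add: sum_list_sum_nth atLeast0LessThan)
  define E where "E p = fst (L ! p)" for p
  define \<mu> where "\<mu> p i j = Complex (snd (L ! p) (A i j)) (snd (L ! p) (B i j))" for p i j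
  have err: "L2_set (\<lambda>p. norm (blinfun_apply S (E p z) - snd (L ! p) S *\<^sub>R E p z)) {..<length L} \<le> \<delta> * norm z"
    if "S \<in> \<S>" for S z
    by (rule power2_le_imp_le)
       (use L(2)[OF that, of z] \<delta> in \<open>simp_all add: L2_set_power2 nth E_def power_mult_distrib\<close>)
  have "E p \<in> C" if "p < length L" for p
    using L(1) that unfolding resolution_def E_def by auto
  moreover have "L2_set (\<lambda>p. norm (E p z)) {..<length L} = norm z" for z
    using L(1) by (simp add: resolution_def nth E_def L2_set_def)
  moreover have "L2_set (\<lambda>p. norm (T i j (E p z) - \<mu> p i j *\<^sub>C E p z)) {..<length L} \<le> 2 * \<delta> * norm z"
    if ij: "i < d" "j < d" for i j z
  proof -
    have "norm (T i j u - \<mu> p i j *\<^sub>C u) \<le> norm (A i j u - snd (L ! p) (A i j) *\<^sub>R u)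
        + norm (B i j u - snd (L ! p) (B i j) *\<^sub>R u)" for p u
    proof -
      let ?b = "B i j u - snd (L ! p) (B i j) *\<^sub>R u"
      have ib: "\<i> *\<^sub>C ?b + snd (L ! p) (B i j) *\<^sub>R \<i> *\<^sub>C u = \<i> *\<^sub>C B i j u"
        using scaleC_add_right[of \<i> ?b "snd (L ! p) (B i j) *\<^sub>R u"]
        by (simp add: scaleC_scaleR scaleC_scaleC mult.commute)
      have "T i j u - \<mu> p i j *\<^sub>C u = (A i j u - snd (L ! p) (A i j) *\<^sub>R u) + \<i> *\<^sub>C ?b"
        using AB[of i j] ij ib by (simp add: \<mu>_def scaleC_Complex algebra_simps)
      then show ?thesis
        using norm_triangle_ineq[of "A i j u - snd (L ! p) (A i j) *\<^sub>R u" "\<i> *\<^sub>C ?b"] by (simp add: norm_scaleC)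
    qed
    then have "L2_set (\<lambda>p. norm (T i j (E p z) - \<mu> p i j *\<^sub>C E p z)) {..<length L}
        \<le> L2_set (\<lambda>p. norm (A i j (E p z) - snd (L ! p) (A i j) *\<^sub>R E p z)
          + norm (B i j (E p z) - snd (L ! p) (B i j) *\<^sub>R E p z)) {..<length L}"
      by (intro L2_set_mono) auto
    also have "\<dots> \<le> \<delta> * norm z + \<delta> * norm z"
    proof (rule order_trans[OF L2_set_triangle_ineq add_mono])
      have "A i j \<in> \<S>" "B i j \<in> \<S>" using ij by (auto simp: \<S>_def)
      then show "L2_set (\<lambda>p. norm (A i j (E p z) - snd (L ! p) (A i j) *\<^sub>R E p z)) {..<length L} \<le> \<delta> * norm z"
        "L2_set (\<lambda>p. norm (B i j (E p z) - snd (L ! p) (B i j) *\<^sub>R E p z)) {..<length L} \<le> \<delta> * norm z"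
        by (auto intro: err)
    qed
    finally show ?thesis by simp
  qed
  ultimately show ?thesis by blast
qed

text \<open>
  On the range of \<open>E p\<close> the matrix \<open>T\<close> acts almost like the scalar matrix \<open>\<mu> p\<close>, whose
norm is \<open>\<Gamma> p\<close>. No bound on \<open>\<Gamma> p\<close> itself can be expected: \<open>\<mu> p\<close> is arbitrary if
\<open>E p\<close> is zero. What holds for all \<open>p\<close> is the weighted bound
\<open>\<Gamma> p \<parallel>E p z\<parallel> \<le> \<gamma> \<parallel>E p z\<parallel> + e p z\<close>, whose errors \<open>e p z\<close> are small in the mean square
over \<open>p\<close>. This suffices, because \<open>\<Gamma> p\<close> only ever multiplies such norms.
\<close>
theorem mat_norm_le_scalar_compressions:
  fixes T :: "nat \<Rightarrow> nat \<Rightarrow> ('c \<Rightarrow>\<^sub>L 'c)"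
  assumes T: "\<And>i j. i < d \<Longrightarrow> j < d \<Longrightarrow> T i j \<in> C" and \<gamma>: "0 \<le> \<gamma>"
    and H: "\<And>a b z. norm (\<Sum>i<d. \<Sum>j<d. (a i * b j) *\<^sub>C T i j z)
      \<le> \<gamma> * (L2_set (\<lambda>i. cmod (a i)) {..<d} * L2_set (\<lambda>j. cmod (b j)) {..<d}) * norm z"
  shows "mat_norm d T \<le> \<gamma>"
proof -
  \<comment> \<open>The error of the following estimate is \<open>\<kappa> \<delta>\<close>; the factors \<open>d\<close> come from triangle inequalities over the matrix indices.\<close>
  define \<kappa> where "\<kappa> = (real d + 1) * (real d * (real d * (real d * 2)))"
  have bound: "mat_norm d T \<le> \<gamma> + \<kappa> * \<delta>" if \<delta>: "0 < \<delta>" for \<delta>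
  proof -
    obtain n :: nat and E \<mu> where E: "\<And>p. p < n \<Longrightarrow> E p \<in> C"
      "\<And>z. L2_set (\<lambda>p. norm (blinfun_apply (E p) z)) {..<n} = norm z"
      and err: "\<And>i j z. i < d \<Longrightarrow> j < d \<Longrightarrow>
        L2_set (\<lambda>p. norm (T i j (blinfun_apply (E p) z) - \<mu> p i j *\<^sub>C blinfun_apply (E p) z)) {..<n} \<le> 2 * \<delta> * norm z"
      using approximate_joint_diagonalization[of d T \<delta>] T \<delta> by blast
    define D where "D p i j z = norm (T i j (E p z) - \<mu> p i j *\<^sub>C E p z)" for p i j z
    define e where "e p z = (\<Sum>i<d. \<Sum>j<d. D p i j z)" for p z
    have D0: "0 \<le> D p i j z" for p i j z by (simp add: D_def)
    have e0: "0 \<le> e p z" for p z by (simp add: e_def D0 sum_nonneg)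
    have D_le_row: "(\<Sum>j<d. D p i j z) \<le> e p z" if "i < d" for p i z
      unfolding e_def by (rule member_le_sum) (use that in \<open>auto simp: D0 sum_nonneg\<close>)
    have D_le: "D p i j z \<le> e p z" if "i < d" "j < d" for p i j z
    proof -
      have "D p i j z \<le> (\<Sum>j<d. D p i j z)" by (rule member_le_sum) (use that in \<open>auto simp: D0\<close>)
      then show ?thesis using D_le_row[OF that(1)] order_trans by blast
    qed
    have L2_e: "L2_set (\<lambda>p. e p z) {..<n} \<le> real d * (real d * (2 * \<delta> * norm z))" for z
    proof -
      have "L2_set (\<lambda>p. e p z) {..<n} \<le> (\<Sum>i<d. L2_set (\<lambda>p. \<Sum>j<d. D p i j z) {..<n})"
        unfolding e_def by (rule L2_set_sum_le)
      also have "\<dots> \<le> (\<Sum>i<d. \<Sum>j<d. L2_set (\<lambda>p. D p i j z) {..<n})"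
        by (intro sum_mono L2_set_sum_le)
      also have "\<dots> \<le> (\<Sum>i<d. \<Sum>j<d. 2 * \<delta> * norm z)"
        unfolding D_def by (intro sum_mono err) auto
      finally show ?thesis by simp
    qed
    define \<Gamma> where "\<Gamma> p = mat_norm d (\<lambda>i j. blinfun_mult_right (\<mu> p i j))" for p
    have \<Gamma>0: "0 \<le> \<Gamma> p" for p unfolding \<Gamma>_def by (rule mat_norm_nonneg)
    have \<Gamma>: "\<Gamma> p * norm (E p z) \<le> \<gamma> * norm (E p z) + e p z" for p z
      unfolding \<Gamma>_def
    proof (rule scalar_matrix_norm_leI)
      show "0 \<le> \<gamma> * norm (E p z) + e p z" using \<gamma> e0 by simp
      fix a b :: "nat \<Rightarrow> complex"
      let ?a = "L2_set (\<lambda>i. cmod (a i)) {..<d}" and ?b = "L2_set (\<lambda>j. cmod (b j)) {..<d}"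
      let ?u = "E p z"
      have "cmod (\<Sum>i<d. \<Sum>j<d. a i * b j * \<mu> p i j) * norm ?u
          = norm (\<Sum>i<d. \<Sum>j<d. (a i * b j) *\<^sub>C \<mu> p i j *\<^sub>C ?u)"
        by (simp add: scaleC_sum_left scaleC_scaleC flip: norm_scaleC)
      also have "(\<Sum>i<d. \<Sum>j<d. (a i * b j) *\<^sub>C \<mu> p i j *\<^sub>C ?u)
          = (\<Sum>i<d. \<Sum>j<d. (a i * b j) *\<^sub>C T i j ?u) - (\<Sum>i<d. \<Sum>j<d. (a i * b j) *\<^sub>C (T i j ?u - \<mu> p i j *\<^sub>C ?u))"
      proof -
        have "(a i * b j) *\<^sub>C \<mu> p i j *\<^sub>C ?u = (a i * b j) *\<^sub>C T i j ?u - (a i * b j) *\<^sub>C (T i j ?u - \<mu> p i j *\<^sub>C ?u)" for i j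
          using scaleC_add_right[of "a i * b j" "\<mu> p i j *\<^sub>C ?u" "T i j ?u - \<mu> p i j *\<^sub>C ?u"] by (simp add: algebra_simps)
        then show ?thesis by (simp add: sum_subtractf)
      qed
      also have "norm \<dots> \<le> \<gamma> * (?a * ?b) * norm ?u + (?a * ?b) * e p z"
      proof (rule order_trans[OF norm_triangle_ineq4 add_mono[OF H]])
        have "norm ((a i * b j) *\<^sub>C (T i j ?u - \<mu> p i j *\<^sub>C ?u)) \<le> ?a * ?b * D p i j z" if "i < d" "j < d" for i j
          unfolding norm_scaleC norm_mult D_def
          using that by (intro mult_right_mono mult_mono member_le_L2_set) auto
        then have "norm (\<Sum>i<d. \<Sum>j<d. (a i * b j) *\<^sub>C (T i j ?u - \<mu> p i j *\<^sub>C ?u))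
            \<le> (\<Sum>i<d. \<Sum>j<d. ?a * ?b * D p i j z)"
          by (intro sum_norm_le) auto
        then show "norm (\<Sum>i<d. \<Sum>j<d. (a i * b j) *\<^sub>C (T i j ?u - \<mu> p i j *\<^sub>C ?u)) \<le> ?a * ?b * e p z"
          by (simp add: e_def sum_distrib_left)
      qed
      finally show "cmod (\<Sum>i<d. \<Sum>j<d. a i * b j * \<mu> p i j) * norm ?u
          \<le> (\<gamma> * norm ?u + e p z) * (?a * ?b)"
        by (simp add: algebra_simps)
    qed simp
    show ?thesis
    proof (rule mat_norm_leI)
      have "0 \<le> \<kappa>" by (simp add: \<kappa>_def)
      then show "0 \<le> \<gamma> + \<kappa> * \<delta>" using \<gamma> \<delta> by simp
      fix x :: "nat \<Rightarrow> 'c"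
      define w where "w i = (\<Sum>j<d. T i j (x j))" for i
      define r where "r p = (\<Sum>j<d. e p (x j))" for p
      define X where "X = L2_set (\<lambda>j. norm (x j)) {..<d}"
      have swap: "L2_set (\<lambda>p. L2_set (\<lambda>i. norm (E p (y i))) {..<d}) {..<n} = L2_set (\<lambda>i. norm (y i)) {..<d}" for y
      proof -
        have sq: "(\<Sum>p<n. (norm (E p u))\<^sup>2) = (norm u)\<^sup>2" for u
          using E(2)[of u] L2_set_power2[of "\<lambda>p. norm (E p u)" "{..<n}"] by simp
        have "(\<Sum>p<n. \<Sum>i<d. (norm (E p (y i)))\<^sup>2) = (\<Sum>i<d. (norm (y i))\<^sup>2)"
          by (subst sum.swap) (simp add: sq)
        then show ?thesis by (simp add: L2_set_def sum_nonneg)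
      qed
      have "L2_set (\<lambda>i. norm (E p (w i))) {..<d}
          \<le> \<gamma> * L2_set (\<lambda>j. norm (E p (x j))) {..<d} + (real d + 1) * r p" if p: "p < n" for p
      proof -
        have "norm (E p (w i)) \<le> norm (\<Sum>j<d. \<mu> p i j *\<^sub>C E p (x j)) + r p" if i: "i < d" for i
        proof -
          have "E p (w i) = (\<Sum>j<d. T i j (E p (x j)))"
            using i p by (simp add: w_def blinfun.sum_right commute[OF E(1) T])
          also have "\<dots> = (\<Sum>j<d. \<mu> p i j *\<^sub>C E p (x j)) + (\<Sum>j<d. T i j (E p (x j)) - \<mu> p i j *\<^sub>C E p (x j))"
            by (simp flip: sum.distrib)
          also have "norm \<dots> \<le> norm (\<Sum>j<d. \<mu> p i j *\<^sub>C E p (x j)) + (\<Sum>j<d. e p (x j))"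
            by (intro order_trans[OF norm_triangle_ineq] add_left_mono sum_norm_le)
               (use D_le[OF i] in \<open>simp add: D_def\<close>)
          finally show ?thesis by (simp add: r_def)
        qed
        then have "L2_set (\<lambda>i. norm (E p (w i))) {..<d}
            \<le> L2_set (\<lambda>i. norm (\<Sum>j<d. \<mu> p i j *\<^sub>C E p (x j)) + r p) {..<d}"
          by (intro L2_set_mono) auto
        also have "\<dots> \<le> L2_set (\<lambda>i. norm (\<Sum>j<d. \<mu> p i j *\<^sub>C E p (x j))) {..<d} + L2_set (\<lambda>i. r p) {..<d}"
          by (rule L2_set_triangle_ineq)
        also have "\<dots> \<le> \<Gamma> p * L2_set (\<lambda>j. norm (E p (x j))) {..<d} + real d * r p"
        proof (rule add_mono)
          show "L2_set (\<lambda>i. norm (\<Sum>j<d. \<mu> p i j *\<^sub>C E p (x j))) {..<d} \<le> \<Gamma> p * L2_set (\<lambda>j. norm (E p (x j))) {..<d}"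
            unfolding \<Gamma>_def by (rule scalar_matrix_amplification)
          show "L2_set (\<lambda>i. r p) {..<d} \<le> real d * r p"
            using L2_set_le_sum[of "{..<d}" "\<lambda>i. r p"] by (simp add: r_def e0 sum_nonneg)
        qed
        also have "\<Gamma> p * L2_set (\<lambda>j. norm (E p (x j))) {..<d} \<le> \<gamma> * L2_set (\<lambda>j. norm (E p (x j))) {..<d} + r p"
        proof -
          have "\<Gamma> p * L2_set (\<lambda>j. norm (E p (x j))) {..<d} = L2_set (\<lambda>j. \<Gamma> p * norm (E p (x j))) {..<d}"
            by (rule L2_set_right_distrib[OF \<Gamma>0])
          also have "\<dots> \<le> L2_set (\<lambda>j. \<gamma> * norm (E p (x j)) + e p (x j)) {..<d}"
            by (intro L2_set_mono \<Gamma>) (simp add: \<Gamma>0)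
          also have "\<dots> \<le> L2_set (\<lambda>j. \<gamma> * norm (E p (x j))) {..<d} + L2_set (\<lambda>j. e p (x j)) {..<d}"
            by (rule L2_set_triangle_ineq)
          also have "L2_set (\<lambda>j. \<gamma> * norm (E p (x j))) {..<d} = \<gamma> * L2_set (\<lambda>j. norm (E p (x j))) {..<d}"
            by (rule L2_set_right_distrib[OF \<gamma>, symmetric])
          also have "L2_set (\<lambda>j. e p (x j)) {..<d} \<le> r p"
            unfolding r_def by (rule L2_set_le_sum) (simp add: e0)
          finally show ?thesis by simp
        qed
        finally show ?thesis by (simp add: algebra_simps)
      qed
      then have "L2_set (\<lambda>p. L2_set (\<lambda>i. norm (E p (w i))) {..<d}) {..<n}
          \<le> L2_set (\<lambda>p. \<gamma> * L2_set (\<lambda>j. norm (E p (x j))) {..<d} + (real d + 1) * r p) {..<n}"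
        by (intro L2_set_mono) auto
      also have "\<dots> \<le> L2_set (\<lambda>p. \<gamma> * L2_set (\<lambda>j. norm (E p (x j))) {..<d}) {..<n}
          + L2_set (\<lambda>p. (real d + 1) * r p) {..<n}"
        by (rule L2_set_triangle_ineq)
      also have "\<dots> = \<gamma> * X + (real d + 1) * L2_set r {..<n}"
        using L2_set_right_distrib[OF \<gamma>, of "\<lambda>p. L2_set (\<lambda>j. norm (E p (x j))) {..<d}" "{..<n}"]
          L2_set_right_distrib[of "real d + 1" r "{..<n}"] swap[of x]
        by (simp add: X_def)
      also have "\<dots> \<le> \<gamma> * X + (real d + 1) * (real d * (real d * (real d * 2)) * \<delta> * X)"
      proof (intro add_left_mono mult_left_mono)
        have "L2_set r {..<n} \<le> (\<Sum>j<d. L2_set (\<lambda>p. e p (x j)) {..<n})"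
          unfolding r_def by (rule L2_set_sum_le)
        also have "\<dots> \<le> (\<Sum>j<d. real d * (real d * (2 * \<delta> * X)))"
        proof (rule sum_mono)
          fix j assume "j \<in> {..<d}"
          then have "norm (x j) \<le> X" unfolding X_def by (intro member_le_L2_set) auto
          then have "real d * (real d * (2 * \<delta> * norm (x j))) \<le> real d * (real d * (2 * \<delta> * X))"
            using \<delta> by (intro mult_left_mono) auto
          with L2_e show "L2_set (\<lambda>p. e p (x j)) {..<n} \<le> real d * (real d * (2 * \<delta> * X))"
            by (rule order_trans)
        qed
        finally show "L2_set r {..<n} \<le> real d * (real d * (real d * 2)) * \<delta> * X"
          by (simp add: ac_simps)
      qed simp
      finally show "L2_set (\<lambda>i. norm (\<Sum>j<d. T i j (x j))) {..<d} \<le> (\<gamma> + \<kappa> * \<delta>) * L2_set (\<lambda>j. norm (x j)) {..<d}"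
        unfolding swap by (simp add: w_def X_def \<kappa>_def algebra_simps)
    qed
  qed
  show ?thesis
  proof (rule field_le_epsilon)
    fix \<epsilon> :: real assume \<epsilon>: "0 < \<epsilon>"
    have \<kappa>0: "0 \<le> \<kappa>" by (simp add: \<kappa>_def)
    have "\<kappa> * (\<epsilon> / (\<kappa> + 1)) \<le> \<epsilon>" using \<epsilon> \<kappa>0 by (simp add: field_simps)
    then show "mat_norm d T \<le> \<gamma> + \<epsilon>" using bound[of "\<epsilon> / (\<kappa> + 1)"] \<epsilon> \<kappa>0 by simp
  qed
qed

text \<open>
  Elements of a commutative \<open>C\<^sup>*\<close>-algebra are normal, so \<open>T\<^sup>* T x\<close> and \<open>T T x\<close> have the same norm.
\<close>
lemma norm_square:
  assumes T: "T \<in> C"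
  shows "norm (T o\<^sub>L T) = (norm T)\<^sup>2"
proof (rule antisym)
  show "norm (T o\<^sub>L T) \<le> (norm T)\<^sup>2" using norm_blinfun_compose[of T T] by (simp add: power2_eq_square)
  obtain S where S: "S \<in> C" "\<And>x y. inner (T x) y = inner x (S y)"
    using adjoint_exists[OF T] by blast
  have n: "norm (S (T x)) = norm (T (T x))" for x
  proof -
    have "inner (S (T x)) (S (T x)) = inner (T (S (T x))) (T x)" by (simp add: S(2))
    also have "\<dots> = inner (S (T (T x))) (T x)" by (simp add: commute[OF T S(1)])
    also have "\<dots> = inner (T (T x)) (T (T x))" by (metis S(2) inner_commute)
    finally show ?thesis by (simp add: norm_eq_sqrt_inner)
  qed
  have "norm T \<le> sqrt (norm (T o\<^sub>L T))"
  proof (rule norm_blinfun_bound)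
    fix x
    have "(norm (T x))\<^sup>2 = inner x (S (T x))" by (simp add: power2_norm_eq_inner S(2))
    also have "\<dots> \<le> norm x * norm (T (T x))" using norm_cauchy_schwarz[of x "S (T x)"] by (simp add: n)
    also have "\<dots> \<le> norm x * (norm (T o\<^sub>L T) * norm x)"
      using norm_blinfun[of "T o\<^sub>L T" x] by (intro mult_left_mono) auto
    also have "\<dots> = (sqrt (norm (T o\<^sub>L T)) * norm x)\<^sup>2" by (simp add: power_mult_distrib power2_eq_square)
    finally show "norm (T x) \<le> sqrt (norm (T o\<^sub>L T)) * norm x" by (rule power2_le_imp_le) simp
  qed simp
  then show "(norm T)\<^sup>2 \<le> norm (T o\<^sub>L T)" using power_mono[of "norm T" "sqrt (norm (T o\<^sub>L T))" 2] by simp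
qed

end

section \<open>Making homomorphisms of uniform algebras completely isometric\<close>
lemma le_if_power2_powers_le:
  fixes a b L :: real
  assumes a: "0 \<le> a" "0 \<le> b" and le: "\<And>k. a ^ (2 ^ k) \<le> L * b ^ (2 ^ k)"
  shows "a \<le> b"
proof (rule ccontr)
  assume "\<not> a \<le> b"
  then have ba: "b < a" by simp
  show False
  proof (cases "b = 0")
    case True
    then show False using le[of 0] ba by simp
  next
    case False
    then have b: "0 < b" using a by simp
    define r where "r = a / b"
    have r: "1 < r" using ba b by (simp add: r_def)
    obtain n where n: "L < r ^ n" using real_arch_pow[OF r] by blast
    have "r ^ n \<le> r ^ (2 ^ n)" using r by (intro power_increasing) (simp_all add: less_imp_le)
    also have "\<dots> \<le> L" using le[of n] b by (simp add: r_def power_divide field_simps)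
    finally show False using n by simp
  qed
qed

text \<open>
  A constant \<open>L\<close> in \<open>\<parallel>g\<parallel> \<le> L \<parallel>\<sigma>(g)\<parallel>\<close> can be improved to \<open>1\<close>: apply the inequality to
\<open>g = f ^ (2 ^ k)\<close>, where the left-hand side is exactly \<open>\<parallel>f\<parallel> ^ (2 ^ k)\<close>.
\<close>
lemma norm_le_if_multiplicative_bounded_below:
  fixes \<sigma> :: "('c::chilbert_space \<Rightarrow>\<^sub>L 'c) \<Rightarrow> ('a::real_normed_vector \<Rightarrow>\<^sub>L 'a)"
  assumes F: "uniform_algebra F" and f: "f \<in> F"
    and mult: "\<And>S T. S \<in> F \<Longrightarrow> T \<in> F \<Longrightarrow> \<sigma> (S o\<^sub>L T) = \<sigma> S o\<^sub>L \<sigma> T"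
    and below: "\<And>f. f \<in> F \<Longrightarrow> norm f \<le> L * norm (\<sigma> f)" and L: "0 \<le> L"
  shows "norm f \<le> norm (\<sigma> f)"
proof -
  obtain C where C: "commutative_unital_cstar_algebra C" "F \<subseteq> C" and alg: "unital_operator_algebra F"
    using F by (auto simp: uniform_algebra_def)
  interpret C: comm_cstar C by standard (rule C(1))
  have "\<exists>g\<in>F. norm g = norm f ^ (2 ^ k) \<and> norm (\<sigma> g) \<le> norm (\<sigma> f) ^ (2 ^ k)" for k
  proof (induction k)
    case 0
    show ?case using f by auto
  next
    case (Suc k)
    then obtain g where g: "g \<in> F" "norm g = norm f ^ (2 ^ k)" "norm (\<sigma> g) \<le> norm (\<sigma> f) ^ (2 ^ k)" by blast
    have p: "x ^ (2 ^ Suc k) = (x ^ (2 ^ k))\<^sup>2" for x :: real by (simp add: power_mult mult.commute flip: power_mult)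
    have "g o\<^sub>L g \<in> F" using g(1) alg by (simp add: unital_operator_algebra_def)
    moreover have "norm (g o\<^sub>L g) = norm f ^ (2 ^ Suc k)"
      unfolding p using C.norm_square[of g] g C(2) by auto
    moreover have "norm (\<sigma> (g o\<^sub>L g)) \<le> norm (\<sigma> f) ^ (2 ^ Suc k)"
    proof -
      have "norm (\<sigma> (g o\<^sub>L g)) \<le> (norm (\<sigma> g))\<^sup>2"
        using norm_blinfun_compose[of "\<sigma> g" "\<sigma> g"] by (simp add: mult[OF g(1) g(1)] power2_eq_square)
      also have "\<dots> \<le> (norm (\<sigma> f) ^ (2 ^ k))\<^sup>2" using g(3) by (intro power_mono) auto
      finally show ?thesis unfolding p .
    qed
    ultimately show ?case by blast
  qed
  then have "norm f ^ (2 ^ k) \<le> L * norm (\<sigma> f) ^ (2 ^ k)" for k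
    using below L by (metis mult_left_mono order_trans)
  then show ?thesis by (rule le_if_power2_powers_le[rotated 2]) simp_all
qed

theorem uniform_algebra_similarity:
  fixes \<rho> :: "('c::chilbert_space \<Rightarrow>\<^sub>L 'c) \<Rightarrow> ('a::chilbert_space \<Rightarrow>\<^sub>L 'a)"
  assumes F: "uniform_algebra F"
    and hom: "completely_bounded_on F \<rho>" "\<rho> id_blinfun = id_blinfun"
      "\<And>S T. S \<in> F \<Longrightarrow> T \<in> F \<Longrightarrow> \<rho> (S o\<^sub>L T) = \<rho> S o\<^sub>L \<rho> T"
    and ops: "\<And>f. f \<in> F \<Longrightarrow> \<rho> f \<in> bounded_ops"
    and below: "\<And>f. f \<in> F \<Longrightarrow> norm f \<le> L * norm (\<rho> f)"
  shows "\<exists>X X'. inverse_ops X X' \<and> (\<forall>d T. (\<forall>i<d. \<forall>j<d. T i j \<in> F) \<longrightarrow>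
      mat_norm d (\<lambda>i j. X o\<^sub>L \<rho> (T i j) o\<^sub>L X') = mat_norm d T)"
proof -
  obtain C where C: "commutative_unital_cstar_algebra C" "F \<subseteq> C" and alg: "unital_operator_algebra F"
    using F by (auto simp: uniform_algebra_def)
  interpret C: comm_cstar C by standard (rule C(1))
  interpret \<rho>: unital_cb_hom F \<rho> using alg hom by unfold_locales
  obtain X X' where inv: "inverse_ops X X'" and
    le: "\<And>d T. (\<forall>i<d. \<forall>j<d. T i j \<in> F) \<Longrightarrow> mat_norm d (\<lambda>i j. X o\<^sub>L \<rho> (T i j) o\<^sub>L X') \<le> mat_norm d T"
    using \<rho>.similar_to_completely_contractive by blast
  define \<sigma> where "\<sigma> f = X o\<^sub>L \<rho> f o\<^sub>L X'" for f
  have XX': "X' (X y) = y" for y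
    using inv unfolding inverse_ops_def by (metis blinfun_apply_blinfun_compose blinfun_apply_id_blinfun)
  have \<sigma>_mult: "\<sigma> (S o\<^sub>L T) = \<sigma> S o\<^sub>L \<sigma> T" if "S \<in> F" "T \<in> F" for S T
    by (rule blinfun_eqI) (simp add: \<sigma>_def hom(3)[OF that] XX')
  have \<sigma>_ops: "\<sigma> f \<in> bounded_ops" if "f \<in> F" for f
    using inv ops[OF that] unfolding \<sigma>_def inverse_ops_def by (intro bounded_ops_algebra) auto
  have \<sigma>_below: "norm f \<le> (\<bar>L\<bar> * (norm X' * norm X)) * norm (\<sigma> f)" if f: "f \<in> F" for f
  proof -
    have "\<rho> f = X' o\<^sub>L (\<sigma> f o\<^sub>L X)" by (rule blinfun_eqI) (simp add: \<sigma>_def XX')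
    then have "norm (\<rho> f) \<le> norm X' * (norm (\<sigma> f) * norm X)"
      using norm_blinfun_compose[of X' "\<sigma> f o\<^sub>L X"] norm_blinfun_compose[of "\<sigma> f" X]
      by (metis mult_left_mono norm_ge_zero order_trans)
    then have "\<bar>L\<bar> * norm (\<rho> f) \<le> \<bar>L\<bar> * (norm X' * (norm (\<sigma> f) * norm X))" by (intro mult_left_mono) auto
    moreover have "L * norm (\<rho> f) \<le> \<bar>L\<bar> * norm (\<rho> f)" by (intro mult_right_mono) auto
    ultimately show ?thesis using below[OF f] by (simp add: ac_simps)
  qed
  have contr: "norm f \<le> norm (\<sigma> f)" if "f \<in> F" for f
    by (rule norm_le_if_multiplicative_bounded_below[OF F that \<sigma>_mult \<sigma>_below]) auto
  have \<sigma>_linear: "op_linear_on F \<sigma>"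
    unfolding op_linear_on_def
  proof (intro conjI ballI allI)
    show "\<sigma> (S + T) = \<sigma> S + \<sigma> T" if "S \<in> F" "T \<in> F" for S T
      using \<rho>.lin that
      by (intro blinfun_eqI) (simp add: \<sigma>_def op_linear_on_def blinfun.add_left blinfun.add_right)
    show "\<sigma> (scaleC_op c T) = scaleC_op c (\<sigma> T)" if "T \<in> F" for c T
      using \<rho>.lin that inv
      by (intro blinfun_eqI) (simp add: \<sigma>_def op_linear_on_def scaleC_op.rep_eq inverse_ops_def bounded_opsD)
  qed
  have "mat_norm d T \<le> mat_norm d (\<lambda>i j. \<sigma> (T i j))" if T: "\<forall>i<d. \<forall>j<d. T i j \<in> F" for d T
  proof (rule C.mat_norm_le_scalar_compressions)
    define \<gamma> where "\<gamma> = mat_norm d (\<lambda>i j. \<sigma> (T i j))"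
    show "0 \<le> mat_norm d (\<lambda>i j. \<sigma> (T i j))" by (rule mat_norm_nonneg)
    show "T i j \<in> C" if "i < d" "j < d" for i j using T C(2) that by blast
    fix a b :: "nat \<Rightarrow> complex" and z :: 'c
    let ?a = "L2_set (\<lambda>i. cmod (a i)) {..<d}" and ?b = "L2_set (\<lambda>j. cmod (b j)) {..<d}"
    define f where "f = (\<Sum>i<d. \<Sum>j<d. scaleC_op (a i * b j) (T i j))"
    have t_in: "scaleC_op (a i * b j) (T i j) \<in> F" if "i < d" "j < d" for i j
      using T alg that by (simp add: unital_operator_algebra_def)
    have row_in: "(\<Sum>j<d. scaleC_op (a i * b j) (T i j)) \<in> F" if "i < d" for i
      by (rule unital_operator_algebra_sum[OF alg]) (use t_in that in auto)
    have f_in: "f \<in> F" unfolding f_def by (rule unital_operator_algebra_sum[OF alg]) (use row_in in auto)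
    have "\<sigma> f = (\<Sum>i<d. \<sigma> (\<Sum>j<d. scaleC_op (a i * b j) (T i j)))"
      unfolding f_def by (rule op_linear_on_sum[OF \<sigma>_linear alg]) (use row_in in auto)
    also have "\<dots> = (\<Sum>i<d. \<Sum>j<d. \<sigma> (scaleC_op (a i * b j) (T i j)))"
      by (intro sum.cong op_linear_on_sum[OF \<sigma>_linear alg]) (use t_in in auto)
    also have "\<dots> = (\<Sum>i<d. \<Sum>j<d. scaleC_op (a i * b j) (\<sigma> (T i j)))"
      using \<sigma>_linear T by (intro sum.cong) (auto simp: op_linear_on_def)
    finally have \<sigma>f: "\<sigma> f = (\<Sum>i<d. \<Sum>j<d. scaleC_op (a i * b j) (\<sigma> (T i j)))" .
    have "norm (\<sigma> f) \<le> \<gamma> * (?a * ?b)"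
    proof (rule norm_blinfun_bound)
      show "0 \<le> \<gamma> * (?a * ?b)" by (simp add: \<gamma>_def mat_norm_nonneg)
      fix w
      define y where "y i = (\<Sum>j<d. \<sigma> (T i j) (b j *\<^sub>C w))" for i
      have "\<sigma> f w = (\<Sum>i<d. a i *\<^sub>C y i)"
        using T by (simp add: \<sigma>f y_def blinfun.sum_left scaleC_op.rep_eq scaleC_sum_right
            bounded_opsD[OF \<sigma>_ops] flip: scaleC_scaleC)
      then have "norm (\<sigma> f w) \<le> (\<Sum>i<d. norm (a i *\<^sub>C y i))" by (simp add: norm_sum)
      also have "\<dots> = (\<Sum>i<d. \<bar>cmod (a i)\<bar> * \<bar>norm (y i)\<bar>)" by (simp add: norm_scaleC)
      also have "\<dots> \<le> ?a * L2_set (\<lambda>i. norm (y i)) {..<d}" by (rule L2_set_mult_ineq)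
      also have "\<dots> \<le> ?a * (\<gamma> * L2_set (\<lambda>j. norm (b j *\<^sub>C w)) {..<d})"
        unfolding y_def \<gamma>_def by (intro mult_left_mono mat_norm_apply) simp
      also have "L2_set (\<lambda>j. norm (b j *\<^sub>C w)) {..<d} = ?b * norm w"
        by (simp add: norm_scaleC L2_set_left_distrib)
      finally show "norm (\<sigma> f w) \<le> \<gamma> * (?a * ?b) * norm w"
        by (simp add: ac_simps)
    qed
    then have "norm f \<le> \<gamma> * (?a * ?b)" using contr[OF f_in] by simp
    then have "norm f * norm z \<le> \<gamma> * (?a * ?b) * norm z" by (rule mult_right_mono) simp
    then have "norm (f z) \<le> \<gamma> * (?a * ?b) * norm z" using norm_blinfun[of f z] by (rule order_trans[rotated])
    moreover have "f z = (\<Sum>i<d. \<Sum>j<d. (a i * b j) *\<^sub>C T i j z)"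
      by (simp add: f_def blinfun.sum_left scaleC_op.rep_eq)
    ultimately show "norm (\<Sum>i<d. \<Sum>j<d. (a i * b j) *\<^sub>C T i j z)
        \<le> mat_norm d (\<lambda>i j. \<sigma> (T i j)) * (?a * ?b) * norm z"
      by (simp add: \<gamma>_def)
  qed
  then have "mat_norm d (\<lambda>i j. X o\<^sub>L \<rho> (T i j) o\<^sub>L X') = mat_norm d T" if "\<forall>i<d. \<forall>j<d. T i j \<in> F" for d T
    using le[OF that] that unfolding \<sigma>_def by (simp add: antisym)
  with inv show ?thesis by blast
qed

lemma completely_bounded_imp_bounded:
  assumes "completely_bounded_on A \<psi>"
  shows "\<exists>K. \<forall>T\<in>A. norm (\<psi> T) \<le> K * norm T"
proof -
  obtain K where K: "\<And>d T. (\<forall>i<d. \<forall>j<d. T i j \<in> A) \<Longrightarrow> mat_norm d (\<lambda>i j. \<psi> (T i j)) \<le> K * mat_norm d T"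
    using assms unfolding completely_bounded_on_def by blast
  have mat_norm_1: "mat_norm 1 (\<lambda>i j. T) = norm T" for T :: "'x::real_normed_vector \<Rightarrow>\<^sub>L 'y::real_normed_vector"
  proof (rule antisym)
    show "mat_norm 1 (\<lambda>i j. T) \<le> norm T"
      by (rule mat_norm_leI) (simp_all add: L2_set_def norm_blinfun)
    show "norm T \<le> mat_norm 1 (\<lambda>i j. T)"
      using mat_norm_apply[where d = 1 and T = "\<lambda>i j. T"]
      by (intro norm_blinfun_bound mat_norm_nonneg) (simp add: L2_set_def)
  qed
  have "norm (\<psi> T) \<le> K * norm T" if "T \<in> A" for T
    using K[of 1 "\<lambda>i j. T", unfolded mat_norm_1] that by blast
  then show ?thesis by blast
qed

lemma completely_bounded_comp:
  assumes \<theta>: "completely_bounded_on F \<theta>" and \<phi>: "completely_bounded_on A \<phi>" and FA: "\<theta> ` F \<subseteq> A"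
  shows "completely_bounded_on F (\<phi> \<circ> \<theta>)"
proof -
  obtain K where K: "\<And>d T. (\<forall>i<d. \<forall>j<d. T i j \<in> F) \<Longrightarrow> mat_norm d (\<lambda>i j. \<theta> (T i j)) \<le> K * mat_norm d T"
    using \<theta> unfolding completely_bounded_on_def by blast
  obtain L where L: "\<And>d T. (\<forall>i<d. \<forall>j<d. T i j \<in> A) \<Longrightarrow> mat_norm d (\<lambda>i j. \<phi> (T i j)) \<le> L * mat_norm d T"
    using \<phi> unfolding completely_bounded_on_def by blast
  have "mat_norm d (\<lambda>i j. \<phi> (\<theta> (T i j))) \<le> \<bar>L\<bar> * K * mat_norm d T" if T: "\<forall>i<d. \<forall>j<d. T i j \<in> F" for d T
  proof -
    have "mat_norm d (\<lambda>i j. \<phi> (\<theta> (T i j))) \<le> L * mat_norm d (\<lambda>i j. \<theta> (T i j))"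
      using T FA by (intro L) blast
    also have "\<dots> \<le> \<bar>L\<bar> * mat_norm d (\<lambda>i j. \<theta> (T i j))"
      by (intro mult_right_mono mat_norm_nonneg) simp
    also have "\<dots> \<le> \<bar>L\<bar> * (K * mat_norm d T)"
      by (intro mult_left_mono K T) simp
    finally show ?thesis by (simp add: ac_simps)
  qed
  moreover have "op_linear_on F (\<phi> \<circ> \<theta>)"
    using \<theta> \<phi> FA unfolding completely_bounded_on_def op_linear_on_def image_subset_iff by simp
  ultimately show ?thesis unfolding completely_bounded_on_def by auto
qed

lemma mat_norm_cong:
  "(\<And>i j. i < d \<Longrightarrow> j < d \<Longrightarrow> S i j = T i j) \<Longrightarrow> mat_norm d S = mat_norm d T"
  unfolding mat_norm_def
  by (intro arg_cong[of _ _ Sup] image_cong refl L2_set_cong arg_cong[of _ _ norm] sum.cong) auto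

theorem theorem2p4:
  fixes A :: "('a::chilbert_space \<Rightarrow>\<^sub>L 'a) set"
    and B :: "('b::chilbert_space \<Rightarrow>\<^sub>L 'b) set"
    and F :: "('c::chilbert_space \<Rightarrow>\<^sub>L 'c) set"
    and \<theta> :: "('c \<Rightarrow>\<^sub>L 'c) \<Rightarrow> ('a \<Rightarrow>\<^sub>L 'a)"
    and \<phi> :: "('a \<Rightarrow>\<^sub>L 'a) \<Rightarrow> ('b \<Rightarrow>\<^sub>L 'b)"
  assumes "unital_operator_algebra A"
    and "unital_operator_algebra B"
    and "uniform_algebra F"
    and "unital_cb_isomorphism F A \<theta>"
    and "unital_cb_isomorphism A B \<phi>"
  shows "\<exists>X X' Y Y'. inverse_ops X X' \<and> inverse_ops Y Y' \<and>
    (\<exists>\<psi>. (\<forall>a\<in>A. \<psi> (X o\<^sub>L a o\<^sub>L X') = Y o\<^sub>L \<phi> a o\<^sub>L Y') \<and>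
      \<psi> ` ((\<lambda>a. X o\<^sub>L a o\<^sub>L X') ` A) = (\<lambda>b. Y o\<^sub>L b o\<^sub>L Y') ` B \<and>
      completely_isometric_on ((\<lambda>a. X o\<^sub>L a o\<^sub>L X') ` A) \<psi>)"
proof -
  note A = assms(1) and B = assms(2) and F = assms(3)
  have \<theta>: "bij_betw \<theta> F A" "\<theta> id_blinfun = id_blinfun"
    "\<And>S T. S \<in> F \<Longrightarrow> T \<in> F \<Longrightarrow> \<theta> (S o\<^sub>L T) = \<theta> S o\<^sub>L \<theta> T"
    "completely_bounded_on F \<theta>" "completely_bounded_on A (inv_into F \<theta>)"
    using assms(4) by (auto simp: unital_cb_isomorphism_def)
  have \<phi>: "bij_betw \<phi> A B" "\<phi> id_blinfun = id_blinfun"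
    "\<And>S T. S \<in> A \<Longrightarrow> T \<in> A \<Longrightarrow> \<phi> (S o\<^sub>L T) = \<phi> S o\<^sub>L \<phi> T"
    "completely_bounded_on A \<phi>" "completely_bounded_on B (inv_into A \<phi>)"
    using assms(5) by (auto simp: unital_cb_isomorphism_def)
  have \<theta>_in: "\<theta> f \<in> A" if "f \<in> F" for f using \<theta>(1) that by (rule bij_betw_apply)
  have \<phi>_in: "\<phi> a \<in> B" if "a \<in> A" for a using \<phi>(1) that by (rule bij_betw_apply)
  have A_ops: "a \<in> bounded_ops" if "a \<in> A" for a using A that by (auto simp: unital_operator_algebra_def)
  have B_ops: "b \<in> bounded_ops" if "b \<in> B" for b using B that by (auto simp: unital_operator_algebra_def)
  obtain K where K: "\<And>a. a \<in> A \<Longrightarrow> norm (inv_into F \<theta> a) \<le> K * norm a"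
    using completely_bounded_imp_bounded[OF \<theta>(5)] by blast
  obtain L where L: "\<And>b. b \<in> B \<Longrightarrow> norm (inv_into A \<phi> b) \<le> L * norm b"
    using completely_bounded_imp_bounded[OF \<phi>(5)] by blast
  have below\<theta>: "norm f \<le> K * norm (\<theta> f)" if "f \<in> F" for f
    using K[OF \<theta>_in[OF that]] bij_betw_inv_into_left[OF \<theta>(1) that] by simp
  have below\<phi>: "norm a \<le> L * norm (\<phi> a)" if "a \<in> A" for a
    using L[OF \<phi>_in[OF that]] bij_betw_inv_into_left[OF \<phi>(1) that] by simp
  obtain X X' where X: "inverse_ops X X'"
    "\<And>d T. (\<forall>i<d. \<forall>j<d. T i j \<in> F) \<Longrightarrow> mat_norm d (\<lambda>i j. X o\<^sub>L \<theta> (T i j) o\<^sub>L X') = mat_norm d T"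
    using uniform_algebra_similarity[OF F \<theta>(4,2,3) A_ops[OF \<theta>_in] below\<theta>] by blast
  have "\<exists>Y Y'. inverse_ops Y Y' \<and> (\<forall>d T. (\<forall>i<d. \<forall>j<d. T i j \<in> F) \<longrightarrow>
      mat_norm d (\<lambda>i j. Y o\<^sub>L (\<phi> \<circ> \<theta>) (T i j) o\<^sub>L Y') = mat_norm d T)"
  proof (rule uniform_algebra_similarity[OF F])
    show "completely_bounded_on F (\<phi> \<circ> \<theta>)"
      by (rule completely_bounded_comp[OF \<theta>(4) \<phi>(4)]) (use \<theta>_in in auto)
    show "(\<phi> \<circ> \<theta>) id_blinfun = id_blinfun" by (simp add: \<theta>(2) \<phi>(2))
    show "(\<phi> \<circ> \<theta>) (S o\<^sub>L T) = (\<phi> \<circ> \<theta>) S o\<^sub>L (\<phi> \<circ> \<theta>) T" if "S \<in> F" "T \<in> F" for S T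
      using that by (simp add: \<theta>(3) \<phi>(3) \<theta>_in)
    fix f assume f: "f \<in> F"
    show "(\<phi> \<circ> \<theta>) f \<in> bounded_ops" using f by (simp add: B_ops \<phi>_in \<theta>_in)
    have "norm f \<le> \<bar>K\<bar> * norm (\<theta> f)"
      using below\<theta>[OF f] mult_right_mono[OF abs_ge_self norm_ge_zero] by (rule order_trans)
    also have "\<dots> \<le> \<bar>K\<bar> * (L * norm (\<phi> (\<theta> f)))" by (intro mult_left_mono below\<phi> \<theta>_in f) simp
    finally show "norm f \<le> (\<bar>K\<bar> * L) * norm ((\<phi> \<circ> \<theta>) f)" by (simp add: ac_simps)
  qed
  then obtain Y Y' where Y: "inverse_ops Y Y'"
    "\<And>d T. (\<forall>i<d. \<forall>j<d. T i j \<in> F) \<Longrightarrow> mat_norm d (\<lambda>i j. Y o\<^sub>L (\<phi> \<circ> \<theta>) (T i j) o\<^sub>L Y') = mat_norm d T"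
    by blast
  define \<psi> where "\<psi> S = Y o\<^sub>L \<phi> (X' o\<^sub>L S o\<^sub>L X) o\<^sub>L Y'" for S
  have XX': "X' (X y) = y" for y
    using X(1) unfolding inverse_ops_def by (metis blinfun_apply_blinfun_compose blinfun_apply_id_blinfun)
  have "X' o\<^sub>L (X o\<^sub>L a o\<^sub>L X') o\<^sub>L X = a" for a by (rule blinfun_eqI) (simp add: XX')
  then have \<psi>: "\<psi> (X o\<^sub>L a o\<^sub>L X') = Y o\<^sub>L \<phi> a o\<^sub>L Y'" for a by (simp add: \<psi>_def)
  have conj_add: "(Z o\<^sub>L S o\<^sub>L Z') + (Z o\<^sub>L T o\<^sub>L Z') = Z o\<^sub>L (S + T) o\<^sub>L Z'"
    for Z S T Z' :: "'x::real_normed_vector \<Rightarrow>\<^sub>L 'x"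
    by (rule blinfun_eqI) (simp add: blinfun.add_left blinfun.add_right)
  have conj_scale: "scaleC_op c (Z o\<^sub>L S o\<^sub>L Z') = Z o\<^sub>L scaleC_op c S o\<^sub>L Z'"
    if "Z \<in> bounded_ops" for c and Z S Z' :: "'x::complex_inner \<Rightarrow>\<^sub>L 'x"
    by (rule blinfun_eqI) (simp add: scaleC_op.rep_eq bounded_opsD[OF that])
  have lin: "op_linear_on ((\<lambda>a. X o\<^sub>L a o\<^sub>L X') ` A) \<psi>"
    unfolding op_linear_on_def
  proof (intro conjI ballI allI; elim imageE)
    fix S T a b assume "S = X o\<^sub>L a o\<^sub>L X'" "T = X o\<^sub>L b o\<^sub>L X'" "a \<in> A" "b \<in> A"
    then show "\<psi> (S + T) = \<psi> S + \<psi> T"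
      using \<phi>(4) by (simp add: conj_add \<psi> completely_bounded_on_def op_linear_on_def)
  next
    fix c T a assume "T = X o\<^sub>L a o\<^sub>L X'" "a \<in> A"
    then show "\<psi> (scaleC_op c T) = scaleC_op c (\<psi> T)"
      using \<phi>(4) X(1) Y(1)
      by (simp add: conj_scale \<psi> completely_bounded_on_def op_linear_on_def inverse_ops_def)
  qed
  have iso: "mat_norm d (\<lambda>i j. \<psi> (T i j)) = mat_norm d T"
    if T: "\<forall>i<d. \<forall>j<d. T i j \<in> (\<lambda>a. X o\<^sub>L a o\<^sub>L X') ` A" for d T
  proof -
    \<comment> \<open>Every matrix over the conjugate of \<open>A\<close> comes from a matrix over \<open>F\<close>, with which both sides are compared.\<close>
    have "\<forall>i j. \<exists>f. i < d \<and> j < d \<longrightarrow> f \<in> F \<and> T i j = X o\<^sub>L \<theta> f o\<^sub>L X'"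
      using T \<theta>(1) by (auto simp: bij_betw_def image_iff)
    then obtain f where f: "\<And>i j. i < d \<and> j < d \<longrightarrow> f i j \<in> F \<and> T i j = X o\<^sub>L \<theta> (f i j) o\<^sub>L X'"
      by metis
    have "mat_norm d (\<lambda>i j. \<psi> (T i j)) = mat_norm d (\<lambda>i j. Y o\<^sub>L (\<phi> \<circ> \<theta>) (f i j) o\<^sub>L Y')"
      using f by (intro mat_norm_cong) (simp add: \<psi>)
    also have "\<dots> = mat_norm d f" using f by (intro Y(2)) blast
    also have "\<dots> = mat_norm d (\<lambda>i j. X o\<^sub>L \<theta> (f i j) o\<^sub>L X')" using f by (intro X(2)[symmetric]) blast
    also have "\<dots> = mat_norm d T" using f by (intro mat_norm_cong) simp
    finally show ?thesis .
  qed
  have "\<psi> ` ((\<lambda>a. X o\<^sub>L a o\<^sub>L X') ` A) = (\<lambda>b. Y o\<^sub>L b o\<^sub>L Y') ` B"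
    using bij_betw_imp_surj_on[OF \<phi>(1)] by (auto simp: image_image \<psi>)
  then show ?thesis
    using X(1) Y(1) \<psi> lin iso unfolding completely_isometric_on_def by blast
qed

end
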